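(* Let $\mathfrak G$ be an $\omega$-categorical abelian group. Then $(\mathfrak G,\neq)$ has a pseudo-Siggers polymorphism if and only if $\mathrm{Pol}(\mathfrak G,\neq)$ has no uniformly continuous minor-preserving map to $\mathscr P$, the clone of projections on a two-element set.
   Context: A countable (finite or infinite) structure is $\omega$-categorical if all countably infinite models of its first-order theory are isomorphic (finite structures are included). $(\mathfrak G,\neq)$ is the expansion of the group $\mathfrak G$ by the disequality relation on its domain. $\mathrm{Pol}(\mathfrak B)$ is the clone of all polymorphisms of $\mathfrak B$, i.e., of all operations $f\colon B^k\to B$, $k\ge 1$, that are homomorphisms $\mathfrak B^k\to\mathfrak B$. A pseudo-Siggers polymorphism of $\mathfrak B$ is a polymorphism $s\colon B^6\to B$ for which there are endomorphisms $e_1,e_2$ of $\mathfrak B$ with $e_1(s(x,y,x,z,y,z))=e_2(s(y,x,z,x,z,y))$ for all $x,y,z\in B$. $\mathscr P$ is the clone of all projections on a two-element set. A map $\xi$ between clones is minor-preserving if it preserves arities and $\xi(f(p_1,\dots,p_n))=\xi(f)(p_1,\dots,p_n)$ for all $n$-ary $f$ and all projections $p_1,\dots,p_n$ of the same arity $m$ (on the right-hand side, the corresponding projections of the target clone). A map $\xi\colon\mathscr C\to\mathscr P$ from a clone $\mathscr C$ on a set $C$ is uniformly continuous if there is a finite set $F\subseteq C$ such that whenever $f,g\in\mathscr C$ have the same arity $n$ and agree on $F^n$, then $\xi(f)=\xi(g)$. *)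

theory Defs
  imports "HOL-Algebra.Group" "HOL-Library.Countable_Set" "HOL-Library.FuncSet"
begin

section \<open>First-order structures\<close>

record ('f, 'r) signature =
  fsyms :: "'f set"
  rsyms :: "'r set"
  farity :: "'f \<Rightarrow> nat"
  rarity :: "'r \<Rightarrow> nat"

record ('a, 'f, 'r) fo_struct =
  univ :: "'a set"
  fint :: "'f \<Rightarrow> 'a list \<Rightarrow> 'a"
  rint :: "'r \<Rightarrow> 'a list set"

definition tuples :: "'a set \<Rightarrow> nat \<Rightarrow> 'a list set" where
  "tuples A n = {xs. length xs = n \<and> set xs \<subseteq> A}"

text \<open>Interpretations of symbols outside the signature, and values of functions outside
  the tuples of the correct length over the universe, are irrelevant.\<close>

definition is_struct :: "('f, 'r) signature \<Rightarrow> ('a, 'f, 'r) fo_struct \<Rightarrow> bool" where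
  "is_struct S A \<longleftrightarrow> univ A \<noteq> {} \<and>
     (\<forall>f\<in>fsyms S. \<forall>xs\<in>tuples (univ A) (farity S f). fint A f xs \<in> univ A) \<and>
     (\<forall>r\<in>rsyms S. rint A r \<subseteq> tuples (univ A) (rarity S r))"

definition fo_hom ::
  "('f, 'r) signature \<Rightarrow> ('a, 'f, 'r) fo_struct \<Rightarrow> ('b, 'f, 'r) fo_struct \<Rightarrow> ('a \<Rightarrow> 'b) \<Rightarrow> bool" where
  "fo_hom S A B h \<longleftrightarrow> h \<in> univ A \<rightarrow> univ B \<and>
     (\<forall>f\<in>fsyms S. \<forall>xs\<in>tuples (univ A) (farity S f). h (fint A f xs) = fint B f (map h xs)) \<and>
     (\<forall>r\<in>rsyms S. \<forall>xs\<in>tuples (univ A) (rarity S r). xs \<in> rint A r \<longrightarrow> map h xs \<in> rint B r)"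

definition fo_iso ::
  "('f, 'r) signature \<Rightarrow> ('a, 'f, 'r) fo_struct \<Rightarrow> ('b, 'f, 'r) fo_struct \<Rightarrow> ('a \<Rightarrow> 'b) \<Rightarrow> bool" where
  "fo_iso S A B h \<longleftrightarrow> bij_betw h (univ A) (univ B) \<and>
     (\<forall>f\<in>fsyms S. \<forall>xs\<in>tuples (univ A) (farity S f). h (fint A f xs) = fint B f (map h xs)) \<and>
     (\<forall>r\<in>rsyms S. \<forall>xs\<in>tuples (univ A) (rarity S r). xs \<in> rint A r \<longleftrightarrow> map h xs \<in> rint B r)"

text \<open>The universe of the \<open>k\<close>-th power consists of the extensional functions on \<open>{..<k}\<close>.\<close>

definition power_struct :: "('a, 'f, 'r) fo_struct \<Rightarrow> nat \<Rightarrow> (nat \<Rightarrow> 'a, 'f, 'r) fo_struct" where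
  "power_struct A k =
     \<lparr>univ = {..<k} \<rightarrow>\<^sub>E univ A,
      fint = (\<lambda>f xs. \<lambda>i\<in>{..<k}. fint A f (map (\<lambda>x. x i) xs)),
      rint = (\<lambda>r. {xs \<in> lists ({..<k} \<rightarrow>\<^sub>E univ A). \<forall>i<k. map (\<lambda>x. x i) xs \<in> rint A r})\<rparr>"


section \<open>First-order logic and omega-categoricity\<close>

datatype 'f fo_term = Var nat | App 'f "'f fo_term list"

datatype ('f, 'r) fo_form =
    Equal "'f fo_term" "'f fo_term"
  | Rel 'r "'f fo_term list"
  | Neg "('f, 'r) fo_form"
  | Conj "('f, 'r) fo_form" "('f, 'r) fo_form"
  | Exists nat "('f, 'r) fo_form"

primrec term_vars :: "'f fo_term \<Rightarrow> nat set" where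
  "term_vars (Var x) = {x}"
| "term_vars (App f ts) = \<Union> (set (map term_vars ts))"

primrec wf_term :: "('f, 'r) signature \<Rightarrow> 'f fo_term \<Rightarrow> bool" where
  "wf_term S (Var x) \<longleftrightarrow> True"
| "wf_term S (App f ts) \<longleftrightarrow> f \<in> fsyms S \<and> length ts = farity S f \<and> list_all id (map (wf_term S) ts)"

primrec eval_term :: "('a, 'f, 'r) fo_struct \<Rightarrow> (nat \<Rightarrow> 'a) \<Rightarrow> 'f fo_term \<Rightarrow> 'a" where
  "eval_term A v (Var x) = v x"
| "eval_term A v (App f ts) = fint A f (map (eval_term A v) ts)"

primrec free_vars :: "('f, 'r) fo_form \<Rightarrow> nat set" where
  "free_vars (Equal s t) = term_vars s \<union> term_vars t"
| "free_vars (Rel r ts) = \<Union> (set (map term_vars ts))"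
| "free_vars (Neg p) = free_vars p"
| "free_vars (Conj p q) = free_vars p \<union> free_vars q"
| "free_vars (Exists x p) = free_vars p - {x}"

primrec wf_form :: "('f, 'r) signature \<Rightarrow> ('f, 'r) fo_form \<Rightarrow> bool" where
  "wf_form S (Equal s t) \<longleftrightarrow> wf_term S s \<and> wf_term S t"
| "wf_form S (Rel r ts) \<longleftrightarrow> r \<in> rsyms S \<and> length ts = rarity S r \<and> list_all (wf_term S) ts"
| "wf_form S (Neg p) \<longleftrightarrow> wf_form S p"
| "wf_form S (Conj p q) \<longleftrightarrow> wf_form S p \<and> wf_form S q"
| "wf_form S (Exists x p) \<longleftrightarrow> wf_form S p"

primrec sat :: "('a, 'f, 'r) fo_struct \<Rightarrow> (nat \<Rightarrow> 'a) \<Rightarrow> ('f, 'r) fo_form \<Rightarrow> bool" where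
  "sat A v (Equal s t) \<longleftrightarrow> eval_term A v s = eval_term A v t"
| "sat A v (Rel r ts) \<longleftrightarrow> map (eval_term A v) ts \<in> rint A r"
| "sat A v (Neg p) \<longleftrightarrow> \<not> sat A v p"
| "sat A v (Conj p q) \<longleftrightarrow> sat A v p \<and> sat A v q"
| "sat A v (Exists x p) \<longleftrightarrow> (\<exists>a\<in>univ A. sat A (v(x := a)) p)"

definition sentence :: "('f, 'r) signature \<Rightarrow> ('f, 'r) fo_form \<Rightarrow> bool" where
  "sentence S p \<longleftrightarrow> wf_form S p \<and> free_vars p = {}"

definition holds :: "('a, 'f, 'r) fo_struct \<Rightarrow> ('f, 'r) fo_form \<Rightarrow> bool" where
  "holds A p \<longleftrightarrow> (\<forall>v. range v \<subseteq> univ A \<longrightarrow> sat A v p)"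

definition fo_theory :: "('f, 'r) signature \<Rightarrow> ('a, 'f, 'r) fo_struct \<Rightarrow> ('f, 'r) fo_form set" where
  "fo_theory S A = {p. sentence S p \<and> holds A p}"

definition is_model ::
  "('f, 'r) signature \<Rightarrow> ('a, 'f, 'r) fo_struct \<Rightarrow> ('f, 'r) fo_form set \<Rightarrow> bool" where
  "is_model S M T \<longleftrightarrow> is_struct S M \<and> (\<forall>p\<in>T. holds M p)"

text \<open>A definition cannot quantify over types. Every countably infinite structure
  is isomorphic to one whose universe is an infinite set of natural numbers, so quantifying over
  the latter covers all countably infinite models. For finite \<open>A\<close> the theory has no infinite
  models and the condition holds vacuously.\<close>

definition omega_categorical ::
  "('f, 'r) signature \<Rightarrow> ('a, 'f, 'r) fo_struct \<Rightarrow> bool" where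
  "omega_categorical S A \<longleftrightarrow> is_struct S A \<and> countable (univ A) \<and>
     (\<forall>(M :: (nat, 'f, 'r) fo_struct) (N :: (nat, 'f, 'r) fo_struct).
        is_model S M (fo_theory S A) \<and> infinite (univ M) \<and>
        is_model S N (fo_theory S A) \<and> infinite (univ N)
        \<longrightarrow> (\<exists>h. fo_iso S M N h))"


section \<open>Operations, clones and polymorphisms\<close>

text \<open>An \<open>n\<close>-ary operation on \<open>B\<close> is an element of \<open>({..<n} \<rightarrow>\<^sub>E B) \<rightarrow>\<^sub>E B\<close>, and a clone is given
  as the family of its sets of \<open>n\<close>-ary operations. There are no operations of arity \<open>0\<close>.\<close>

type_synonym 'a operation = "(nat \<Rightarrow> 'a) \<Rightarrow> 'a"

type_synonym 'a clone = "nat \<Rightarrow> 'a operation set"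

definition projection :: "'a set \<Rightarrow> nat \<Rightarrow> nat \<Rightarrow> 'a operation" where
  "projection B n i = (\<lambda>x\<in>{..<n} \<rightarrow>\<^sub>E B. x i)"

definition projection_clone :: "'a set \<Rightarrow> 'a clone" where
  "projection_clone B n = projection B n ` {..<n}"

text \<open>\<open>op_comp B n m f g\<close> is the \<open>m\<close>-ary operation \<open>f(g\<^sub>0, \<dots>, g\<^sub>n\<^sub>-\<^sub>1)\<close>.\<close>

definition op_comp ::
  "'a set \<Rightarrow> nat \<Rightarrow> nat \<Rightarrow> 'a operation \<Rightarrow> (nat \<Rightarrow> 'a operation) \<Rightarrow> 'a operation" where
  "op_comp B n m f g = (\<lambda>x\<in>{..<m} \<rightarrow>\<^sub>E B. f (\<lambda>i\<in>{..<n}. g i x))"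

definition Pol :: "('f, 'r) signature \<Rightarrow> ('a, 'f, 'r) fo_struct \<Rightarrow> 'a clone" where
  "Pol S A k =
     {f \<in> ({..<k} \<rightarrow>\<^sub>E univ A) \<rightarrow>\<^sub>E univ A. 1 \<le> k \<and> fo_hom S (power_struct A k) A f}"

definition apply6 :: "'a operation \<Rightarrow> 'a \<Rightarrow> 'a \<Rightarrow> 'a \<Rightarrow> 'a \<Rightarrow> 'a \<Rightarrow> 'a \<Rightarrow> 'a" where
  "apply6 s a b c d e f = s (\<lambda>i\<in>{..<6}. [a, b, c, d, e, f] ! i)"

definition pseudo_Siggers ::
  "('f, 'r) signature \<Rightarrow> ('a, 'f, 'r) fo_struct \<Rightarrow> 'a operation \<Rightarrow> bool" where
  "pseudo_Siggers S A s \<longleftrightarrow> s \<in> Pol S A 6 \<and>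
     (\<exists>e1 e2. fo_hom S A A e1 \<and> fo_hom S A A e2 \<and>
        (\<forall>x\<in>univ A. \<forall>y\<in>univ A. \<forall>z\<in>univ A.
           e1 (apply6 s x y x z y z) = e2 (apply6 s y x z x z y)))"

text \<open>The arity is an explicit argument of \<open>\<xi>\<close>. An \<open>n\<close>-tuple of \<open>m\<close>-ary projections is
  given by the map \<open>\<sigma>\<close> of its indices.\<close>

definition minor_preserving ::
  "'a set \<Rightarrow> 'a clone \<Rightarrow> 'b set \<Rightarrow> 'b clone \<Rightarrow> (nat \<Rightarrow> 'a operation \<Rightarrow> 'b operation) \<Rightarrow> bool" where
  "minor_preserving B C B' C' \<xi> \<longleftrightarrow>
     (\<forall>n. \<xi> n \<in> C n \<rightarrow> C' n) \<and>
     (\<forall>n m. \<forall>f\<in>C n. \<forall>\<sigma> \<in> {..<n} \<rightarrow> {..<m}.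
        \<xi> m (op_comp B n m f (\<lambda>i. projection B m (\<sigma> i))) =
        op_comp B' n m (\<xi> n f) (\<lambda>i. projection B' m (\<sigma> i)))"

definition uniformly_continuous_clone_map ::
  "'a set \<Rightarrow> 'a clone \<Rightarrow> (nat \<Rightarrow> 'a operation \<Rightarrow> 'b operation) \<Rightarrow> bool" where
  "uniformly_continuous_clone_map B C \<xi> \<longleftrightarrow>
     (\<exists>F. finite F \<and> F \<subseteq> B \<and>
        (\<forall>n. \<forall>f\<in>C n. \<forall>g\<in>C n. (\<forall>x\<in>{..<n} \<rightarrow>\<^sub>E F. f x = g x) \<longrightarrow> \<xi> n f = \<xi> n g))"


section \<open>Groups as structures\<close>

datatype group_fsym = Mult | Inv | One

datatype neq_rsym = Disequal

definition group_sig :: "(group_fsym, neq_rsym) signature" where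
  "group_sig = \<lparr>fsyms = UNIV, rsyms = {},
     farity = (\<lambda>f. case f of Mult \<Rightarrow> 2 | Inv \<Rightarrow> 1 | One \<Rightarrow> 0), rarity = (\<lambda>_. 2)\<rparr>"

definition group_neq_sig :: "(group_fsym, neq_rsym) signature" where
  "group_neq_sig = group_sig\<lparr>rsyms := {Disequal}\<rparr>"

definition group_struct ::
  "('a, 'b) monoid_scheme \<Rightarrow> ('a, group_fsym, neq_rsym) fo_struct" where
  "group_struct G = \<lparr>univ = carrier G,
     fint = (\<lambda>f xs. case f of
        Mult \<Rightarrow> xs ! 0 \<otimes>\<^bsub>G\<^esub> xs ! 1
      | Inv \<Rightarrow> inv\<^bsub>G\<^esub> (xs ! 0)
      | One \<Rightarrow> \<one>\<^bsub>G\<^esub>),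
     rint = (\<lambda>_. {})\<rparr>"

definition group_neq_struct ::
  "('a, 'b) monoid_scheme \<Rightarrow> ('a, group_fsym, neq_rsym) fo_struct" where
  "group_neq_struct G = (group_struct G)
     \<lparr>rint := (\<lambda>_. {[x, y] | x y. x \<in> carrier G \<and> y \<in> carrier G \<and> x \<noteq> y})\<rparr>"

end

theory Submission
  imports Defs
    "HOL-Library.Countable"
    "HOL-Library.Nat_Bijection"
    "HOL-Computational_Algebra.Primes"
    "HOL-Algebra.Multiplicative_Group"
    "HOL-Algebra.Product_Groups"
begin

text \<open>In additive notation, the polymorphisms of \<open>(G, \<noteq>)\<close> are the homomorphisms
  \<open>G\<^sup>k \<rightarrow> G\<close> whose kernel contains no tuple without zero entries. An
  \<open>\<omega>\<close>-categorical group has bounded exponent, since otherwise some type of pairs is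
  a limit of infinitely many others, and can be both realised and omitted in countable models.
  Let \<open>m\<close> be the least positive number such that the core \<open>D = mG\<close> is finite. Every
  polymorphism maps powers of \<open>D\<close> to \<open>D\<close>.

  If \<open>D\<close> has at least three elements, then every polymorphism depends on exactly one
  argument on \<open>D\<close>; this argument defines a uniformly continuous minor-preserving map and
  rules out a pseudo-Siggers polymorphism.

  If \<open>D\<close> has at most two elements, then \<open>G\<close> contains a large subgroup that behaves like an
  injective module, and so homomorphisms \<open>G\<^sup>k \<rightarrow> G\<close> can be constructed with any kernel that
  is compatible with \<open>D\<close>. A suitable kernel inside \<open>D\<^sup>6\<close> gives a pseudo-Siggers
  polymorphism, where the outer endomorphisms come from an amalgam of two copies of \<open>G\<close>; a
  suitable kernel inside \<open>D\<^sup>3\<close> gives four ternary polymorphisms with two common binary minors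
  on which no map to projections can act consistently.\<close>

text \<open>Both models of the type argument are limits of the given structure along ultrafilters on
  valuations: one along valuations that begin with the given pairs, the other along valuations
  forced to violate the limit type at every pair of coordinates.

  A homomorphism with a prescribed kernel is built by prime steps, and each new value must avoid the
  image used so far. Minimality of \<open>m\<close> provides the room: since
  \<open>powers (m div p)\<close> is infinite for every prime divisor \<open>p\<close>, a maximal
  subgroup with Baer's property has infinite \<open>p\<close>-torsion. The obstacle is that the
  group need not have exponent \<open>m\<close>, as \<open>m\<close>-th powers may hit the
  nontrivial core element \<open>d\<close>. Therefore an element \<open>g0\<close> with
  \<open>g0 [^] m = d\<close> is fixed in advance as the image of some \<open>k0\<close>, and other
  elements are corrected by powers of \<open>k0\<close> until their \<open>m\<close>-th power lies
  in the kernel.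

  The threshold for the core is a matter of parity: when \<open>d\<close> is its own inverse, an
  equation with an odd number of terms excludes the tuple with all entries \<open>d\<close>. Two
  distinct nontrivial core elements already give enough freedom to solve any such equation.\<close>

instance fo_term :: (countable) countable
  by countable_datatype

instance fo_form :: (countable, countable) countable
  by countable_datatype

subsection \<open>Ultrafilters\<close>

definition ultra :: "'x filter \<Rightarrow> bool" where
  "ultra U \<longleftrightarrow> U \<noteq> bot \<and> (\<forall>P. eventually P U \<or> eventually (\<lambda>x. \<not> P x) U)"

lemma ultra_not:
  assumes "ultra U"
  shows "eventually (\<lambda>x. \<not> P x) U \<longleftrightarrow> \<not> eventually P U"
proof
  assume not_P: "eventually (\<lambda>x. \<not> P x) U"
  show "\<not> eventually P U"
  proof
    assume "eventually P U"
    with not_P have "eventually (\<lambda>x. False) U"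
      by eventually_elim simp
    with assms show False
      by (simp add: ultra_def eventually_False)
  qed
qed (use assms in \<open>auto simp: ultra_def\<close>)

text \<open>Smaller filters are finer, so ultrafilters are the minimal proper filters and Zorn's
  lemma is applied to the reversed order. The infimum of a chain stays proper because what holds
  eventually in it already does so in one member. A minimal \<open>U\<close> decides
  \<open>P\<close>: either it is incompatible with \<open>P\<close>, or its restriction to
  \<open>P\<close> is proper and hence equal to \<open>U\<close>.\<close>

lemma ultra_exists_le:
  fixes F :: "'x filter"
  assumes "F \<noteq> bot"
  shows "\<exists>U\<le>F. ultra U"
proof -
  define Z where "Z = {U. U \<noteq> bot \<and> U \<le> F}"
  have "\<exists>U\<in>Z. \<forall>V\<in>Z. V \<le> U \<longrightarrow> V = U"
  proof -
    have *: "\<exists>l\<in>Z. \<forall>V\<in>C. l \<le> V" if C: "C \<subseteq> Z" "\<And>V W. V \<in> C \<Longrightarrow> W \<in> C \<Longrightarrow> V \<le> W \<or> W \<le> V" for C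
    proof (cases "C = {}")
      case True
      then show ?thesis using assms by (auto simp: Z_def)
    next
      case False
      have "Inf C \<noteq> bot"
      proof
        assume "Inf C = bot"
        then have "eventually (\<lambda>x. False) (Inf C)"
          by simp
        then obtain V where "V \<in> C" "eventually (\<lambda>x. False) V"
          using eventually_Inf_base[of C "\<lambda>x. False"] False C(2)
          by (metis inf.absorb1 inf.absorb2 order_refl)
        then show False
          using C(1) by (auto simp: Z_def eventually_False)
      qed
      moreover have "Inf C \<le> F"
        using False C(1) by (auto simp: Z_def intro: Inf_lower2)
      ultimately show ?thesis
        by (intro bexI[of _ "Inf C"]) (auto simp: Z_def Inf_lower)
    qed
    have po: "partial_order_on Z {(V, W). V \<in> Z \<and> W \<in> Z \<and> W \<le> V}"
      by (auto simp: partial_order_on_def preorder_on_def refl_on_def trans_def antisym_def)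
    have Fi: "Field {(V, W). V \<in> Z \<and> W \<in> Z \<and> W \<le> V} = Z"
      by (auto simp: Field_def)
    have "\<exists>m\<in>Field {(V, W). V \<in> Z \<and> W \<in> Z \<and> W \<le> V}.
        \<forall>a\<in>Field {(V, W). V \<in> Z \<and> W \<in> Z \<and> W \<le> V}. (m, a) \<in> {(V, W). V \<in> Z \<and> W \<in> Z \<and> W \<le> V} \<longrightarrow> a = m"
    proof (rule Zorns_po_lemma)
      show "Partial_order {(V, W). V \<in> Z \<and> W \<in> Z \<and> W \<le> V}"
        using po by (simp add: Fi)
      fix C assume "C \<in> Chains {(V, W). V \<in> Z \<and> W \<in> Z \<and> W \<le> V}"
      then have "C \<subseteq> Z" "\<And>V W. V \<in> C \<Longrightarrow> W \<in> C \<Longrightarrow> V \<le> W \<or> W \<le> V"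
        by (auto simp: Chains_def)
      from *[OF this] \<open>C \<subseteq> Z\<close>
      show "\<exists>u\<in>Field {(V, W). V \<in> Z \<and> W \<in> Z \<and> W \<le> V}. \<forall>a\<in>C. (a, u) \<in> {(V, W). V \<in> Z \<and> W \<in> Z \<and> W \<le> V}"
        by (auto simp: Fi)
    qed
    then show ?thesis
      unfolding Fi by auto
  qed
  then obtain U where U: "U \<noteq> bot" "U \<le> F" and
    min: "\<And>V. V \<noteq> bot \<Longrightarrow> V \<le> F \<Longrightarrow> V \<le> U \<Longrightarrow> V = U"
    by (auto simp: Z_def)
  have "eventually P U \<or> eventually (\<lambda>x. \<not> P x) U" for P
  proof (cases "inf U (principal {x. P x}) = bot")
    case True
    then have "eventually (\<lambda>x. False) (inf U (principal {x. P x}))"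
      by simp
    then show ?thesis
      by (simp add: eventually_inf_principal)
  next
    case False
    then have "inf U (principal {x. P x}) = U"
      using min U(2) by (meson inf.coboundedI1 inf_le1)
    then have "U \<le> principal {x. P x}"
      by (metis inf_le2)
    then show ?thesis
      by (simp add: le_principal)
  qed
  with U show ?thesis
    by (auto simp: ultra_def)
qed

lemma ultra_filtermap: "ultra U \<Longrightarrow> ultra (filtermap f U)"
  by (auto simp: ultra_def filtermap_bot_iff eventually_filtermap)

subsection \<open>Syntax\<close>

lemma eval_term_cong:
  "(\<And>x. x \<in> term_vars t \<Longrightarrow> v x = w x) \<Longrightarrow> eval_term A v t = eval_term A w t"
proof (induction t)
  case (App f ts)
  have "map (eval_term A v) ts = map (eval_term A w) ts"
    using App by (auto intro!: map_cong)
  then show ?case by (simp del: map_eq_conv)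
qed auto

lemma sat_cong:
  "(\<And>x. x \<in> free_vars p \<Longrightarrow> v x = w x) \<Longrightarrow> sat A v p \<longleftrightarrow> sat A w p"
proof (induction p arbitrary: v w)
  case (Equal s t)
  then show ?case by (metis UnI1 UnI2 eval_term_cong free_vars.simps(1) sat.simps(1))
next
  case (Rel r ts)
  have "map (eval_term A v) ts = map (eval_term A w) ts"
    using Rel by (auto intro!: eval_term_cong)
  then show ?case by (simp del: map_eq_conv)
next
  case (Neg p)
  then show ?case by (metis free_vars.simps(3) sat.simps(3))
next
  case (Conj p q)
  then show ?case by (metis UnCI free_vars.simps(4) sat.simps(4))
next
  case (Exists x p)
  have "sat A (v(x := a)) p \<longleftrightarrow> sat A (w(x := a)) p" for a
    using Exists.prems by (intro Exists.IH) auto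
  then show ?case by simp
qed

lemma finite_term_vars: "finite (term_vars t)"
  by (induction t) auto

lemma finite_free_vars: "finite (free_vars p)"
  by (induction p) (auto simp: finite_term_vars)

lemma free_vars_bounded: "\<exists>N. \<forall>x\<in>free_vars p. x < N"
  using finite_free_vars[of p] by (meson finite_nat_set_iff_bounded)

primrec subst_term :: "(nat \<Rightarrow> nat) \<Rightarrow> 'f fo_term \<Rightarrow> 'f fo_term" where
  "subst_term \<sigma> (Var x) = Var (\<sigma> x)"
| "subst_term \<sigma> (App f ts) = App f (map (subst_term \<sigma>) ts)"

lemma eval_subst_term: "eval_term A v (subst_term \<sigma> t) = eval_term A (\<lambda>i. v (\<sigma> i)) t"
proof (induction t)
  case (App f ts)
  then have "map (eval_term A v \<circ> subst_term \<sigma>) ts = map (eval_term A (\<lambda>i. v (\<sigma> i))) ts"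
    by auto
  then show ?case by (simp del: map_eq_conv)
qed auto

lemma wf_subst_term: "wf_term S (subst_term \<sigma> t) \<longleftrightarrow> wf_term S t"
  by (induction t) (auto simp: list_all_iff)

text \<open>Only existence is claimed, because bound variables have to be chosen fresh with respect
  to a renaming that changes at every quantifier.\<close>

lemma subst_form_exists:
  "\<exists>q. (wf_form S p \<longrightarrow> wf_form S q) \<and> (\<forall>v. sat A v q \<longleftrightarrow> sat A (\<lambda>i. v (\<sigma> i)) p)"
proof (induction p arbitrary: \<sigma>)
  case (Equal s t)
  show ?case
    by (rule exI[of _ "Equal (subst_term \<sigma> s) (subst_term \<sigma> t)"])
      (simp add: eval_subst_term wf_subst_term)
next
  case (Rel r ts)
  have "map (eval_term A v) (map (subst_term \<sigma>) ts) = map (eval_term A (\<lambda>i. v (\<sigma> i))) ts" for v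
    by (simp add: eval_subst_term)
  then show ?case
    by (intro exI[of _ "Rel r (map (subst_term \<sigma>) ts)"])
      (simp add: wf_subst_term list_all_iff del: map_map)
next
  case (Neg p)
  then obtain q where "wf_form S p \<longrightarrow> wf_form S q" "\<forall>v. sat A v q \<longleftrightarrow> sat A (\<lambda>i. v (\<sigma> i)) p"
    by blast
  then show ?case by (intro exI[of _ "Neg q"]) simp
next
  case (Conj p p')
  obtain q where "wf_form S p \<longrightarrow> wf_form S q" "\<forall>v. sat A v q \<longleftrightarrow> sat A (\<lambda>i. v (\<sigma> i)) p"
    using Conj(1) by blast
  moreover obtain q' where "wf_form S p' \<longrightarrow> wf_form S q'"
    "\<forall>v. sat A v q' \<longleftrightarrow> sat A (\<lambda>i. v (\<sigma> i)) p'"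
    using Conj(2) by blast
  ultimately show ?case
    by (intro exI[of _ "Conj q q'"]) simp
next
  case (Exists x p)
  \<comment> \<open>Above the images of all free variables of the body, \<open>y\<close> captures
    none of them.\<close>
  obtain y where y: "\<And>z. z \<in> free_vars p \<Longrightarrow> \<sigma> z < y"
    using finite_imageI[OF finite_free_vars, of \<sigma> p] unfolding finite_nat_set_iff_bounded by blast
  obtain q where q: "wf_form S p \<longrightarrow> wf_form S q" "\<And>v. sat A v q \<longleftrightarrow> sat A (\<lambda>i. v ((\<sigma>(x := y)) i)) p"
    using Exists by blast
  have "sat A (\<lambda>i. (v(y := a)) ((\<sigma>(x := y)) i)) p \<longleftrightarrow> sat A ((\<lambda>i. v (\<sigma> i))(x := a)) p" for v a
    by (rule sat_cong) (use y in fastforce)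
  then show ?case
    by (intro exI[of _ "Exists y q"]) (auto simp: q)
qed

lemma sat_Exists_list:
  "sat A v (foldr Exists xs p) \<longleftrightarrow>
    (\<exists>w. (\<forall>x\<in>set xs. w x \<in> univ A) \<and> (\<forall>x. x \<notin> set xs \<longrightarrow> w x = v x) \<and> sat A w p)"
proof (induction xs arbitrary: v)
  case Nil
  have "(\<exists>w. (\<forall>x. w x = v x) \<and> sat A w p) \<longleftrightarrow> sat A v p"
    by (metis ext)
  then show ?case by simp
next
  case (Cons x xs)
  show ?case (is "?l \<longleftrightarrow> ?r")
  proof
    assume ?l
    then obtain a w where "a \<in> univ A" "\<forall>x\<in>set xs. w x \<in> univ A"
      "\<forall>z. z \<notin> set xs \<longrightarrow> w z = (v(x := a)) z" "sat A w p"
      by (auto simp: Cons.IH)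
    then have "w x \<in> univ A"
      by (cases "x \<in> set xs") auto
    with \<open>\<forall>x\<in>set xs. w x \<in> univ A\<close> \<open>\<forall>z. z \<notin> set xs \<longrightarrow> w z = (v(x := a)) z\<close> \<open>sat A w p\<close>
    show ?r
      by (intro exI[of _ w]) (auto split: if_splits)
  next
    assume ?r
    then obtain w where "\<forall>z\<in>set (x # xs). w z \<in> univ A"
      "\<forall>z. z \<notin> set (x # xs) \<longrightarrow> w z = v z" "sat A w p"
      by blast
    then show ?l
      by (auto simp: Cons.IH intro!: bexI[of _ "w x"] exI[of _ w])
  qed
qed

lemma wf_Exists_list: "wf_form S (foldr Exists xs p) \<longleftrightarrow> wf_form S p"
  by (induction xs) auto

lemma eval_term_in_univ:
  assumes "is_struct S A" "wf_term S t" "range v \<subseteq> univ A"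
  shows "eval_term A v t \<in> univ A"
  using assms(2)
proof (induction t)
  case (App f ts)
  then have "map (eval_term A v) ts \<in> tuples (univ A) (farity S f)"
    by (auto simp: tuples_def list_all_iff)
  then show ?case using App.prems assms(1) by (simp add: is_struct_def)
qed (use assms in auto)

lemma fo_iso_sat:
  assumes "fo_iso S M N h" "is_struct S M" "wf_form S p" "range w \<subseteq> univ M"
  shows "sat M w p \<longleftrightarrow> sat N (\<lambda>i. h (w i)) p"
proof -
  have bij: "bij_betw h (univ M) (univ N)"
    using assms(1) by (simp add: fo_iso_def)
  have ev: "h (eval_term M w t) = eval_term N (\<lambda>i. h (w i)) t"
    if "wf_term S t" "range w \<subseteq> univ M" for w t
    using that(1)
  proof (induction t)
    case (App f ts)
    then have "map (eval_term M w) ts \<in> tuples (univ M) (farity S f)"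
      using eval_term_in_univ[OF assms(2) _ that(2)] by (auto simp: tuples_def list_all_iff)
    then have "h (fint M f (map (eval_term M w) ts)) = fint N f (map h (map (eval_term M w) ts))"
      using assms(1) App.prems by (auto simp: fo_iso_def)
    also have "map h (map (eval_term M w) ts) = map (eval_term N (\<lambda>i. h (w i))) ts"
      using App by (auto simp: list_all_iff)
    finally show ?case by simp
  qed simp
  show ?thesis
    using assms(3,4)
  proof (induction p arbitrary: w)
    case (Equal s t)
    then have "eval_term M w s \<in> univ M" "eval_term M w t \<in> univ M"
      using eval_term_in_univ[OF assms(2)] by auto
    then have "eval_term M w s = eval_term M w t \<longleftrightarrow> h (eval_term M w s) = h (eval_term M w t)"
      using bij by (metis bij_betw_imp_inj_on inj_on_eq_iff)
    then show ?case using Equal by (simp add: ev)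
  next
    case (Rel r ts)
    then have "map (eval_term M w) ts \<in> tuples (univ M) (rarity S r)"
      using eval_term_in_univ[OF assms(2)] by (auto simp: tuples_def list_all_iff)
    then have "map (eval_term M w) ts \<in> rint M r \<longleftrightarrow> map h (map (eval_term M w) ts) \<in> rint N r"
      using assms(1) Rel.prems by (auto simp: fo_iso_def)
    also have "map h (map (eval_term M w) ts) = map (eval_term N (\<lambda>i. h (w i))) ts"
      using Rel.prems by (auto simp: list_all_iff ev)
    finally show ?case by simp
  next
    case (Exists x p)
    have "sat M (w(x := a)) p \<longleftrightarrow> sat N ((\<lambda>i. h (w i))(x := h a)) p" if "a \<in> univ M" for a
    proof -
      have "(\<lambda>i. h ((w(x := a)) i)) = (\<lambda>i. h (w i))(x := h a)"
        by auto
      moreover have "range (w(x := a)) \<subseteq> univ M"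
        using Exists.prems that by auto
      ultimately show ?thesis
        using Exists.IH[of "w(x := a)"] Exists.prems(1) by (simp del: fun_upd_apply)
    qed
    moreover have "univ N = h ` univ M"
      using bij by (simp add: bij_betw_def)
    ultimately show ?case by auto
  qed auto
qed

subsection \<open>Generic limits of a structure\<close>

text \<open>Discarding the second component of the decoded pair makes every task recur at
  arbitrarily large \<open>n\<close>, where all variables of its parameter list are
  available.\<close>

definition task :: "nat \<Rightarrow> ('f::countable, 'r::countable) fo_form \<times> nat list \<times> nat" where
  "task n = from_nat (fst (prod_decode n))"

text \<open>The default 0 keeps the renaming below \<open>n\<close> outside the list too, so that a
  condition at \<open>n\<close> never refers to later coordinates.\<close>

definition ren :: "nat list \<Rightarrow> nat \<Rightarrow> nat" where
  "ren l i = (if i < length l then l ! i else 0)"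

text \<open>The coordinate \<open>n\<close> of a valuation serves as the witness of the \<open>n\<close>-th existential task.
  The coordinates 0 and 1 are left free, so that they can be prescribed.\<close>

definition henkin :: "('f::countable, 'r::countable) signature \<Rightarrow> ('a, 'f, 'r) fo_struct \<Rightarrow> nat \<Rightarrow> (nat \<Rightarrow> 'a) \<Rightarrow> bool" where
  "henkin S A n v \<longleftrightarrow> (case task n of (p, l, x) \<Rightarrow>
     2 \<le> n \<and> wf_form S p \<and> set l \<subseteq> {..<n} \<longrightarrow>
     (\<exists>a\<in>univ A. sat A ((\<lambda>i. v (ren l i))(x := a)) p) \<longrightarrow>
     sat A ((\<lambda>i. v (ren l i))(x := v n)) p)"

lemma task_unbounded: "\<exists>n\<ge>N. task n = t"
  by (rule exI[of _ "prod_encode (to_nat t, N)"]) (simp add: task_def le_prod_encode_2)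

lemma ren_less: "set l \<subseteq> {..<n} \<Longrightarrow> 0 < n \<Longrightarrow> ren l i < n"
  by (auto simp: ren_def subset_iff)

text \<open>This locality permits choosing coordinates one at a time, and changing a valuation
  beyond a bound without harming the earlier conditions.\<close>

lemma henkin_cong:
  assumes "\<And>i. i \<le> n \<Longrightarrow> v i = w i"
  shows "henkin S A n v \<longleftrightarrow> henkin S A n w"
proof (cases "task n :: ('b, 'c) fo_form \<times> nat list \<times> nat")
  case (fields p l x)
  show ?thesis
  proof (cases "2 \<le> n \<and> wf_form S p \<and> set l \<subseteq> {..<n}")
    case True
    then have "(\<lambda>i. v (ren l i)) = (\<lambda>i. w (ren l i))"
      using ren_less[of l n] assms by (intro ext) (simp add: less_imp_le)
    then show ?thesis using assms[of n] by (simp add: henkin_def fields)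
  qed (auto simp: henkin_def fields)
qed

text \<open>Each coordinate from \<open>n\<close> on is chosen after all smaller ones: a witness of
  its task if there is one, any element otherwise. By locality later choices do not disturb its
  condition.\<close>

lemma henkin_extend:
  fixes S :: "('f::countable, 'r::countable) signature"
  assumes "is_struct S A" "range v \<subseteq> univ A" "\<And>m. m < n \<Longrightarrow> henkin S A m v"
  shows "\<exists>v'. range v' \<subseteq> univ A \<and> (\<forall>i<n. v' i = v i) \<and> (\<forall>m. henkin S A m v')"
proof -
  let ?P = "\<lambda>f k a. a \<in> univ A \<and> (k < n \<longrightarrow> a = v k) \<and>
    (n \<le> k \<longrightarrow> henkin S A k (\<lambda>i. if i < k then f i else a))"
  have "\<exists>f. \<forall>k. ?P f k (f k)"
  proof (rule dependent_wellorder_choice)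
    fix r and f g :: "nat \<Rightarrow> 'a" and k :: nat
    assume "\<And>y. y < k \<Longrightarrow> f y = g y"
    then have "(\<lambda>i. if i < k then f i else r) = (\<lambda>i. if i < k then g i else r)"
      by auto
    then show "?P f k r = ?P g k r"
      by simp
  next
    fix k and f :: "nat \<Rightarrow> 'a"
    show "\<exists>r. ?P f k r"
    proof (cases "k < n")
      case True
      then show ?thesis using assms(2) by auto
    next
      case False
      obtain p l x where t: "(task k :: ('f, 'r) fo_form \<times> nat list \<times> nat) = (p, l, x)"
        by (cases "task k :: ('f, 'r) fo_form \<times> nat list \<times> nat") auto
      obtain a0 where a0: "a0 \<in> univ A"
        using assms(1) by (auto simp: is_struct_def)
      show ?thesis
      proof (cases "2 \<le> k \<and> wf_form S p \<and> set l \<subseteq> {..<k} \<and> (\<exists>a\<in>univ A. sat A ((\<lambda>i. f (ren l i))(x := a)) p)")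
        case True
        then obtain a where a: "a \<in> univ A" "sat A ((\<lambda>i. f (ren l i))(x := a)) p"
          by blast
        have "(\<lambda>i. if ren l i < k then f (ren l i) else a) = (\<lambda>i. f (ren l i))"
          using True ren_less[of l k] by auto
        then have "henkin S A k (\<lambda>i. if i < k then f i else a)"
          using a by (simp add: henkin_def t)
        with a False show ?thesis by auto
      next
        case no: False
        have "henkin S A k (\<lambda>i. if i < k then f i else a0)"
        proof (cases "2 \<le> k \<and> wf_form S p \<and> set l \<subseteq> {..<k}")
          case True
          then have "(\<lambda>i. if ren l i < k then f (ren l i) else a0) = (\<lambda>i. f (ren l i))"
            using ren_less[of l k] by auto
          then show ?thesis
            using True no by (simp add: henkin_def t)
        qed (auto simp: henkin_def t)
        with a0 False show ?thesis by auto
      qed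
    qed
  qed
  then obtain f where f: "\<And>k. ?P f k (f k)" by blast
  have "henkin S A m f" for m
  proof (cases "m < n")
    case True
    then show ?thesis using f assms(3)[OF True] henkin_cong[of m f v S A] by auto
  next
    case False
    then have "henkin S A m (\<lambda>i. if i < m then f i else f m)"
      using f[of m] by auto
    then show ?thesis using henkin_cong[of m f "\<lambda>i. if i < m then f i else f m" S A] by auto
  qed
  then show ?thesis using f by (intro exI[of _ f]) auto
qed

lemma henkin_form:
  fixes S :: "('f::countable, 'r::countable) signature"
  shows "\<exists>q. wf_form S q \<and> (\<forall>v. sat A v q \<longleftrightarrow> henkin S A n v)"
proof -
  obtain p l x where t: "(task n :: ('f, 'r) fo_form \<times> nat list \<times> nat) = (p, l, x)"
    by (cases "task n :: ('f, 'r) fo_form \<times> nat list \<times> nat") auto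
  show ?thesis
  proof (cases "2 \<le> n \<and> wf_form S p \<and> set l \<subseteq> {..<n}")
    case True
    obtain q1 where q1: "wf_form S q1" "\<And>v. sat A v q1 \<longleftrightarrow> sat A (\<lambda>i. v (ren l i)) (Exists x p)"
      using subst_form_exists[of S "Exists x p" A "ren l"] True by auto
    obtain q2 where q2: "wf_form S q2" "\<And>v. sat A v q2 \<longleftrightarrow> sat A (\<lambda>i. v (((ren l)(x := n)) i)) p"
      using subst_form_exists[of S p A "(ren l)(x := n)"] True by auto
    have "(\<lambda>i. v (((ren l)(x := n)) i)) = (\<lambda>i. v (ren l i))(x := v n)" for v :: "nat \<Rightarrow> 'a"
      by auto
    then show ?thesis
      using True q1 q2
      by (intro exI[of _ "Neg (Conj q1 (Neg q2))"]) (auto simp: henkin_def t simp del: fun_upd_apply)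
  next
    case False
    then show ?thesis
      by (intro exI[of _ "Equal (Var 0) (Var 0)"]) (auto simp: henkin_def t)
  qed
qed

text \<open>An initial segment of the conditions is first-order, so it can be added to a formula
  before the solutions are projected to two coordinates.\<close>

lemma henkin_below_form:
  fixes S :: "('f::countable, 'r::countable) signature"
  shows "\<exists>q. wf_form S q \<and> (\<forall>v. sat A v q \<longleftrightarrow> (\<forall>m<n. henkin S A m v))"
proof (induction n)
  case 0
  then show ?case
    by (intro exI[of _ "Equal (Var 0) (Var 0)"]) auto
next
  case (Suc n)
  then obtain q where "wf_form S q" "\<forall>v. sat A v q \<longleftrightarrow> (\<forall>m<n. henkin S A m v)"
    by blast
  moreover obtain q' where "wf_form S q'" "\<forall>v. sat A v q' \<longleftrightarrow> henkin S A n v"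
    using henkin_form[of S A n] by blast
  ultimately show ?case
    by (intro exI[of _ "Conj q q'"]) (auto simp: less_Suc_eq)
qed

text \<open>The index \<open>y\<close> serves all generic valuations at once, like a Skolem function
  that is a coordinate. Only finitely many values of \<open>w\<close> matter for \<open>p\<close>;
  they form the parameter list of a task placed beyond all of them.\<close>

lemma henkin_witness:
  fixes S :: "('f::countable, 'r::countable) signature"
  assumes "wf_form S p"
  shows "\<exists>y. \<forall>v. (\<forall>n. henkin S A n v) \<longrightarrow>
    (\<exists>a\<in>univ A. sat A ((\<lambda>i. v (w i))(x := a)) p) \<longrightarrow> sat A ((\<lambda>i. v (w i))(x := v y)) p"
proof -
  obtain N where N: "\<forall>z\<in>free_vars p. z < N"
    using free_vars_bounded by blast
  define l where "l = map w [0..<N]"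
  obtain K where K: "set l \<subseteq> {..<K}"
    using finite_nat_set_iff_bounded[of "set l"] by auto
  obtain y where y: "y \<ge> max 2 K" "task y = (p, l, x)"
    using task_unbounded by blast
  have eq: "sat A ((\<lambda>i. v (ren l i))(x := a)) p \<longleftrightarrow> sat A ((\<lambda>i. v (w i))(x := a)) p" for v a
    by (rule sat_cong) (use N in \<open>auto simp: l_def ren_def\<close>)
  have "sat A ((\<lambda>i. v (w i))(x := v y)) p"
    if "henkin S A y v" "\<exists>a\<in>univ A. sat A ((\<lambda>i. v (w i))(x := a)) p" for v
    using that y K assms unfolding henkin_def eq by (auto simp: eq simp del: fun_upd_apply)
  then show ?thesis by blast
qed

text \<open>The elements of the limit of \<open>A\<close> along a filter \<open>U\<close> of valuations are the variables
  modulo \<open>U\<close>-almost everywhere equality, represented by the least variable in each class. A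
  valuation into the limit is therefore also a renaming of variables, which makes syntactic
  substitution unnecessary in the truth lemma \<open>sat_limit\<close> below.\<close>

definition rp :: "(nat \<Rightarrow> 'a) filter \<Rightarrow> nat \<Rightarrow> nat" where
  "rp U i = (LEAST j. eventually (\<lambda>v. v i = v j) U)"

text \<open>Variable \<open>i\<close> stands for the function that sends a valuation
  \<open>v\<close> to \<open>v i\<close>, so this is a countable part of an ultrapower of
  \<open>A\<close>. The choice in \<open>fint\<close> succeeds if almost all valuations are generic,
  by \<open>fint_limit\<close>.\<close>

definition limit_struct ::
  "('f, 'r) signature \<Rightarrow> ('a, 'f, 'r) fo_struct \<Rightarrow> (nat \<Rightarrow> 'a) filter \<Rightarrow> (nat, 'f, 'r) fo_struct" where
  "limit_struct S A U =
     \<lparr>univ = range (rp U),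
      fint = (\<lambda>f js. rp U (SOME y. eventually (\<lambda>v. v y = fint A f (map v js)) U)),
      rint = (\<lambda>r. {js \<in> tuples (range (rp U)) (rarity S r). eventually (\<lambda>v. map v js \<in> rint A r) U})\<rparr>"

lemma rp_eventually: "eventually (\<lambda>v. v i = v (rp U i)) U"
  unfolding rp_def by (rule LeastI[of _ i]) simp

lemma rp_eqI:
  assumes "eventually (\<lambda>v. v i = v j) U"
  shows "rp U i = rp U j"
proof -
  have "eventually (\<lambda>v. v i = v k) U \<longleftrightarrow> eventually (\<lambda>v. v j = v k) U" for k
    by (rule eventually_cong[OF assms]) simp
  then show ?thesis by (simp add: rp_def)
qed

lemma rp_idem: "i \<in> range (rp U) \<Longrightarrow> rp U i = i"
  using rp_eqI[OF rp_eventually[of _ U]] by auto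

locale generic_limit =
  fixes S :: "('f::countable, 'r::countable) signature"
    and A :: "('a, 'f, 'r) fo_struct"
    and U :: "(nat \<Rightarrow> 'a) filter"
  assumes struct: "is_struct S A"
    and ultra: "ultra U"
    and generic: "eventually (\<lambda>v. range v \<subseteq> univ A \<and> (\<forall>n. henkin S A n v)) U"
begin

abbreviation "M \<equiv> limit_struct S A U"

lemma in_univ: "eventually (\<lambda>v. range v \<subseteq> univ A) U"
  using generic by eventually_elim simp

text \<open>The equation that defines a function value is itself an existential task whose only
  witness is that value; hence one coordinate equals it for almost all valuations.\<close>

lemma fint_limit:
  assumes "f \<in> fsyms S" "length js = farity S f"
  shows "eventually (\<lambda>v. v (fint M f js) = fint A f (map v js)) U"
proof -
  let ?n = "length js"
  let ?p = "Equal (Var ?n) (App f (map Var [0..<?n])) :: ('f, 'r) fo_form"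
  have "wf_form S ?p"
    using assms by (simp add: list_all_iff)
  from henkin_witness[OF this, of A "ren js" ?n] obtain y where
    y: "\<And>v. (\<forall>n. henkin S A n v) \<Longrightarrow> (\<exists>a\<in>univ A. sat A ((\<lambda>i. v (ren js i))(?n := a)) ?p) \<Longrightarrow>
      sat A ((\<lambda>i. v (ren js i))(?n := v y)) ?p" by blast
  have sat: "sat A ((\<lambda>i. v (ren js i))(?n := a)) ?p \<longleftrightarrow> a = fint A f (map v js)" for v a
  proof -
    have "map (eval_term A ((\<lambda>i. v (ren js i))(?n := a)) \<circ> Var) [0..<?n] = map v js"
      by (rule nth_equalityI) (auto simp: ren_def)
    then show ?thesis by (simp del: fun_upd_apply map_eq_conv) simp
  qed
  have "eventually (\<lambda>v. v y = fint A f (map v js)) U"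
    using generic
  proof eventually_elim
    case (elim v)
    have "map v js \<in> tuples (univ A) (farity S f)"
      using elim assms(2) by (auto simp: tuples_def)
    then have "fint A f (map v js) \<in> univ A"
      using struct assms(1) by (simp add: is_struct_def)
    with y[of v] elim show ?case
      unfolding sat by blast
  qed
  then have "eventually (\<lambda>v. v (SOME y. eventually (\<lambda>v. v y = fint A f (map v js)) U) = fint A f (map v js)) U"
    by (rule someI)
  with rp_eventually[of "SOME y. eventually (\<lambda>v. v y = fint A f (map v js)) U" U] show ?thesis
    by (rule eventually_elim2) (simp add: limit_struct_def)
qed

lemma is_struct_limit: "is_struct S M"
  by (auto simp: is_struct_def limit_struct_def)

lemma eval_limit:
  "wf_term S t \<Longrightarrow> eventually (\<lambda>v. v (eval_term M w t) = eval_term A (\<lambda>i. v (w i)) t) U"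
proof (induction t)
  case (App f ts)
  then have "eventually (\<lambda>v. \<forall>t\<in>set ts. v (eval_term M w t) = eval_term A (\<lambda>i. v (w i)) t) U"
    by (intro eventually_ball_finite) (auto simp: list_all_iff)
  moreover have "eventually (\<lambda>v. v (fint M f (map (eval_term M w) ts)) = fint A f (map v (map (eval_term M w) ts))) U"
    by (rule fint_limit) (use App in auto)
  ultimately show ?case
  proof eventually_elim
    case (elim v)
    have "map v (map (eval_term M w) ts) = map (eval_term A (\<lambda>i. v (w i))) ts"
      using elim(1) by auto
    with elim(2) show ?case by (simp del: map_map)
  qed
qed simp

text \<open>This is the theorem of Los for a small ultrapower. In the quantifier case the witnesses
  in \<open>A\<close> vary with the valuation, and \<open>henkin_witness\<close> replaces them by a
  single coordinate.\<close>

lemma sat_limit: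
  assumes "wf_form S p" "range w \<subseteq> univ M"
  shows "sat M w p \<longleftrightarrow> eventually (\<lambda>v. sat A (\<lambda>i. v (w i)) p) U"
  using assms
proof (induction p arbitrary: w)
  case (Equal s t)
  then have wf: "wf_term S s" "wf_term S t" by auto
  have un: "rp U (eval_term M w s) = eval_term M w s" "rp U (eval_term M w t) = eval_term M w t"
    using eval_term_in_univ[OF is_struct_limit _ Equal.prems(2)] wf
    by (auto simp: limit_struct_def intro!: rp_idem)
  have "eval_term M w s = eval_term M w t \<longleftrightarrow> eventually (\<lambda>v. v (eval_term M w s) = v (eval_term M w t)) U"
    using rp_eqI[of "eval_term M w s" "eval_term M w t" U] un by auto
  also have "\<dots> \<longleftrightarrow> eventually (\<lambda>v. eval_term A (\<lambda>i. v (w i)) s = eval_term A (\<lambda>i. v (w i)) t) U"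
    by (rule eventually_cong[OF eventually_conj[OF eval_limit[OF wf(1), of w] eval_limit[OF wf(2), of w]]]) (use wf in auto)
  finally show ?case by simp
next
  case (Rel r ts)
  then have "eventually (\<lambda>v. \<forall>t\<in>set ts. v (eval_term M w t) = eval_term A (\<lambda>i. v (w i)) t) U"
    by (intro eventually_ball_finite) (auto simp: list_all_iff eval_limit)
  then have "eventually (\<lambda>v. map (eval_term A (\<lambda>i. v (w i))) ts = map v (map (eval_term M w) ts)) U"
    by eventually_elim auto
  then have "eventually (\<lambda>v. map (eval_term A (\<lambda>i. v (w i))) ts \<in> rint A r) U \<longleftrightarrow>
    eventually (\<lambda>v. map v (map (eval_term M w) ts) \<in> rint A r) U"
    by (rule eventually_cong) (simp only:)
  moreover have "map (eval_term M w) ts \<in> tuples (range (rp U)) (rarity S r)"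
    using eval_term_in_univ[OF is_struct_limit _ Rel.prems(2)] Rel.prems(1)
    by (auto simp: tuples_def list_all_iff limit_struct_def)
  ultimately show ?case
    by (simp add: limit_struct_def del: map_map)
next
  case (Neg p)
  then show ?case by (simp add: ultra_not[OF ultra])
next
  case (Conj p q)
  then show ?case by (simp add: eventually_conj_iff)
next
  case (Exists x p)
  have upd: "(\<lambda>i. v ((w(x := y)) i)) = (\<lambda>i. v (w i))(x := v y)" for v :: "nat \<Rightarrow> 'a" and y
    by auto
  have IH: "sat M (w(x := y)) p \<longleftrightarrow> eventually (\<lambda>v. sat A ((\<lambda>i. v (w i))(x := v y)) p) U"
    if "y \<in> univ M" for y
  proof -
    have "range (w(x := y)) \<subseteq> univ M"
      using Exists.prems that by auto
    then show ?thesis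
      using Exists.IH[of "w(x := y)"] Exists.prems(1) unfolding upd by (simp del: fun_upd_apply)
  qed
  show ?case
  proof
    assume "sat M w (Exists x p)"
    then obtain y where "y \<in> univ M" "sat M (w(x := y)) p"
      by auto
    then have "eventually (\<lambda>v. sat A ((\<lambda>i. v (w i))(x := v y)) p) U"
      using IH by blast
    with in_univ show "eventually (\<lambda>v. sat A (\<lambda>i. v (w i)) (Exists x p)) U"
      by eventually_elim auto
  next
    assume ev: "eventually (\<lambda>v. sat A (\<lambda>i. v (w i)) (Exists x p)) U"
    have "wf_form S p" using Exists.prems by simp
    then obtain y where y: "\<And>v. (\<forall>n. henkin S A n v) \<Longrightarrow>
      (\<exists>a\<in>univ A. sat A ((\<lambda>i. v (w i))(x := a)) p) \<Longrightarrow> sat A ((\<lambda>i. v (w i))(x := v y)) p"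
      using henkin_witness[of S p A w x] by blast
    have "eventually (\<lambda>v. sat A ((\<lambda>i. v (w i))(x := v y)) p) U"
      using generic ev by eventually_elim (use y in auto)
    with rp_eventually[of y U] have "eventually (\<lambda>v. sat A ((\<lambda>i. v (w i))(x := v (rp U y))) p) U"
      by eventually_elim simp
    then have "sat M (w(x := rp U y)) p"
      by (subst IH) (auto simp: limit_struct_def)
    then show "sat M w (Exists x p)"
      by (auto simp: limit_struct_def)
  qed
qed

lemma is_model_limit: "is_model S M (fo_theory S A)"
proof -
  have "sat M w p" if "sentence S p" "holds A p" "range w \<subseteq> univ M" for p w
  proof -
    have "eventually (\<lambda>v. sat A (\<lambda>i. v (w i)) p) U"
      using in_univ
    proof eventually_elim
      case (elim v)
      then show ?case
        using that(2) by (force simp: holds_def)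
    qed
    then show ?thesis
      using that sat_limit[of p w] by (simp add: sentence_def)
  qed
  then show ?thesis
    by (auto simp: is_model_def is_struct_limit fo_theory_def holds_def)
qed

text \<open>If a list exhausted the limit, the formula saying that something differs from all its
  entries would fail there, although it holds in the infinite structure \<open>A\<close> under every
  valuation.\<close>

lemma infinite_limit:
  assumes "infinite (univ A)"
  shows "infinite (univ M)"
proof
  assume fin: "finite (univ M)"
  obtain l where l: "set l = univ M"
    using finite_list[OF fin] by blast
  let ?n = "length l"
  let ?p = "foldr (\<lambda>i q. Conj (Neg (Equal (Var ?n) (Var i))) q) [0..<?n] (Equal (Var ?n) (Var ?n)) :: ('f, 'r) fo_form"
  have wf: "wf_form S (foldr (\<lambda>i q. Conj (Neg (Equal (Var n) (Var i))) q) xs (Equal (Var n) (Var n)))"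
    for n xs by (induction xs) auto
  have sat: "sat B v (foldr (\<lambda>i q. Conj (Neg (Equal (Var n) (Var i))) q) xs (Equal (Var n) (Var n)))
      \<longleftrightarrow> (\<forall>i\<in>set xs. v n \<noteq> v i)" for B :: "('x, 'f, 'r) fo_struct" and v n xs
    by (induction xs) auto
  have ne: "l \<noteq> []"
    using l by (auto simp: limit_struct_def)
  define w where "w i = (if i < ?n then l ! i else l ! 0)" for i
  have w: "range w \<subseteq> univ M"
    unfolding l[symmetric] using ne by (auto simp: w_def)
  have "eventually (\<lambda>v. sat A (\<lambda>i. v (w i)) (Exists ?n ?p)) U"
    using in_univ
  proof eventually_elim
    case (elim v)
    have "\<not> univ A \<subseteq> (\<lambda>i. v (w i)) ` {..<?n}"
      using assms finite_subset by blast
    then obtain a where "a \<in> univ A" "a \<notin> (\<lambda>i. v (w i)) ` {..<?n}"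
      by blast
    then have "\<forall>i\<in>{0..<?n}. a \<noteq> v (w i)"
      by auto
    with \<open>a \<in> univ A\<close> show ?case by (auto simp: sat)
  qed
  then have "sat M w (Exists ?n ?p)"
    using sat_limit[of "Exists ?n ?p" w] wf w by simp
  then obtain y where "y \<in> univ M" "\<forall>i<?n. y \<noteq> w i"
    by (auto simp: sat)
  then show False
    unfolding l[symmetric] by (auto simp: w_def in_set_conv_nth)
qed

end

subsection \<open>Types of pairs in omega-categorical structures\<close>

definition pair_val :: "'a \<Rightarrow> 'a \<Rightarrow> nat \<Rightarrow> 'a" where
  "pair_val a b i = (if i = 0 then a else b)"

lemma pair_val_comp: "(\<lambda>i. v (pair_val a b i)) = pair_val (v a) (v b)"
  by (auto simp: pair_val_def)

lemma range_pair_val: "range (pair_val a b) = {a, b}"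
  by (auto simp: pair_val_def image_iff intro: exI[of _ 0] exI[of _ 1])

text \<open>Shifting the variables of \<open>p\<close> by 2 frees the variables 0 and 1 for the
  pair. The bound \<open>K\<close> exceeds every shifted variable of \<open>p\<close> and the
  positions of \<open>i\<close> and \<open>j\<close>, so quantifying from 2 up to \<open>K\<close>
  leaves only the pair.\<close>

lemma projection_form:
  assumes "wf_form S p"
  shows "\<exists>q. wf_form S q \<and> (\<forall>a\<in>univ A. \<forall>b\<in>univ A. sat A (pair_val a b) q \<longleftrightarrow>
    (\<exists>v. range v \<subseteq> univ A \<and> sat A v p \<and> v i = a \<and> v j = b))"
proof -
  obtain N where N: "\<forall>z\<in>free_vars p. z < N"
    using free_vars_bounded by blast
  obtain p' where p': "wf_form S p'" "\<And>v. sat A v p' \<longleftrightarrow> sat A (\<lambda>k. v (k + 2)) p"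
    using subst_form_exists[of S p A "\<lambda>k. k + 2"] assms by auto
  define K where "K = Suc (Max {N + 2, i + 2, j + 2})"
  have K: "N + 2 < K" "i + 2 < K" "j + 2 < K"
    by (auto simp: K_def less_Suc_eq_le)
  define q where "q = foldr Exists [2..<K] (Conj p' (Conj (Equal (Var (i + 2)) (Var 0)) (Equal (Var (j + 2)) (Var 1))))"
  have "sat A (pair_val a b) q \<longleftrightarrow> (\<exists>v. range v \<subseteq> univ A \<and> sat A v p \<and> v i = a \<and> v j = b)" (is "?l \<longleftrightarrow> ?r")
    if ab: "a \<in> univ A" "b \<in> univ A" for a b
  proof
    assume ?l
    then obtain w where w: "\<forall>x\<in>set [2..<K]. w x \<in> univ A" "\<forall>x. x \<notin> set [2..<K] \<longrightarrow> w x = pair_val a b x"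
      "sat A (\<lambda>k. w (k + 2)) p" "w (i + 2) = w 0" "w (j + 2) = w 1"
      unfolding q_def sat_Exists_list by (auto simp: p')
    have "w 0 = a" "w 1 = b"
      using w(2) by (auto simp: pair_val_def)
    moreover have "w k \<in> univ A" for k
      using w(1,2) ab by (cases "k \<in> set [2..<K]") (auto simp: pair_val_def)
    ultimately show ?r
      using w by (intro exI[of _ "\<lambda>k. w (k + 2)"]) auto
  next
    assume ?r
    then obtain v where v: "range v \<subseteq> univ A" "sat A v p" "v i = a" "v j = b"
      by blast
    define w where "w k = (if k \<in> {2..<K} then v (k - 2) else pair_val a b k)" for k
    have "sat A (\<lambda>k. w (k + 2)) p \<longleftrightarrow> sat A v p"
      by (rule sat_cong) (use N K in \<open>auto simp: w_def\<close>)
    then have "sat A w (Conj p' (Conj (Equal (Var (i + 2)) (Var 0)) (Equal (Var (j + 2)) (Var 1))))"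
      using v K by (simp add: p') (simp add: w_def pair_val_def)
    then show ?l
      unfolding q_def sat_Exists_list using v(1)
      by (intro exI[of _ w]) (auto simp: w_def)
  qed
  moreover have "wf_form S q"
    using p' by (simp add: q_def wf_Exists_list)
  ultimately show ?thesis by blast
qed

lemma ultra_infinite_index:
  fixes U :: "nat filter"
  assumes "ultra U" "U \<le> sequentially" "eventually P U"
  shows "\<exists>j k. j < k \<and> P j \<and> P k"
proof -
  have large: "\<exists>k>n. P k" for n
  proof -
    have "eventually (\<lambda>k. k > n) U"
      using filter_leD[OF assms(2) eventually_gt_at_top[of n]] .
    then have "eventually (\<lambda>k. k > n \<and> P k) U"
      using assms(3) by (rule eventually_conj)
    then show ?thesis
      using assms(1) eventually_happens' unfolding ultra_def by blast
  qed
  show ?thesis using large[of 0] large by blast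
qed

text \<open>Otherwise the pairs have pairwise different types. Their limit type along a nonprincipal
  ultrafilter is realised in the model \<open>N\<close>. It is omitted in the model \<open>M\<close>
  because no satisfiable formula isolates it: such a formula would hold for two of the pairs, which
  would then share their type. So \<open>M\<close> and \<open>N\<close> cannot be
  isomorphic.\<close>

theorem omega_categorical_pair_types:
  fixes S :: "('f::countable, 'r::countable) signature"
    and A :: "('a, 'f, 'r) fo_struct"
    and a b :: "nat \<Rightarrow> 'a"
  assumes cat: "omega_categorical S A" and inf: "infinite (univ A)"
    and t: "\<And>k. a k \<in> univ A" "\<And>k. b k \<in> univ A"
  shows "\<exists>j k. j < k \<and> (\<forall>p. wf_form S p \<longrightarrow> (sat A (pair_val (a j) (b j)) p \<longleftrightarrow> sat A (pair_val (a k) (b k)) p))"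
proof (rule ccontr)
  assume no: "\<not> ?thesis"
  have st: "is_struct S A"
    using cat by (simp add: omega_categorical_def)
  obtain U0 :: "nat filter" where U0: "U0 \<le> sequentially" "ultra U0"
    using ultra_exists_le[of sequentially] by auto
  define ty where "ty p \<longleftrightarrow> eventually (\<lambda>k. sat A (pair_val (a k) (b k)) p) U0" for p
  have ty_Neg: "ty (Neg p) \<longleftrightarrow> \<not> ty p" for p
    by (simp add: ty_def ultra_not[OF U0(2)])

  have "\<exists>v. range v \<subseteq> univ A \<and> v 0 = a k \<and> v 1 = b k \<and> (\<forall>n. henkin S A n v)" for k
  proof -
    \<comment> \<open>Conditions below 2 are vacuous, which is why the pair may be
      prescribed.\<close>
    have "henkin S A m (pair_val (a k) (b k))" if "m < 2" for m
      using that by (auto simp: henkin_def split: prod.splits)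
    then obtain v where "range v \<subseteq> univ A" "\<forall>i<2. v i = pair_val (a k) (b k) i" "\<forall>m. henkin S A m v"
      using henkin_extend[OF st, of "pair_val (a k) (b k)" 2] t range_pair_val[of "a k" "b k"] by auto
    then show ?thesis
      by (intro exI[of _ v]) (auto simp: pair_val_def)
  qed
  then obtain V where V: "\<And>k. range (V k) \<subseteq> univ A" "\<And>k. V k 0 = a k" "\<And>k. V k 1 = b k"
    "\<And>k n. henkin S A n (V k)"
    by metis
  define UR where "UR = filtermap V U0"
  interpret N: generic_limit S A UR
    by unfold_locales
      (use st V U0 in \<open>auto simp: UR_def ultra_filtermap eventually_filtermap\<close>)
  have N_ty: "sat N.M (pair_val (rp UR 0) (rp UR 1)) p \<longleftrightarrow> ty p" if "wf_form S p" for p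
  proof -
    have "sat N.M (pair_val (rp UR 0) (rp UR 1)) p \<longleftrightarrow>
        eventually (\<lambda>v. sat A (pair_val (v (rp UR 0)) (v (rp UR 1))) p) UR"
      using N.sat_limit[OF that, of "pair_val (rp UR 0) (rp UR 1)"]
      by (simp add: range_pair_val pair_val_comp limit_struct_def)
    also have "\<dots> \<longleftrightarrow> eventually (\<lambda>v. sat A (pair_val (v 0) (v 1)) p) UR"
      by (rule eventually_cong[OF eventually_conj[OF rp_eventually[of 0 UR] rp_eventually[of 1 UR]]]) auto
    also have "\<dots> \<longleftrightarrow> ty p"
      using V(2,3) by (simp add: UR_def eventually_filtermap ty_def)
    finally show ?thesis .
  qed

  \<comment> \<open>These are forcing conditions: \<open>Q\<close> demands a generic solution, and
    \<open>R n\<close> a stronger condition that violates the limit type at the pair of coordinates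
    coded by \<open>n\<close>.\<close>
  define Q where "Q c \<longleftrightarrow> wf_form S c \<and> (\<exists>v. range v \<subseteq> univ A \<and> (\<forall>n. henkin S A n v) \<and> sat A v c)" for c
  define R where "R n c c' \<longleftrightarrow> (\<forall>v. sat A v c' \<longrightarrow> sat A v c) \<and>
    (\<exists>p. wf_form S p \<and> ty p \<and> (\<forall>v. sat A v c' \<longrightarrow>
       \<not> sat A (pair_val (v (fst (prod_decode n))) (v (snd (prod_decode n)))) p))" for n c c'
  have step: "\<exists>c'. Q c' \<and> R n c c'" if "Q c" for n c
  proof -
    obtain i j where ij: "prod_decode n = (i, j)" by fastforce
    obtain u where u: "range u \<subseteq> univ A" "\<And>n. henkin S A n u" "sat A u c"
      using \<open>Q c\<close> by (auto simp: Q_def)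
    obtain N where N: "\<forall>z\<in>free_vars c. z < N"
      using free_vars_bounded by blast
    \<comment> \<open>Valuations that agree below \<open>K\<close> agree on \<open>c\<close> and at
      \<open>i\<close> and \<open>j\<close>. A solution of \<open>c1\<close> also meets the Henkin
      conditions below \<open>K\<close>, so changing it from \<open>K\<close> on makes it
      generic.\<close>
    define K where "K = N + i + j + 2"
    obtain h where h: "wf_form S h" "\<And>v. sat A v h \<longleftrightarrow> (\<forall>m<K. henkin S A m v)"
      using henkin_below_form[of S A K] by blast
    define c1 where "c1 = Conj c h"
    have wf1: "wf_form S c1"
      using \<open>Q c\<close> h by (simp add: Q_def c1_def)
    obtain q where q: "wf_form S q" "\<And>x y. x \<in> univ A \<Longrightarrow> y \<in> univ A \<Longrightarrow> sat A (pair_val x y) q \<longleftrightarrow>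
        (\<exists>v. range v \<subseteq> univ A \<and> sat A v c1 \<and> v i = x \<and> v j = y)"
      using projection_form[OF wf1, of A i j] by blast
    \<comment> \<open>If \<open>c1\<close> forced the limit type at \<open>(i, j)\<close>, then its projection \<open>q\<close> would belong to the
      limit type, so two of the given pairs would satisfy \<open>q\<close> and have the limit type.\<close>
    have "\<exists>v p. range v \<subseteq> univ A \<and> sat A v c1 \<and> wf_form S p \<and> ty p \<and> \<not> sat A (pair_val (v i) (v j)) p"
    proof (rule ccontr)
      assume "\<not> ?thesis"
      then have forced: "sat A (pair_val (v i) (v j)) p"
        if "range v \<subseteq> univ A" "sat A v c1" "wf_form S p" "ty p" for v p
        using that by blast
      have iff: "sat A (pair_val (v i) (v j)) p \<longleftrightarrow> ty p"
        if "range v \<subseteq> univ A" "sat A v c1" "wf_form S p" for v p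
        using forced[OF that] forced[of v "Neg p"] that by (auto simp: ty_Neg)
      have "sat A u c1"
        using u h by (simp add: c1_def)
      have "sat A (pair_val (u i) (u j)) q"
        using q(2)[of "u i" "u j"] u(1) \<open>sat A u c1\<close> by blast
      then have "ty q"
        using iff[OF u(1) \<open>sat A u c1\<close> q(1)] by simp
      then obtain l k where lk: "l < k" "sat A (pair_val (a l) (b l)) q" "sat A (pair_val (a k) (b k)) q"
        using ultra_infinite_index[OF U0(2,1)] unfolding ty_def by blast
      have "sat A (pair_val (a x) (b x)) p \<longleftrightarrow> ty p" if xp: "sat A (pair_val (a x) (b x)) q" "wf_form S p" for x p
      proof -
        obtain w where "range w \<subseteq> univ A" "sat A w c1" "w i = a x" "w j = b x"
          using xp(1) q(2)[OF t(1)[of x] t(2)[of x]] by auto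
        with iff[of w p] xp(2) show ?thesis by simp
      qed
      then have "\<forall>p. wf_form S p \<longrightarrow> (sat A (pair_val (a l) (b l)) p \<longleftrightarrow> sat A (pair_val (a k) (b k)) p)"
        using lk(2,3) by simp
      with no lk(1) show False by blast
    qed
    then obtain v p where v: "range v \<subseteq> univ A" "sat A v c1" "wf_form S p" "ty p"
      "\<not> sat A (pair_val (v i) (v j)) p"
      by blast
    obtain p' where p': "wf_form S p'" "\<And>v. sat A v p' \<longleftrightarrow> sat A (\<lambda>k. v (pair_val i j k)) p"
      using subst_form_exists[of S p A "pair_val i j"] v(3) by blast
    obtain v' where v': "range v' \<subseteq> univ A" "\<And>k. k < K \<Longrightarrow> v' k = v k" "\<And>m. henkin S A m v'"
      using henkin_extend[OF st v(1), of K] v(2) h by (auto simp: c1_def)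
    have "sat A v' c \<longleftrightarrow> sat A v c"
      by (rule sat_cong) (use N v'(2) in \<open>auto simp: K_def\<close>)
    moreover have "v' i = v i" "v' j = v j"
      using v'(2) by (auto simp: K_def)
    ultimately have "sat A v' (Conj c (Neg p'))"
      using v by (simp add: c1_def p' pair_val_comp)
    then have "Q (Conj c (Neg p'))"
      unfolding Q_def using v' p' \<open>Q c\<close> by (auto simp: Q_def)
    moreover have "R n c (Conj c (Neg p'))"
      using v(3,4) by (auto simp: R_def ij p' pair_val_comp)
    ultimately show ?thesis by blast
  qed
  have "Q (Equal (Var 0) (Var 0))"
  proof -
    obtain a0 where "a0 \<in> univ A" using t by blast
    then have "range (\<lambda>_::nat. a0) \<subseteq> univ A" by auto
    from henkin_extend[OF st this, of 0] show ?thesis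
      by (auto simp: Q_def)
  qed
  with step obtain c where c: "\<And>n. Q (c n)" "\<And>n. R n (c n) (c (Suc n))"
    using dependent_nat_choice[of "\<lambda>_. Q" R] by blast
  have c_mono: "sat A v (c n)" if "m \<ge> n" "sat A v (c m)" for m n v
    using that by (induction rule: dec_induct) (use c(2) in \<open>auto simp: R_def\<close>)
  define X where "X n = {v. range v \<subseteq> univ A \<and> (\<forall>n. henkin S A n v) \<and> sat A v (c n)}" for n
  have X_mono: "X m \<subseteq> X n" if "n \<le> m" for m n
    using c_mono[OF that] by (auto simp: X_def)
  \<comment> \<open>The sets \<open>X n\<close> decrease and are nonempty, so they generate a proper
    filter, and an ultrafilter below it satisfies all conditions \<open>c n\<close>.\<close>
  define F where "F = (INF n. principal (X n))"
  have ev_F: "eventually P F \<longleftrightarrow> (\<exists>n. \<forall>v\<in>X n. P v)" for P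
  proof -
    have "eventually P F \<longleftrightarrow> (\<exists>n\<in>UNIV. eventually P (principal (X n)))"
      unfolding F_def
    proof (rule eventually_INF_base)
      fix x y :: nat
      show "\<exists>z\<in>UNIV. principal (X z) \<le> inf (principal (X x)) (principal (X y))"
        using X_mono[of x "max x y"] X_mono[of y "max x y"] by (intro bexI[of _ "max x y"]) auto
    qed simp
    then show ?thesis by (simp add: eventually_principal)
  qed
  have "F \<noteq> bot"
  proof
    assume "F = bot"
    then have "eventually (\<lambda>_. False) F" by simp
    then obtain n where "X n = {}"
      by (auto simp: ev_F)
    then show False
      using c(1)[of n] by (auto simp: X_def Q_def)
  qed
  then obtain UO where UO: "UO \<le> F" "ultra UO"
    using ultra_exists_le by blast
  have ev_UO: "eventually P UO" if "\<forall>v\<in>X n. P v" for P n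
    using filter_leD[OF UO(1)] ev_F that by blast
  interpret M: generic_limit S A UO
    by unfold_locales (use st UO ev_UO[of 0] in \<open>auto simp: X_def\<close>)
  have M_ty: "\<exists>p. wf_form S p \<and> ty p \<and> \<not> sat M.M (pair_val x y) p"
    if "x \<in> univ M.M" "y \<in> univ M.M" for x y
  proof -
    let ?n = "prod_encode (x, y)"
    obtain p where p: "wf_form S p" "ty p" "\<And>v. sat A v (c (Suc ?n)) \<Longrightarrow> \<not> sat A (pair_val (v x) (v y)) p"
      using c(2)[of ?n] by (auto simp: R_def)
    have "eventually (\<lambda>v. \<not> sat A (pair_val (v x) (v y)) p) UO"
      by (rule ev_UO[of "Suc ?n"]) (use p(3) in \<open>auto simp: X_def\<close>)
    then have "\<not> sat M.M (pair_val x y) p"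
      using M.sat_limit[OF p(1), of "pair_val x y"] that
      by (simp add: range_pair_val pair_val_comp ultra_not[OF UO(2)])
    with p show ?thesis by blast
  qed

  obtain h where h: "fo_iso S N.M M.M h"
    using cat N.is_model_limit N.infinite_limit[OF inf] M.is_model_limit M.infinite_limit[OF inf]
    unfolding omega_categorical_def by blast
  let ?x = "rp UR 0" and ?y = "rp UR 1"
  have xy: "?x \<in> univ N.M" "?y \<in> univ N.M"
    by (auto simp: limit_struct_def)
  then have "h ?x \<in> univ M.M" "h ?y \<in> univ M.M"
    using h by (auto simp: fo_iso_def dest: bij_betw_apply)
  then obtain p where p: "wf_form S p" "ty p" "\<not> sat M.M (pair_val (h ?x) (h ?y)) p"
    using M_ty by blast
  then show False
    using fo_iso_sat[OF h N.is_struct_limit p(1), of "pair_val ?x ?y"] N_ty[OF p(1)] xy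
    by (simp add: range_pair_val pair_val_comp)
qed

subsection \<open>Omega-categorical groups have bounded exponent\<close>

instance group_fsym :: countable
  by countable_datatype

instance neq_rsym :: countable
  by countable_datatype

primrec pow_term :: "nat \<Rightarrow> nat \<Rightarrow> group_fsym fo_term" where
  "pow_term 0 i = App One []"
| "pow_term (Suc n) i = App Mult [pow_term n i, Var i]"

lemma wf_pow_term: "wf_term group_sig (pow_term n i)"
  by (induction n) (auto simp: group_sig_def)

lemma eval_pow_term: "eval_term (group_struct G) v (pow_term n i) = v i [^]\<^bsub>G\<^esub> n"
  by (induction n) (auto simp: group_struct_def nat_pow_def)

context group
begin

lemma pow_inj_of_no_torsion:
  assumes "g \<in> carrier G" "\<And>n::nat. 0 < n \<Longrightarrow> g [^] n \<noteq> \<one>" "j < (k::nat)"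
  shows "g [^] j \<noteq> g [^] k"
proof
  assume "g [^] j = g [^] k"
  then have "g [^] (k - j) = \<one>"
    using assms pow_eq_div2[of g k j] by auto
  then show False using assms by auto
qed

text \<open>The exponents are chosen to divide one another. If an earlier exponent annihilated the
  element at \<open>k\<close>, so would the exponent just before it, which the choice of that
  element excludes.\<close>

lemma unbounded_exponent_sequence:
  assumes "\<And>n::nat. 0 < n \<Longrightarrow> \<exists>x\<in>carrier G. x [^] n \<noteq> \<one>"
    and "\<And>x. x \<in> carrier G \<Longrightarrow> \<exists>n>0. x [^] (n::nat) = \<one>"
  shows "\<exists>(x :: nat \<Rightarrow> 'a) N. \<forall>k. x k \<in> carrier G \<and> x k [^] (N k :: nat) = \<one> \<and> (\<forall>j<k. x k [^] N j \<noteq> \<one>)"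
proof -
  define P where "P s \<longleftrightarrow> fst s \<in> carrier G \<and> 0 < snd s \<and> fst s [^] snd s = \<one>" for s :: "'a \<times> nat"
  define Q where "Q s s' \<longleftrightarrow> snd s dvd snd s' \<and> fst s' [^] snd s \<noteq> \<one>" for s s' :: "'a \<times> nat"
  have "\<exists>s'. P s' \<and> Q s s'" if s: "P s" for s
  proof -
    obtain y where y: "y \<in> carrier G" "y [^] snd s \<noteq> \<one>"
      using assms(1)[of "snd s"] s by (auto simp: P_def)
    obtain n where n: "n > 0" "y [^] (n::nat) = \<one>"
      using assms(2)[OF y(1)] by blast
    have "y [^] (n * snd s) = \<one>"
      using n y by (metis nat_pow_one nat_pow_pow)
    then have "P (y, n * snd s)" "Q s (y, n * snd s)"
      using y n s by (auto simp: P_def Q_def)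
    then show ?thesis by blast
  qed
  moreover have "P (\<one>, 1)" by (simp add: P_def)
  ultimately obtain s where s: "\<And>k. P (s k)" "\<And>k. Q (s k) (s (Suc k))"
    using dependent_nat_choice[of "\<lambda>_. P" "\<lambda>_. Q"] by blast
  have dvd: "snd (s j) dvd snd (s k)" if "j \<le> k" for j k
    using that by (induction rule: dec_induct) (use s(2) in \<open>auto simp: Q_def dest: dvd_trans\<close>)
  have "fst (s k) [^] snd (s j) \<noteq> \<one>" if jk: "j < k" for j k
  proof
    assume "fst (s k) [^] snd (s j) = \<one>"
    obtain k' where k': "k = Suc k'" using jk by (cases k) auto
    obtain c where "snd (s k') = snd (s j) * c"
      using dvd[of j k'] jk k' by auto
    then have "fst (s k) [^] snd (s k') = \<one>"
      using \<open>fst (s k) [^] snd (s j) = \<one>\<close> s(1)[of k] by (metis P_def nat_pow_one nat_pow_pow)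
    then show False using s(2)[of k'] by (simp add: Q_def k')
  qed
  then show ?thesis
    using s(1) by (intro exI[of _ "fst \<circ> s"] exI[of _ "snd \<circ> s"]) (simp add: P_def)
qed

text \<open>An element of infinite order, paired with its own powers, gives pairs that are told
  apart by which power of the first entry the second one is. If all orders are finite but unbounded,
  elements paired with \<open>\<one>\<close> are told apart by the exponents that annihilate
  them.\<close>

theorem omega_categorical_bounded_exponent:
  assumes "omega_categorical group_sig (group_struct G)"
  shows "\<exists>n>0. \<forall>x\<in>carrier G. x [^] (n::nat) = \<one>"
proof (cases "finite (carrier G)")
  case True
  then show ?thesis
    using pow_order_eq_1 order_gt_0_iff_finite by blast
next
  case False
  have univ: "univ (group_struct G) = carrier G"
    by (simp add: group_struct_def)
  have types: "\<exists>j k. j < k \<and> (\<forall>p. wf_form group_sig p \<longrightarrow>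
      (sat (group_struct G) (pair_val (a j) (b j)) p \<longleftrightarrow> sat (group_struct G) (pair_val (a k) (b k)) p))"
    if "\<And>k. a k \<in> carrier G" "\<And>k. b k \<in> carrier G" for a b :: "nat \<Rightarrow> 'a"
    using omega_categorical_pair_types[OF assms] False that by (simp add: univ)
  show ?thesis
  proof (rule ccontr)
    assume no: "\<not> ?thesis"
    show False
    proof (cases "\<exists>g\<in>carrier G. \<forall>n>0. g [^] (n::nat) \<noteq> \<one>")
      case True
      then obtain g where g: "g \<in> carrier G" "\<And>n::nat. 0 < n \<Longrightarrow> g [^] n \<noteq> \<one>"
        by blast
      have "\<exists>j k :: nat. j < k \<and> (\<forall>p. wf_form group_sig p \<longrightarrow>
          (sat (group_struct G) (pair_val g (g [^] j)) p \<longleftrightarrow> sat (group_struct G) (pair_val g (g [^] k)) p))"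
        by (rule types) (use g(1) in auto)
      then obtain j k :: nat where jk: "j < k" and same: "\<And>p. wf_form group_sig p \<Longrightarrow>
        sat (group_struct G) (pair_val g (g [^] j)) p \<longleftrightarrow> sat (group_struct G) (pair_val g (g [^] k)) p"
        by blast
      have "g [^] j = g [^] k"
        using same[of "Equal (Var 1) (pow_term j 0)"]
        by (simp add: wf_pow_term eval_pow_term pair_val_def)
      then show False
        using pow_inj_of_no_torsion[OF g jk] by simp
    next
      case False
      have "\<exists>(x :: nat \<Rightarrow> 'a) N. \<forall>k. x k \<in> carrier G \<and> x k [^] (N k :: nat) = \<one> \<and> (\<forall>j<k. x k [^] N j \<noteq> \<one>)"
        by (rule unbounded_exponent_sequence) (use False no in blast)+
      then obtain x :: "nat \<Rightarrow> 'a" and N where xN: "\<And>k. x k \<in> carrier G" "\<And>k. x k [^] (N k :: nat) = \<one>"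
        "\<And>j k. j < k \<Longrightarrow> x k [^] N j \<noteq> \<one>"
        by blast
      have "\<exists>j k :: nat. j < k \<and> (\<forall>p. wf_form group_sig p \<longrightarrow>
          (sat (group_struct G) (pair_val (x j) \<one>) p \<longleftrightarrow> sat (group_struct G) (pair_val (x k) \<one>) p))"
        by (rule types) (use xN(1) in auto)
      then obtain j k :: nat where jk: "j < k" and same: "\<And>p. wf_form group_sig p \<Longrightarrow>
        sat (group_struct G) (pair_val (x j) \<one>) p \<longleftrightarrow> sat (group_struct G) (pair_val (x k) \<one>) p"
        by blast
      show False
        using same[of "Equal (pow_term (N j) 0) (Var 1)"] xN(2)[of j] xN(3)[OF jk]
        by (simp add: wf_pow_term eval_pow_term pair_val_def)
    qed
  qed
qed

end

subsection \<open>Subgroups of torsion groups\<close>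

lemma (in group) subgroup_pow_mem:
  "subgroup H G \<Longrightarrow> x \<in> H \<Longrightarrow> x [^] (k::nat) \<in> H"
  by (induction k) (auto simp: subgroup.one_closed subgroup.m_closed)

lemma (in group) coprime_pow_mem:
  assumes "subgroup H G" "a \<in> carrier G" "a [^] (k::nat) \<in> H" "a [^] (l::nat) \<in> H" "coprime k l"
  shows "a \<in> H"
proof (cases "k = 0")
  case True
  then show ?thesis using assms by simp
next
  case False
  then obtain x y where "k * x = l * y + 1"
    using bezout_nat[of k l] assms(5) by auto
  then have "a [^] (k * x) = a [^] (l * y) \<otimes> a"
    using assms(2) by (metis Suc_eq_plus1 nat_pow_Suc)
  then have "a = inv (a [^] (l * y)) \<otimes> a [^] (k * x)"
    using assms(2) by (simp add: m_assoc[symmetric])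
  moreover have "a [^] (l * y) \<in> H" "a [^] (k * x) \<in> H"
    using assms by (metis nat_pow_pow subgroup_pow_mem)+
  ultimately show ?thesis
    using assms(1) by (metis subgroup.m_closed subgroup.m_inv_closed)
qed

text \<open>Modulo \<open>H\<close> the element \<open>a\<close> has order exactly
  \<open>p\<close>.\<close>

lemma (in group) prime_pow_mem_dvd:
  assumes "subgroup H G" "a \<in> carrier G" "a [^] p \<in> H" "a \<notin> H" "prime (p::nat)" "a [^] k \<in> H"
  shows "p dvd k"
  using coprime_pow_mem[OF assms(1,2,3,6)] assms(4,5) prime_imp_coprime by blast

text \<open>Natural exponents suffice, since the adjoined elements have finite order.\<close>

definition adjoin :: "('a, 'b) monoid_scheme \<Rightarrow> 'a set \<Rightarrow> 'a \<Rightarrow> 'a set" where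
  "adjoin G H c = {h \<otimes>\<^bsub>G\<^esub> c [^]\<^bsub>G\<^esub> k | h k::nat. h \<in> H}"

context comm_group
begin

lemma adjoin_subgroup:
  assumes "subgroup H G" "c \<in> carrier G" "c [^] (n::nat) = \<one>" "0 < n"
  shows "subgroup (adjoin G H c) G"
proof (rule subgroupI)
  have H: "H \<subseteq> carrier G" using assms(1) by (rule subgroup.subset)
  show "adjoin G H c \<subseteq> carrier G"
    using H assms(2) by (auto simp: adjoin_def)
  show "adjoin G H c \<noteq> {}"
    using subgroup.one_closed[OF assms(1)] by (auto simp: adjoin_def)
  fix x assume "x \<in> adjoin G H c"
  then obtain h k where x: "x = h \<otimes> c [^] (k::nat)" "h \<in> H"
    by (auto simp: adjoin_def)
  have "c [^] (k * (n - 1)) \<otimes> c [^] k = c [^] (n * k)"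
    using assms by (simp add: nat_pow_mult algebra_simps)
  also have "\<dots> = \<one>"
    using assms by (metis nat_pow_one nat_pow_pow)
  finally have "inv (c [^] k) = c [^] (k * (n - 1))"
    using assms(2) by (simp add: inv_equality)
  then have "inv x = inv h \<otimes> c [^] (k * (n - 1))"
    using x H assms(2) by (simp add: subset_iff inv_mult)
  then show "inv x \<in> adjoin G H c"
    using x assms(1) by (auto simp: adjoin_def subgroup.m_inv_closed)
  fix y assume "y \<in> adjoin G H c"
  then obtain h' k' where y: "y = h' \<otimes> c [^] (k'::nat)" "h' \<in> H"
    by (auto simp: adjoin_def)
  have "x \<otimes> y = (h \<otimes> h') \<otimes> (c [^] k \<otimes> c [^] k')"
    using x y H assms(2) by (simp add: subset_iff m_ac)
  also have "\<dots> = (h \<otimes> h') \<otimes> c [^] (k + k')"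
    using assms(2) by (simp add: nat_pow_mult)
  finally show "x \<otimes> y \<in> adjoin G H c"
    using x y assms(1) by (auto simp: adjoin_def subgroup.m_closed)
qed

lemma subset_adjoin:
  assumes "subgroup H G"
  shows "H \<subseteq> adjoin G H c"
proof
  fix h assume "h \<in> H"
  then have "h = h \<otimes> c [^] (0::nat)"
    using subgroup.subset[OF assms] by auto
  with \<open>h \<in> H\<close> show "h \<in> adjoin G H c"
    unfolding adjoin_def by blast
qed

lemma mem_adjoin:
  assumes "subgroup H G" "c \<in> carrier G"
  shows "c \<in> adjoin G H c"
proof -
  have "c = \<one> \<otimes> c [^] (1::nat)"
    using assms(2) by simp
  then show ?thesis
    unfolding adjoin_def using subgroup.one_closed[OF assms(1)] by blast
qed

subsection \<open>Maximally divisible subgroups\<close>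

definition powers :: "nat \<Rightarrow> 'a set" where
  "powers m = (\<lambda>x. x [^] m) ` carrier G"

text \<open>For a group of exponent \<open>m\<close> this is Baer's criterion for injectivity as a module over
  the integers modulo \<open>m\<close>, restricted to the maximal ideals.\<close>

definition injective_for :: "nat \<Rightarrow> 'a set \<Rightarrow> bool" where
  "injective_for m E \<longleftrightarrow> (\<forall>p. prime p \<and> p dvd m \<longrightarrow>
     (\<forall>z\<in>E. z [^] (m div p) = \<one> \<longrightarrow> (\<exists>b\<in>E. b [^] p = z)))"

text \<open>The infinite sets \<open>powers (m div p)\<close> are the source of the infinitely many
  elements of order \<open>p\<close> found below.\<close>

lemma least_finite_powers:
  assumes "0 < n" "\<And>x. x \<in> carrier G \<Longrightarrow> x [^] (n::nat) = \<one>"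
  shows "\<exists>m>0. finite (powers m) \<and> (\<forall>p. prime p \<and> p dvd m \<longrightarrow> infinite (powers (m div p)))"
proof -
  have "powers n \<subseteq> {\<one>}"
    using assms by (auto simp: powers_def)
  then have ex: "0 < n \<and> finite (powers n)"
    using assms(1) finite_subset by blast
  define m where "m = (LEAST m. 0 < m \<and> finite (powers m))"
  have m: "0 < m" "finite (powers m)"
    using LeastI[of "\<lambda>m. 0 < m \<and> finite (powers m)", OF ex] by (auto simp: m_def)
  have "infinite (powers (m div p))" if "prime p" "p dvd m" for p
  proof
    assume "finite (powers (m div p))"
    moreover have "0 < m div p" "m div p < m"
      using that m(1) prime_gt_1_nat[of p] by (auto simp: dvd_div_eq_0_iff)
    ultimately show False
      using not_less_Least[of "m div p" "\<lambda>m. 0 < m \<and> finite (powers m)"] by (auto simp: m_def)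
  qed
  with m show ?thesis by blast
qed

text \<open>Raising to the power \<open>p\<close> maps the infinite set
  \<open>powers (m div p)\<close> into the finite set \<open>powers m\<close>, so some fibre is
  infinite. Quotients of elements of one fibre have the required form.\<close>

lemma infinite_divisible_torsion:
  assumes "0 < m" "finite (powers m)" "infinite (powers (m div p))" "p dvd m"
  shows "infinite {y [^] (m div p) | y. y \<in> carrier G \<and> y [^] m = \<one>}"
proof -
  have mp: "m div p * p = m" using assms(4) by simp
  have "(\<lambda>w. w [^] p) ` powers (m div p) \<subseteq> powers m"
    using mp by (auto simp: powers_def nat_pow_pow)
  then have "finite ((\<lambda>w. w [^] p) ` powers (m div p))"
    using assms(2) finite_subset by blast
  from pigeonhole_infinite[OF assms(3) this] obtain w0 where
    w0: "w0 \<in> powers (m div p)" "infinite {w \<in> powers (m div p). w [^] p = w0 [^] p}"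
    by blast
  then obtain y0 where y0: "y0 \<in> carrier G" "w0 = y0 [^] (m div p)"
    by (auto simp: powers_def)
  have "(\<lambda>w. w \<otimes> inv w0) ` {w \<in> powers (m div p). w [^] p = w0 [^] p} \<subseteq>
    {y [^] (m div p) | y. y \<in> carrier G \<and> y [^] m = \<one>}"
  proof (rule image_subsetI)
    fix w assume "w \<in> {w \<in> powers (m div p). w [^] p = w0 [^] p}"
    then obtain y where y: "y \<in> carrier G" "w = y [^] (m div p)" "w [^] p = w0 [^] p"
      by (auto simp: powers_def)
    have "y [^] m = y0 [^] m"
      using y y0 mp by (metis nat_pow_pow)
    then have "(y \<otimes> inv y0) [^] m = \<one>"
      using y y0 by (simp add: nat_pow_distrib nat_pow_inv)
    moreover have "w \<otimes> inv w0 = (y \<otimes> inv y0) [^] (m div p)"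
      using y y0 by (simp add: nat_pow_distrib nat_pow_inv)
    ultimately show "w \<otimes> inv w0 \<in> {y [^] (m div p) | y. y \<in> carrier G \<and> y [^] m = \<one>}"
      using y y0 by blast
  qed
  moreover have "inj_on (\<lambda>w. w \<otimes> inv w0) {w \<in> powers (m div p). w [^] p = w0 [^] p}"
    using y0 by (auto simp: inj_on_def powers_def)
  ultimately show ?thesis
    using w0(2) finite_imageD finite_subset by blast
qed

text \<open>Some \<open>y\<close> with trivial \<open>m\<close>-th power has
  \<open>y [^] (m div p)\<close> outside \<open>E\<close>. Raising \<open>y\<close> to the part of
  \<open>m\<close> prime to \<open>p\<close> preserves this element as the \<open>p ^ e\<close>-th
  power and yields a cyclic group that meets \<open>E\<close> trivially and whose order is the exact
  power of \<open>p\<close> in \<open>m\<close>.\<close>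

lemma exists_independent_element:
  assumes "0 < m" "finite (powers m)" "infinite (powers (m div p))" "prime p" "p dvd m"
    and "subgroup E G" "finite {z \<in> E. z [^] p = \<one>}"
  shows "\<exists>c e. c \<in> carrier G \<and> c [^] (p ^ Suc e) = \<one> \<and> c [^] (p ^ e) \<notin> E \<and>
    m = p ^ Suc e * (m div p ^ Suc e) \<and> \<not> p dvd m div p ^ Suc e"
proof -
  have mp: "m div p * p = m" using assms(5) by simp
  have "\<not> {y [^] (m div p) | y. y \<in> carrier G \<and> y [^] m = \<one>} \<subseteq> {z \<in> E. z [^] p = \<one>}"
    using infinite_divisible_torsion[OF assms(1-3,5)] assms(7) finite_subset by blast
  then obtain y where y: "y \<in> carrier G" "y [^] m = \<one>" "y [^] (m div p) \<notin> E"
    using mp by (auto simp: nat_pow_pow)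
  have "\<not> is_unit p" using assms(4) by auto
  then obtain r where r: "m = p ^ multiplicity p m * r" "\<not> p dvd r"
    using multiplicity_decompose'[of m p] assms(1) by auto
  have "0 < multiplicity p m"
    using assms(1,4,5) by (simp add: prime_multiplicity_gt_zero_iff)
  then obtain e where e: "multiplicity p m = Suc e"
    using gr0_implies_Suc by blast
  have p0: "p > 0" using assms(4) prime_gt_0_nat by blast
  have "m div p = p ^ e * r"
    using r(1) p0 by (metis e mult.assoc nonzero_mult_div_cancel_left not_gr0 power_Suc)
  then have "(y [^] r) [^] (p ^ e) \<notin> E" "(y [^] r) [^] (p ^ Suc e) = \<one>"
    using y r(1) e by (auto simp: nat_pow_pow mult.commute simp del: power_Suc)
  moreover have "m div p ^ Suc e = r"
    using r(1) e p0 by (metis nonzero_mult_div_cancel_left not_gr0 power_not_zero)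
  ultimately show ?thesis
    using y(1) r e by (intro exI[of _ "y [^] r"] exI[of _ e]) auto
qed

text \<open>Subgroups of a cyclic \<open>p\<close>-group form a chain. If the group generated by
  \<open>c\<close> met \<open>E\<close> nontrivially, \<open>E\<close> would contain its smallest
  nontrivial subgroup, which \<open>c [^] (p ^ e)\<close> generates.\<close>

lemma independent_pow_mem:
  assumes "subgroup E G" "c \<in> carrier G" "c [^] (p ^ Suc e) = \<one>" "c [^] (p ^ e) \<notin> E" "prime p"
    and "c [^] (k::nat) \<in> E"
  shows "p ^ Suc e dvd k"
proof -
  have "c [^] (p ^ a) \<notin> E" if "a \<le> e" for a
    using that
  proof (induction rule: inc_induct)
    case (step a)
    then show ?case
      using subgroup_pow_mem[OF assms(1), of "c [^] (p ^ a)" p] assms(2)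
      by (auto simp: nat_pow_pow mult.commute)
  qed (use assms in auto)
  moreover have "gcd k (p ^ Suc e) dvd p ^ Suc e" by simp
  then obtain a where a: "a \<le> Suc e" "gcd k (p ^ Suc e) = p ^ a"
    using assms(5) by (metis divides_primepow_nat)
  have "c [^] (p ^ a) \<in> E"
  proof (cases "k = 0")
    case True
    then show ?thesis using a assms subgroup.one_closed by auto
  next
    case False
    then obtain x y where "k * x = p ^ Suc e * y + p ^ a"
      using bezout_nat[of k "p ^ Suc e"] a(2) by auto
    then have "c [^] (k * x) = (c [^] (p ^ Suc e)) [^] y \<otimes> c [^] (p ^ a)"
      using assms(2) by (simp add: nat_pow_pow nat_pow_mult del: power_Suc)
    then have "c [^] (p ^ a) = (c [^] k) [^] x"
      using assms(2,3) by (simp add: nat_pow_pow del: power_Suc)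
    then show ?thesis
      using subgroup_pow_mem[OF assms(1,6)] by simp
  qed
  ultimately have "a = Suc e"
    using a(1) by (metis le_SucE)
  then show ?thesis using a(2) by (metis gcd_dvd1)
qed

text \<open>The product of \<open>E\<close> and the group generated by \<open>c\<close> is direct,
  so roots are found in each factor. In the cyclic factor, \<open>q\<close>-th roots exist by
  coprimality if \<open>q\<close> differs from \<open>p\<close>. For \<open>q = p\<close>,
  annihilation by \<open>m div p\<close> makes the exponent of \<open>c\<close> divisible by
  \<open>p\<close>, because the order of \<open>c\<close> is the exact power of \<open>p\<close> in
  \<open>m\<close>.\<close>

lemma injective_for_adjoin:
  assumes E: "subgroup E G" "injective_for m E"
    and c: "c \<in> carrier G" "c [^] (p ^ Suc e) = \<one>" "c [^] (p ^ e) \<notin> E" "prime p"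
    and m: "m = p ^ Suc e * r" "\<not> p dvd r"
  shows "injective_for m (adjoin G E c)"
  unfolding injective_for_def
proof (intro allI impI ballI)
  fix q z assume q: "prime q \<and> q dvd m" and z: "z \<in> adjoin G E c" "z [^] (m div q) = \<one>"
  have p0: "p > 0" using c(4) prime_gt_0_nat by blast
  obtain f k where f: "f \<in> E" "z = f \<otimes> c [^] (k::nat)"
    using z(1) by (auto simp: adjoin_def)
  have fG: "f \<in> carrier G" using f(1) subgroup.subset[OF E(1)] by auto
  have eq: "f [^] (m div q) \<otimes> c [^] (k * (m div q)) = \<one>"
    using z(2) f(2) fG c(1) by (simp add: nat_pow_distrib nat_pow_pow)
  then have "c [^] (k * (m div q)) = inv (f [^] (m div q))"
    using fG c(1) by (metis inv_equality m_comm nat_pow_closed inv_inv)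
  then have "c [^] (k * (m div q)) \<in> E"
    using subgroup_pow_mem[OF E(1) f(1)] subgroup.m_inv_closed[OF E(1)] by simp
  then have dvd: "p ^ Suc e dvd k * (m div q)"
    using independent_pow_mem[OF E(1) c] by blast
  then have "c [^] (k * (m div q)) = \<one>"
    using c(1,2) by (metis dvdE nat_pow_one nat_pow_pow)
  then have "f [^] (m div q) = \<one>"
    using eq fG by simp
  then obtain b where b: "b \<in> E" "b [^] q = f"
    using E(2) f(1) q by (auto simp: injective_for_def)
  have "\<exists>l::nat. (c [^] l) [^] q = c [^] k"
  proof (cases "q = p")
    case True
    have "m div q = p ^ e * r"
      using m(1) p0 True by simp
    then have "p ^ e * p dvd p ^ e * (k * r)"
      using dvd by (simp add: ac_simps)
    then have "p dvd k * r"
      using p0 by (simp add: dvd_mult_cancel1)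
    then have "p dvd k"
      using m(2) c(4) prime_dvd_multD by blast
    then obtain l where "k = l * p"
      by (metis dvdE mult.commute)
    then have "(c [^] l) [^] q = c [^] k"
      using True c(1) by (simp add: nat_pow_pow)
    then show ?thesis ..
  next
    case False
    then have "coprime q p"
      using q c(4) primes_coprime by blast
    then have "coprime q (p ^ Suc e)"
      by simp
    then obtain x y where "q * x = p ^ Suc e * y + 1"
      using bezout_nat[of q "p ^ Suc e"] q by (auto simp: prime_gt_0_nat)
    then have "k * x * q = p ^ Suc e * (y * k) + k"
      by (metis add_mult_distrib mult.assoc mult.commute mult_1_right)
    then have "(c [^] (k * x)) [^] q = c [^] (p ^ Suc e * (y * k)) \<otimes> c [^] k"
      using c(1) by (simp add: nat_pow_pow nat_pow_mult del: power_Suc)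
    also have "c [^] (p ^ Suc e * (y * k)) = \<one>"
      using c(1,2) by (metis nat_pow_one nat_pow_pow)
    finally have "(c [^] (k * x)) [^] q = c [^] k"
      using c(1) by simp
    then show ?thesis ..
  qed
  then obtain l where l: "(c [^] (l::nat)) [^] q = c [^] k" by blast
  have "(b \<otimes> c [^] l) [^] q = z"
    using b l f(2) c(1) subgroup.subset[OF E(1)] by (auto simp: nat_pow_distrib)
  moreover have "b \<otimes> c [^] l \<in> adjoin G E c"
    using b(1) by (auto simp: adjoin_def)
  ultimately show "\<exists>b\<in>adjoin G E c. b [^] q = z" by blast
qed

lemma injective_for_Union:
  "(\<And>E. E \<in> C \<Longrightarrow> injective_for m E) \<Longrightarrow> injective_for m (\<Union>C)"
  unfolding injective_for_def by blast

lemma subgroup_chain_Union: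
  assumes "C \<noteq> {}" "\<And>E. E \<in> C \<Longrightarrow> subgroup E G" "\<And>E F. E \<in> C \<Longrightarrow> F \<in> C \<Longrightarrow> E \<subseteq> F \<or> F \<subseteq> E"
  shows "subgroup (\<Union>C) G"
proof (rule subgroupI)
  show "\<Union>C \<subseteq> carrier G"
    using assms(2) subgroup.subset by blast
  show "\<Union>C \<noteq> {}"
    using assms(1,2) subgroup.one_closed by blast
  fix x assume "x \<in> \<Union>C"
  then obtain D where D: "D \<in> C" "x \<in> D" by blast
  then show "inv x \<in> \<Union>C"
    using subgroup.m_inv_closed[OF assms(2)[OF D(1)]] by blast
  fix y assume "y \<in> \<Union>C"
  then obtain F where F: "F \<in> C" "y \<in> F" by blast
  from assms(3)[OF D(1) F(1)] obtain E where E: "E \<in> C" "x \<in> E" "y \<in> E"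
    using D F by blast
  then show "x \<otimes> y \<in> \<Union>C"
    using subgroup.m_closed[OF assms(2)[OF E(1)]] by blast
qed

text \<open>A maximal subgroup with Baer's property has infinite \<open>p\<close>-torsion, since
  otherwise an independent cyclic factor could still be adjoined.\<close>

theorem exists_large_injective_subgroup:
  assumes m: "0 < m" "finite (powers m)" "\<And>p. prime p \<Longrightarrow> p dvd m \<Longrightarrow> infinite (powers (m div p))"
    and E0: "subgroup E0 G" "injective_for m E0"
  shows "\<exists>E. subgroup E G \<and> E0 \<subseteq> E \<and> injective_for m E \<and>
    (\<forall>p. prime p \<and> p dvd m \<longrightarrow> infinite {z \<in> E. z [^] p = \<one>})"
proof -
  define Z where "Z = {E. subgroup E G \<and> E0 \<subseteq> E \<and> injective_for m E}"
  have "\<exists>E\<in>Z. \<forall>F\<in>Z. E \<subseteq> F \<longrightarrow> F = E"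
  proof (rule subset_Zorn_nonempty)
    show "Z \<noteq> {}" using E0 by (auto simp: Z_def)
    fix C assume C: "C \<noteq> {}" "subset.chain Z C"
    then have sub: "C \<subseteq> Z" "\<And>E F. E \<in> C \<Longrightarrow> F \<in> C \<Longrightarrow> E \<subseteq> F \<or> F \<subseteq> E"
      by (auto simp: subset_chain_def)
    have "subgroup (\<Union>C) G"
      using C(1) sub by (intro subgroup_chain_Union) (auto simp: Z_def)
    moreover have "injective_for m (\<Union>C)"
      using sub by (intro injective_for_Union) (auto simp: Z_def)
    ultimately show "\<Union>C \<in> Z"
      using C(1) sub(1) by (auto simp: Z_def)
  qed
  then obtain E where E: "subgroup E G" "E0 \<subseteq> E" "injective_for m E"
    and max: "\<And>F. subgroup F G \<Longrightarrow> injective_for m F \<Longrightarrow> E \<subseteq> F \<Longrightarrow> F = E"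
    unfolding Z_def by auto
  have "infinite {z \<in> E. z [^] p = \<one>}" if p: "prime p" "p dvd m" for p
  proof
    assume "finite {z \<in> E. z [^] p = \<one>}"
    then obtain c e where c: "c \<in> carrier G" "c [^] (p ^ Suc e) = \<one>" "c [^] (p ^ e) \<notin> E"
      "m = p ^ Suc e * (m div p ^ Suc e)" "\<not> p dvd m div p ^ Suc e"
      using exists_independent_element[OF m(1,2) m(3)[OF p] p E(1)] by blast
    have "subgroup (adjoin G E c) G"
      using adjoin_subgroup[OF E(1) c(1,2)] p(1) prime_gt_0_nat by simp
    moreover have "injective_for m (adjoin G E c)"
      using injective_for_adjoin[OF E(1,3) c(1-3) p(1) c(4,5)] .
    ultimately have "adjoin G E c = E"
      using max subset_adjoin[OF E(1)] by blast
    then have "c \<in> E"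
      using mem_adjoin[OF E(1) c(1)] by simp
    then show False
      using subgroup_pow_mem[OF E(1)] c(3) by blast
  qed
  with E show ?thesis by blast
qed

end

subsection \<open>Homomorphisms with a prescribed kernel\<close>

lemma comm_group_DirProd:
  assumes "comm_group H" "comm_group K"
  shows "comm_group (H \<times>\<times> K)"
proof -
  interpret H: comm_group H by fact
  interpret K: comm_group K by fact
  interpret group "H \<times>\<times> K"
    by (rule DirProd_group) (rule H.is_group K.is_group)+
  show ?thesis
    by (rule group_comm_groupI) (auto simp: H.m_comm K.m_comm)
qed

lemma pow_DirProd: "(x, y) [^]\<^bsub>H \<times>\<times> K\<^esub> (k::nat) = (x [^]\<^bsub>H\<^esub> k, y [^]\<^bsub>K\<^esub> k)"
  by (induction k) (auto simp: nat_pow_def)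

text \<open>The goal is a homomorphism from \<open>B\<close> to \<open>G\<close> with kernel exactly
  \<open>N\<close>. By \<open>base\<close>, sending \<open>k0\<close> to \<open>g0\<close> is a
  consistent start. By \<open>reduce\<close>, every element can be shifted by a power of
  \<open>k0\<close> so that its \<open>m\<close>-th power falls into \<open>N\<close>; Baer's
  condition for \<open>m\<close> then applies.\<close>

locale kernel_problem = comm_group G + B: comm_group B
  for G :: "('a, 'b) monoid_scheme" (structure) and B :: "('c, 'd) monoid_scheme" +
  fixes n m :: nat and E :: "'a set" and N :: "'c set" and g0 :: 'a and k0 :: 'c
  assumes n_pos: "0 < n"
    and exponent: "x \<in> carrier G \<Longrightarrow> x [^] n = \<one>"
    and exponent_B: "a \<in> carrier B \<Longrightarrow> a [^]\<^bsub>B\<^esub> n = \<one>\<^bsub>B\<^esub>"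
    and E: "subgroup E G" "injective_for m E"
    and E_large: "prime p \<Longrightarrow> p dvd m \<Longrightarrow> infinite {z \<in> E. z [^] (p::nat) = \<one>}"
    and N: "subgroup N B"
    and g0: "g0 \<in> E" and k0: "k0 \<in> carrier B"
    and base: "k0 [^]\<^bsub>B\<^esub> j \<in> N \<longleftrightarrow> g0 [^] (j::nat) = \<one>"
    and reduce: "a \<in> carrier B \<Longrightarrow> \<exists>j::nat. (a \<otimes>\<^bsub>B\<^esub> k0 [^]\<^bsub>B\<^esub> j) [^]\<^bsub>B\<^esub> m \<in> N"
begin

abbreviation "P \<equiv> B \<times>\<times> G"

text \<open>Graphs of partial homomorphisms with finite image and kernel exactly \<open>N\<close>.\<close>

definition good :: "('c \<times> 'a) set \<Rightarrow> bool" where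
  "good \<Gamma> \<longleftrightarrow> subgroup \<Gamma> P \<and> (\<forall>(x, y)\<in>\<Gamma>. y \<in> E \<and> (y = \<one> \<longleftrightarrow> x \<in> N)) \<and>
     N \<times> {\<one>} \<subseteq> \<Gamma> \<and> finite (snd ` \<Gamma>) \<and> (k0, g0) \<in> \<Gamma>"

lemma comm_group_P: "comm_group P"
  by (rule comm_group_DirProd) unfold_locales

sublocale P: comm_group P
  by (rule comm_group_P)

lemma E_carrier: "z \<in> E \<Longrightarrow> z \<in> carrier G"
  using subgroup.subset[OF E(1)] by auto

lemma N_carrier: "x \<in> N \<Longrightarrow> x \<in> carrier B"
  using subgroup.subset[OF N] by auto

lemma exponent_P: "z \<in> carrier P \<Longrightarrow> z [^]\<^bsub>P\<^esub> n = \<one>\<^bsub>P\<^esub>"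
  by (cases z) (auto simp: pow_DirProd exponent exponent_B)

lemma subgroup_fst: "subgroup \<Gamma> P \<Longrightarrow> subgroup (fst ` \<Gamma>) B"
  by (rule group_hom.subgroup_img_is_subgroup[of P])
    (auto simp: group_hom_def group_hom_axioms_def hom_def)

lemma subgroup_snd: "subgroup \<Gamma> P \<Longrightarrow> subgroup (snd ` \<Gamma>) G"
  by (rule group_hom.subgroup_img_is_subgroup[of P])
    (auto simp: group_hom_def group_hom_axioms_def hom_def)

lemma finite_adjoin_image:
  assumes "finite (snd ` \<Gamma>)" "a \<in> carrier B" "b \<in> carrier G"
  shows "finite (snd ` adjoin P \<Gamma> (a, b))"
proof (rule finite_subset)
  show "snd ` adjoin P \<Gamma> (a, b) \<subseteq> (\<lambda>(w, k). w \<otimes> b [^] k) ` (snd ` \<Gamma> \<times> {..<n})"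
  proof
    fix y assume "y \<in> snd ` adjoin P \<Gamma> (a, b)"
    then obtain x w and k :: nat where y: "(x, w) \<in> \<Gamma>" "y = w \<otimes> b [^] k"
      by (auto simp: adjoin_def pow_DirProd)
    have "b [^] k = b [^] (n * (k div n) + k mod n)" by simp
    also have "\<dots> = (b [^] n) [^] (k div n) \<otimes> b [^] (k mod n)"
      using assms(3) by (simp only: nat_pow_mult nat_pow_pow)
    also have "\<dots> = b [^] (k mod n)"
      using assms(3) exponent by simp
    finally show "y \<in> (\<lambda>(w, k). w \<otimes> b [^] k) ` (snd ` \<Gamma> \<times> {..<n})"
      using y n_pos by (auto simp: image_iff intro!: bexI[of _ "(x, w)"] bexI[of _ "k mod n"])
  qed
  show "finite ((\<lambda>(w, k). w \<otimes> b [^] k) ` (snd ` \<Gamma> \<times> {..<n}))"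
    using assms(1) by blast
qed

lemma good_base: "good (adjoin P (N \<times> {\<one>}) (k0, g0))"
proof -
  have sub: "subgroup (N \<times> {\<one>}) P"
    using DirProd_subgroups[OF B.is_group N is_group triv_subgroup] by simp
  have kg: "(k0, g0) \<in> carrier P"
    using k0 E_carrier[OF g0] by simp
  have "subgroup (adjoin P (N \<times> {\<one>}) (k0, g0)) P"
    by (rule P.adjoin_subgroup[OF sub kg exponent_P[OF kg] n_pos])
  moreover have "y \<in> E \<and> (y = \<one> \<longleftrightarrow> x \<in> N)" if xy: "(x, y) \<in> adjoin P (N \<times> {\<one>}) (k0, g0)" for x y
  proof -
    obtain h and k :: nat where h: "h \<in> N" "x = h \<otimes>\<^bsub>B\<^esub> k0 [^]\<^bsub>B\<^esub> k" "y = g0 [^] k"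
      using xy E_carrier[OF g0] by (auto simp: adjoin_def pow_DirProd)
    have "x \<in> N \<longleftrightarrow> k0 [^]\<^bsub>B\<^esub> k \<in> N"
    proof
      assume "x \<in> N"
      have "k0 [^]\<^bsub>B\<^esub> k = inv\<^bsub>B\<^esub> h \<otimes>\<^bsub>B\<^esub> x"
        using h N_carrier k0 by (simp add: B.m_assoc[symmetric])
      then show "k0 [^]\<^bsub>B\<^esub> k \<in> N"
        using h(1) \<open>x \<in> N\<close> N by (simp add: subgroup.m_closed subgroup.m_inv_closed)
    qed (use h N subgroup.m_closed in auto)
    then show ?thesis
      using h(3) base subgroup_pow_mem[OF E(1) g0] by simp
  qed
  moreover have "finite (snd ` (N \<times> {\<one>}))"
    by (rule finite_subset[of _ "{\<one>}"]) auto
  then have "finite (snd ` adjoin P (N \<times> {\<one>}) (k0, g0))"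
    using finite_adjoin_image k0 E_carrier[OF g0] by blast
  ultimately show ?thesis
    using P.subset_adjoin[OF sub] P.mem_adjoin[OF sub kg] by (auto simp: good_def)
qed

text \<open>The value \<open>b\<close> of the shifted element \<open>c\<close> must be a
  \<open>p\<close>-th root of the value of its \<open>p\<close>-th power. Baer's condition gives one
  root in \<open>E\<close>, and infinite \<open>p\<close>-torsion gives one outside the finite
  image. Then \<open>b\<close> has order \<open>p\<close> modulo the image, as \<open>c\<close> has
  modulo the domain, so in a new pair either membership in \<open>N\<close> or triviality of the
  value forces \<open>p dvd k\<close>, and the pair is already in \<open>\<Gamma>\<close>.\<close>

lemma good_extend_prime:
  assumes "good \<Gamma>" "a \<in> carrier B" "prime p" "a [^]\<^bsub>B\<^esub> (p::nat) \<in> fst ` \<Gamma>"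
  shows "\<exists>\<Gamma>'. good \<Gamma>' \<and> \<Gamma> \<subseteq> \<Gamma>' \<and> a \<in> fst ` \<Gamma>'"
proof (cases "a \<in> fst ` \<Gamma>")
  case True
  then show ?thesis using assms(1) by blast
next
  case False
  have \<Gamma>: "subgroup \<Gamma> P" "\<And>x y. (x, y) \<in> \<Gamma> \<Longrightarrow> y \<in> E" "\<And>x y. (x, y) \<in> \<Gamma> \<Longrightarrow> y = \<one> \<longleftrightarrow> x \<in> N"
    "N \<times> {\<one>} \<subseteq> \<Gamma>" "finite (snd ` \<Gamma>)" "(k0, g0) \<in> \<Gamma>"
    using assms(1) unfolding good_def by auto
  have \<Gamma>c: "\<And>x y. (x, y) \<in> \<Gamma> \<Longrightarrow> x \<in> carrier B \<and> y \<in> carrier G"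
    using subgroup.subset[OF \<Gamma>(1)] by auto
  note dom = subgroup_fst[OF \<Gamma>(1)] and ran = subgroup_snd[OF \<Gamma>(1)]
  have k0_dom: "k0 [^]\<^bsub>B\<^esub> j \<in> fst ` \<Gamma>" for j :: nat
    using B.subgroup_pow_mem[OF dom] \<Gamma>(6) by force
  have N_dom: "N \<subseteq> fst ` \<Gamma>"
    using \<Gamma>(4) by force
  \<comment> \<open>translating by a multiple of \<open>k0\<close> makes the \<open>m\<close>-th power trivial, which is what lets
    injectivity of \<open>E\<close> supply a \<open>p\<close>-th root\<close>
  obtain j :: nat where j: "(a \<otimes>\<^bsub>B\<^esub> k0 [^]\<^bsub>B\<^esub> j) [^]\<^bsub>B\<^esub> m \<in> N"
    using reduce[OF assms(2)] by blast
  define c where "c = a \<otimes>\<^bsub>B\<^esub> k0 [^]\<^bsub>B\<^esub> j"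
  have c: "c \<in> carrier B" using assms(2) k0 by (simp add: c_def)
  have a_c: "a = c \<otimes>\<^bsub>B\<^esub> inv\<^bsub>B\<^esub> (k0 [^]\<^bsub>B\<^esub> j)"
    using assms(2) k0 by (simp add: c_def B.m_assoc)
  have a_dom: "a \<in> H" if "subgroup H B" "c \<in> H" "k0 [^]\<^bsub>B\<^esub> j \<in> H" for H
    using that by (subst a_c) (simp add: subgroup.m_closed subgroup.m_inv_closed)
  have c_notin: "c \<notin> fst ` \<Gamma>"
    using a_dom[OF dom _ k0_dom] False by blast
  have "c [^]\<^bsub>B\<^esub> p = a [^]\<^bsub>B\<^esub> p \<otimes>\<^bsub>B\<^esub> (k0 [^]\<^bsub>B\<^esub> j) [^]\<^bsub>B\<^esub> p"
    using assms(2) k0 by (simp add: c_def B.nat_pow_distrib)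
  then have cp: "c [^]\<^bsub>B\<^esub> p \<in> fst ` \<Gamma>"
    using assms(4) B.subgroup_pow_mem[OF dom k0_dom] subgroup.m_closed[OF dom] by simp
  have "c [^]\<^bsub>B\<^esub> m \<in> fst ` \<Gamma>"
    using j N_dom by (auto simp: c_def)
  then have pm: "p dvd m"
    by (rule B.prime_pow_mem_dvd[OF dom c cp c_notin assms(3)])
  obtain y where y: "(c [^]\<^bsub>B\<^esub> p, y) \<in> \<Gamma>"
    using cp by force
  have "(c [^]\<^bsub>B\<^esub> p, y) [^]\<^bsub>P\<^esub> (m div p) \<in> \<Gamma>"
    using P.subgroup_pow_mem[OF \<Gamma>(1) y] .
  then have "(c [^]\<^bsub>B\<^esub> m, y [^] (m div p)) \<in> \<Gamma>"
    using c pm by (simp add: pow_DirProd B.nat_pow_pow)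
  then have "y [^] (m div p) = \<one>"
    using \<Gamma>(3) j by (simp add: c_def)
  then obtain b0 where b0: "b0 \<in> E" "b0 [^] p = y"
    using E(2) \<Gamma>(2)[OF y] assms(3) pm by (auto simp: injective_for_def)
  have "inj_on (\<lambda>z. b0 \<otimes> z) {z \<in> E. z [^] p = \<one>}"
    using E_carrier b0(1) by (auto simp: inj_on_def)
  then have "infinite ((\<lambda>z. b0 \<otimes> z) ` {z \<in> E. z [^] p = \<one>})"
    using E_large[OF assms(3) pm] finite_imageD by blast
  then have "\<not> (\<lambda>z. b0 \<otimes> z) ` {z \<in> E. z [^] p = \<one>} \<subseteq> snd ` \<Gamma>"
    using \<Gamma>(5) finite_subset by blast
  then obtain z where z: "z \<in> E" "z [^] p = \<one>" "b0 \<otimes> z \<notin> snd ` \<Gamma>"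
    by blast
  define b where "b = b0 \<otimes> z"
  have b: "b \<in> E" "b [^] p = y" "b \<notin> snd ` \<Gamma>"
    using b0 z E_carrier subgroup.m_closed[OF E(1)] \<Gamma>c[OF y] by (auto simp: b_def nat_pow_distrib)
  have bp: "b [^] p \<in> snd ` \<Gamma>"
    using b(2) y by force
  have cb: "(c, b) \<in> carrier P"
    using c E_carrier[OF b(1)] by simp
  let ?\<Gamma> = "adjoin P \<Gamma> (c, b)"
  have sub: "subgroup ?\<Gamma> P"
    by (rule P.adjoin_subgroup[OF \<Gamma>(1) cb exponent_P[OF cb] n_pos])
  have in_graph: "(x \<otimes>\<^bsub>B\<^esub> c [^]\<^bsub>B\<^esub> k, w \<otimes> b [^] k) \<in> \<Gamma>" if xw: "(x, w) \<in> \<Gamma>" "p dvd k" for x w k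
  proof -
    obtain k' where k': "k = p * k'" using xw(2) by auto
    have "(c [^]\<^bsub>B\<^esub> p, y) [^]\<^bsub>P\<^esub> k' \<in> \<Gamma>"
      using P.subgroup_pow_mem[OF \<Gamma>(1) y] .
    then have "(c [^]\<^bsub>B\<^esub> k, b [^] k) \<in> \<Gamma>"
      using c E_carrier[OF b(1)] b(2) by (simp add: pow_DirProd k' B.nat_pow_pow nat_pow_pow[symmetric])
    from subgroup.m_closed[OF \<Gamma>(1) xw(1) this] show ?thesis by simp
  qed
  have kernel: "v \<in> E \<and> (v = \<one> \<longleftrightarrow> u \<in> N)" if uv: "(u, v) \<in> ?\<Gamma>" for u v
  proof -
    obtain x w and k :: nat where xw: "(x, w) \<in> \<Gamma>" "u = x \<otimes>\<^bsub>B\<^esub> c [^]\<^bsub>B\<^esub> k" "v = w \<otimes> b [^] k"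
      using uv by (auto simp: adjoin_def pow_DirProd)
    note xwc = \<Gamma>c[OF xw(1)]
    have "v \<in> E"
      using xw \<Gamma>(2)[OF xw(1)] subgroup_pow_mem[OF E(1) b(1)] subgroup.m_closed[OF E(1)] by simp
    moreover have "v = \<one> \<longleftrightarrow> u \<in> N" if "p dvd k"
      using \<Gamma>(3)[OF in_graph[OF xw(1) that]] by (simp add: xw)
    moreover have "p dvd k" if "u \<in> N"
    proof -
      have "c [^]\<^bsub>B\<^esub> k = inv\<^bsub>B\<^esub> x \<otimes>\<^bsub>B\<^esub> u"
        using xw(2) xwc c by (simp add: B.m_assoc[symmetric])
      moreover have "x \<in> fst ` \<Gamma>" "u \<in> fst ` \<Gamma>"
        using xw(1) that N_dom by force+
      ultimately have "c [^]\<^bsub>B\<^esub> k \<in> fst ` \<Gamma>"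
        using dom by (simp add: subgroup.m_closed subgroup.m_inv_closed)
      then show ?thesis
        using B.prime_pow_mem_dvd[OF dom c cp c_notin assms(3)] by blast
    qed
    moreover have "p dvd k" if "v = \<one>"
    proof -
      have "b [^] k = inv w \<otimes> v"
        using xw(3) xwc E_carrier[OF b(1)] by (simp add: m_assoc[symmetric])
      then have "b [^] k = inv w"
        using that xwc by simp
      moreover have "w \<in> snd ` \<Gamma>"
        using xw(1) by force
      ultimately have "b [^] k \<in> snd ` \<Gamma>"
        using ran by (simp add: subgroup.m_inv_closed)
      then show ?thesis
        using prime_pow_mem_dvd[OF ran E_carrier[OF b(1)] bp b(3) assms(3)] by blast
    qed
    ultimately show ?thesis by blast
  qed
  have \<Gamma>': "\<Gamma> \<subseteq> ?\<Gamma>" "(c, b) \<in> ?\<Gamma>"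
    using P.subset_adjoin[OF \<Gamma>(1)] P.mem_adjoin[OF \<Gamma>(1) cb] by auto
  have "good ?\<Gamma>"
    unfolding good_def
    using sub kernel \<Gamma>(4,6) \<Gamma>'(1) finite_adjoin_image[OF \<Gamma>(5) c E_carrier[OF b(1)]] by blast
  moreover have "a \<in> fst ` ?\<Gamma>"
  proof (rule a_dom[OF subgroup_fst[OF sub]])
    show "c \<in> fst ` ?\<Gamma>" using \<Gamma>'(2) by force
    show "k0 [^]\<^bsub>B\<^esub> j \<in> fst ` ?\<Gamma>" using k0_dom \<Gamma>'(1) by blast
  qed
  ultimately show ?thesis
    using \<Gamma>'(1) by blast
qed

text \<open>The \<open>n\<close>-th power of \<open>a\<close> lies in the domain; the exponent then
  loses one prime factor at a time.\<close>

lemma good_extend: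
  assumes "good \<Gamma>" "a \<in> carrier B"
  shows "\<exists>\<Gamma>'. good \<Gamma>' \<and> \<Gamma> \<subseteq> \<Gamma>' \<and> a \<in> fst ` \<Gamma>'"
proof -
  have "\<exists>\<Gamma>'. good \<Gamma>' \<and> \<Gamma> \<subseteq> \<Gamma>' \<and> a \<in> fst ` \<Gamma>'"
    if "good \<Gamma>" "a [^]\<^bsub>B\<^esub> k \<in> fst ` \<Gamma>" "0 < k" for k :: nat and \<Gamma>
    using that
  proof (induction k arbitrary: \<Gamma> rule: less_induct)
    case (less k)
    show ?case
    proof (cases "k = 1")
      case True
      then show ?thesis using less.prems assms(2) by auto
    next
      case False
      then obtain p where p: "prime p" "p dvd k"
        using prime_factor_nat by blast
      then have k: "k div p * p = k" by simp
      have "(a [^]\<^bsub>B\<^esub> (k div p)) [^]\<^bsub>B\<^esub> p \<in> fst ` \<Gamma>"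
        using less.prems(2) assms(2) k by (simp add: B.nat_pow_pow)
      then obtain \<Gamma>1 where 1: "good \<Gamma>1" "\<Gamma> \<subseteq> \<Gamma>1" "a [^]\<^bsub>B\<^esub> (k div p) \<in> fst ` \<Gamma>1"
        using good_extend_prime[OF less.prems(1) _ p(1)] assms(2) by blast
      have "k div p < k" "0 < k div p"
        using k less.prems(3) prime_gt_1_nat[OF p(1)] by (auto intro: gr0I)
      then show ?thesis
        using less.IH[of "k div p" \<Gamma>1] 1 by blast
    qed
  qed
  moreover have "\<one>\<^bsub>B\<^esub> \<in> fst ` \<Gamma>"
    using assms(1) subgroup.one_closed[OF subgroup_fst] by (auto simp: good_def)
  ultimately show ?thesis
    using assms exponent_B[OF assms(2)] n_pos by metis
qed

text \<open>Countability exhausts \<open>B\<close> by a sequence of extensions, at each stage of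
  which the image is still finite.\<close>

theorem hom_with_kernel:
  assumes "countable (carrier B)"
  shows "\<exists>f\<in>hom B G. \<forall>x\<in>carrier B. f x = \<one> \<longleftrightarrow> x \<in> N"
proof -
  define en where "en = from_nat_into (carrier B)"
  have en: "en i \<in> carrier B" for i
    unfolding en_def by (rule from_nat_into) auto
  have "\<exists>\<Gamma>. \<forall>i. good (\<Gamma> i) \<and> (\<Gamma> i \<subseteq> \<Gamma> (Suc i) \<and> en i \<in> fst ` \<Gamma> (Suc i))"
    using dependent_nat_choice[of "\<lambda>_. good" "\<lambda>i \<Gamma> \<Gamma>'. \<Gamma> \<subseteq> \<Gamma>' \<and> en i \<in> fst ` \<Gamma>'"]
      good_base good_extend[OF _ en] by blast
  then obtain \<Gamma> where \<Gamma>: "\<And>i. good (\<Gamma> i)" "\<And>i. \<Gamma> i \<subseteq> \<Gamma> (Suc i)" "\<And>i. en i \<in> fst ` \<Gamma> (Suc i)"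
    by blast
  have mono: "\<Gamma> i \<subseteq> \<Gamma> j" if "i \<le> j" for i j
    using that \<Gamma>(2) by (rule lift_Suc_mono_le[rotated])
  have sub: "subgroup (\<Gamma> i) P" for i
    using \<Gamma>(1) by (simp add: good_def)
  define R where "R = (\<Union>i. \<Gamma> i)"
  have R_common: "\<exists>i. z \<in> \<Gamma> i \<and> z' \<in> \<Gamma> i" if zz: "z \<in> R" "z' \<in> R" for z z'
  proof -
    obtain i j where "z \<in> \<Gamma> i" "z' \<in> \<Gamma> j" using zz by (auto simp: R_def)
    then show ?thesis
      using mono[of i "max i j"] mono[of j "max i j"] by (intro exI[of _ "max i j"]) auto
  qed
  have R_mult: "(x \<otimes>\<^bsub>B\<^esub> x', y \<otimes> y') \<in> R" if zz: "(x, y) \<in> R" "(x', y') \<in> R" for x y x' y'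
  proof -
    obtain i where "(x, y) \<in> \<Gamma> i" "(x', y') \<in> \<Gamma> i" using R_common[OF zz] by blast
    from subgroup.m_closed[OF sub this] show ?thesis by (auto simp: R_def)
  qed
  have R_carrier: "x \<in> carrier B \<and> y \<in> carrier G" if zz: "(x, y) \<in> R" for x y
  proof -
    obtain i where "(x, y) \<in> \<Gamma> i" using zz by (auto simp: R_def)
    then show ?thesis using subgroup.subset[OF sub[of i]] by auto
  qed
  have R_kernel: "y = \<one> \<longleftrightarrow> x \<in> N" if zz: "(x, y) \<in> R" for x y
  proof -
    obtain i where "(x, y) \<in> \<Gamma> i" using zz by (auto simp: R_def)
    then show ?thesis using \<Gamma>(1)[of i] by (auto simp: good_def)
  qed
  have R_unique: "y = y'" if zz: "(x, y) \<in> R" "(x, y') \<in> R" for x y y'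
  proof -
    obtain i where i: "(x, y) \<in> \<Gamma> i" "(x, y') \<in> \<Gamma> i" using R_common[OF zz] by blast
    note c = R_carrier[OF zz(1)] R_carrier[OF zz(2)]
    have "(inv\<^bsub>B\<^esub> x, inv y') \<in> \<Gamma> i"
      using subgroup.m_inv_closed[OF sub i(2)] c B.is_group is_group by (simp add: inv_DirProd)
    from subgroup.m_closed[OF sub i(1) this] have "(\<one>\<^bsub>B\<^esub>, y \<otimes> inv y') \<in> R"
      using c by (auto simp: R_def)
    then have "y \<otimes> inv y' = \<one>"
      using R_kernel subgroup.one_closed[OF N] by blast
    then show ?thesis using c by (simp add: inv_equality[symmetric] inv_solve_right')
  qed
  have R_total: "\<exists>y. (x, y) \<in> R" if x: "x \<in> carrier B" for x
  proof -
    obtain i where "x = en i"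
      using from_nat_into_surj[OF assms x] by (auto simp: en_def)
    then obtain y where "(x, y) \<in> \<Gamma> (Suc i)"
      using \<Gamma>(3)[of i] by auto
    then show ?thesis by (auto simp: R_def)
  qed
  define f where "f x = (THE y. (x, y) \<in> R)" for x
  have f: "(x, f x) \<in> R" if "x \<in> carrier B" for x
    unfolding f_def using R_total[OF that] R_unique by (metis theI)
  have "f \<in> hom B G"
  proof (rule homI)
    fix x assume "x \<in> carrier B"
    then show "f x \<in> carrier G" using f R_carrier by blast
  next
    fix x y assume "x \<in> carrier B" "y \<in> carrier B"
    then show "f (x \<otimes>\<^bsub>B\<^esub> y) = f x \<otimes> f y"
      using R_unique[OF f[of "x \<otimes>\<^bsub>B\<^esub> y"] R_mult[OF f[of x] f[of y]]] by simp
  qed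
  then show ?thesis
    using f R_kernel by blast
qed

end

subsection \<open>Finite powers of a group\<close>

abbreviation group_power :: "('a, 'b) monoid_scheme \<Rightarrow> nat \<Rightarrow> (nat \<Rightarrow> 'a) monoid" where
  "group_power G k \<equiv> product_group {..<k} (\<lambda>_. G)"

definition vec :: "'a list \<Rightarrow> nat \<Rightarrow> 'a" where
  "vec xs = (\<lambda>i\<in>{..<length xs}. xs ! i)"

lemma vec_nth [simp]: "i < length xs \<Longrightarrow> vec xs i = xs ! i"
  by (simp add: vec_def)

lemma vec_carrier: "length xs = k \<Longrightarrow> set xs \<subseteq> A \<Longrightarrow> vec xs \<in> {..<k} \<rightarrow>\<^sub>E A"
  by (auto simp: vec_def subset_iff)

lemma vec_eqI:
  "x \<in> {..<k} \<rightarrow>\<^sub>E A \<Longrightarrow> length xs = k \<Longrightarrow> (\<And>i. i < k \<Longrightarrow> x i = xs ! i) \<Longrightarrow> x = vec xs"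
  by (auto simp: vec_def fun_eq_iff PiE_iff extensional_def)

lemma less_3_nat: "i < 3 \<longleftrightarrow> i = 0 \<or> i = 1 \<or> i = (2::nat)"
  by auto

lemma less_6_nat: "i < 6 \<longleftrightarrow> i = 0 \<or> i = 1 \<or> i = 2 \<or> i = 3 \<or> i = 4 \<or> i = (5::nat)"
  by auto

definition reindex :: "nat \<Rightarrow> (nat \<Rightarrow> nat) \<Rightarrow> (nat \<Rightarrow> 'a) \<Rightarrow> nat \<Rightarrow> 'a" where
  "reindex k \<sigma> x = (\<lambda>i\<in>{..<k}. x (\<sigma> i))"

lemma reindex_carrier: "\<sigma> \<in> {..<k} \<rightarrow> {..<l} \<Longrightarrow> x \<in> {..<l} \<rightarrow>\<^sub>E A \<Longrightarrow> reindex k \<sigma> x \<in> {..<k} \<rightarrow>\<^sub>E A"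
  by (auto simp: reindex_def Pi_iff)

lemma op_comp_projection:
  assumes "\<sigma> \<in> {..<n} \<rightarrow> {..<m}"
  shows "op_comp B n m f (\<lambda>i. projection B m (\<sigma> i)) = (\<lambda>x\<in>{..<m} \<rightarrow>\<^sub>E B. f (reindex n \<sigma> x))"
proof -
  have "(\<lambda>i\<in>{..<n}. projection B m (\<sigma> i) x) = reindex n \<sigma> x" if "x \<in> {..<m} \<rightarrow>\<^sub>E B" for x
    using that by (auto simp: reindex_def projection_def)
  then show ?thesis
    unfolding op_comp_def by (intro restrict_ext) (simp only:)
qed

lemma op_comp_projection_projection:
  assumes "\<sigma> \<in> {..<n} \<rightarrow> {..<m}" "i < n"
  shows "op_comp B n m (projection B n i) (\<lambda>i. projection B m (\<sigma> i)) = projection B m (\<sigma> i)"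
proof -
  have "projection B n i (reindex n \<sigma> x) = x (\<sigma> i)" if "x \<in> {..<m} \<rightarrow>\<^sub>E B" for x
    using reindex_carrier[OF assms(1) that] assms(2) by (simp add: projection_def reindex_def)
  then show ?thesis
    unfolding op_comp_projection[OF assms(1)] by (auto simp: projection_def)
qed

lemma projection_bool_eq_iff:
  assumes "i < k" "j < k"
  shows "projection (UNIV :: bool set) k i = projection UNIV k j \<longleftrightarrow> i = j"
proof
  assume eq: "projection (UNIV :: bool set) k i = projection UNIV k j"
  have "(\<lambda>l\<in>{..<k}. l = i) \<in> {..<k} \<rightarrow>\<^sub>E (UNIV :: bool set)" by simp
  then show "i = j"
    using fun_cong[OF eq, of "\<lambda>l\<in>{..<k}. l = i"] assms by (simp add: projection_def)
qed simp

context comm_group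
begin

abbreviation gpow :: "nat \<Rightarrow> (nat \<Rightarrow> 'a) monoid" where
  "gpow k \<equiv> group_power G k"

lemma comm_group_power: "comm_group (gpow k)"
proof -
  interpret K: group "gpow k"
    by (simp add: is_group)
  show ?thesis
    by (rule K.group_comm_groupI) (auto simp: m_comm PiE_iff fun_eq_iff)
qed

lemma eq_of_diff_one:
  assumes "x \<in> carrier G" "y \<in> carrier G" "x \<otimes> inv y = \<one>"
  shows "x = y"
proof -
  have "x = (x \<otimes> inv y) \<otimes> y"
    using assms(1,2) by (simp add: m_assoc)
  then show ?thesis using assms by simp
qed

lemma mult_group_power: "x \<otimes>\<^bsub>gpow k\<^esub> y = (\<lambda>i\<in>{..<k}. x i \<otimes> y i)"
  by simp

lemma pow_group_power:
  "x \<in> carrier (gpow k) \<Longrightarrow> x [^]\<^bsub>gpow k\<^esub> (j::nat) = (\<lambda>i\<in>{..<k}. x i [^] j)"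
proof (induction j)
  interpret K: comm_group "gpow k" by (rule comm_group_power)
  {
    case 0
    show ?case by simp
  next
    case (Suc j)
    then have "x [^]\<^bsub>gpow k\<^esub> Suc j = (\<lambda>i\<in>{..<k}. x i [^] j) \<otimes>\<^bsub>gpow k\<^esub> x"
      by (simp only: K.nat_pow_Suc)
    then show ?case by auto
  }
qed

lemma inv_group_power:
  "x \<in> carrier (gpow k) \<Longrightarrow> inv\<^bsub>gpow k\<^esub> x = (\<lambda>i\<in>{..<k}. inv (x i))"
  by (simp add: is_group)

lemma reindex_hom:
  assumes "\<sigma> \<in> {..<k} \<rightarrow> {..<l}"
  shows "reindex k \<sigma> \<in> hom (gpow l) (gpow k)"
proof (rule homI)
  show "reindex k \<sigma> x \<in> carrier (gpow k)" if "x \<in> carrier (gpow l)" for x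
    using reindex_carrier[OF assms, of x "carrier G"] that by simp
  fix x y assume "x \<in> carrier (gpow l)" "y \<in> carrier (gpow l)"
  then show "reindex k \<sigma> (x \<otimes>\<^bsub>gpow l\<^esub> y) = reindex k \<sigma> x \<otimes>\<^bsub>gpow k\<^esub> reindex k \<sigma> y"
    using assms by (auto simp: reindex_def Pi_iff fun_eq_iff)
qed

definition single :: "nat \<Rightarrow> nat \<Rightarrow> 'a \<Rightarrow> nat \<Rightarrow> 'a" where
  "single k i y = (\<lambda>j\<in>{..<k}. if j = i then y else \<one>)"

lemma single_carrier: "y \<in> carrier G \<Longrightarrow> single k i y \<in> carrier (gpow k)"
  by (auto simp: single_def)

lemma single_mult: "y \<in> carrier G \<Longrightarrow> z \<in> carrier G \<Longrightarrow> single k i (y \<otimes> z) = single k i y \<otimes>\<^bsub>gpow k\<^esub> single k i z"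
  by (auto simp: single_def fun_eq_iff)

lemma single_one: "single k i \<one> = \<one>\<^bsub>gpow k\<^esub>"
  by (auto simp: single_def fun_eq_iff)

lemma single_pow: "y \<in> carrier G \<Longrightarrow> single k i y [^]\<^bsub>gpow k\<^esub> (j::nat) = single k i (y [^] j)"
  by (subst pow_group_power[OF single_carrier]) (auto simp: single_def fun_eq_iff)

lemma single_hom: "single k i \<in> hom G (gpow k)"
  by (rule homI) (rule single_carrier single_mult; assumption)+

subsection \<open>Polymorphisms of a group with disequality\<close>

definition polymorphic :: "nat \<Rightarrow> ((nat \<Rightarrow> 'a) \<Rightarrow> 'a) \<Rightarrow> bool" where
  "polymorphic k f \<longleftrightarrow> f \<in> hom (gpow k) G \<and>
     (\<forall>x\<in>carrier (gpow k). f x = \<one> \<longrightarrow> (\<exists>i<k. x i = \<one>))"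

lemma ball_tuples:
  "(\<forall>xs\<in>tuples A 0. Q xs) \<longleftrightarrow> Q []"
  "(\<forall>xs\<in>tuples A (Suc 0). Q xs) \<longleftrightarrow> (\<forall>x\<in>A. Q [x])"
  "(\<forall>xs\<in>tuples A 2. Q xs) \<longleftrightarrow> (\<forall>x\<in>A. \<forall>y\<in>A. Q [x, y])"
proof -
  have "tuples A 0 = {[]}" "tuples A (Suc 0) = {[x] | x. x \<in> A}"
    "tuples A 2 = {[x, y] | x y. x \<in> A \<and> y \<in> A}"
    unfolding tuples_def numeral_2_eq_2 by (auto simp: length_Suc_conv)
  then show "(\<forall>xs\<in>tuples A 0. Q xs) \<longleftrightarrow> Q []"
    "(\<forall>xs\<in>tuples A (Suc 0). Q xs) \<longleftrightarrow> (\<forall>x\<in>A. Q [x])"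
    "(\<forall>xs\<in>tuples A 2. Q xs) \<longleftrightarrow> (\<forall>x\<in>A. \<forall>y\<in>A. Q [x, y])"
    by auto
qed

lemma tuples_0: "tuples A 0 = {[]}"
  by (auto simp: tuples_def)

lemma all_group_fsym: "(\<forall>s::group_fsym. Q s) \<longleftrightarrow> Q Mult \<and> Q Inv \<and> Q One"
proof
  assume "Q Mult \<and> Q Inv \<and> Q One"
  then show "\<forall>s. Q s"
    by (intro allI, case_tac s) simp_all
qed simp

lemma group_hom_power: "f \<in> hom (gpow k) G \<Longrightarrow> group_hom (gpow k) G f"
  by (intro group_hom.intro group_hom_axioms.intro comm_group.axioms(2)[OF comm_group_power] is_group)

lemma hom_group_power_diff:
  assumes "f \<in> hom (gpow k) G" "x \<in> carrier (gpow k)" "y \<in> carrier (gpow k)"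
  shows "f (\<lambda>i\<in>{..<k}. x i \<otimes> inv (y i)) = f x \<otimes> inv (f y)"
proof -
  interpret K: comm_group "gpow k" by (rule comm_group_power)
  interpret group_hom "gpow k" G f
    by (rule group_hom_power[OF assms(1)])
  have "(\<lambda>i\<in>{..<k}. x i \<otimes> inv (y i)) = x \<otimes>\<^bsub>gpow k\<^esub> inv\<^bsub>gpow k\<^esub> y"
    by (simp only: inv_group_power[OF assms(3)]) auto
  then show ?thesis
    using assms(2,3) by (simp only: hom_mult hom_inv K.inv_closed)
qed

text \<open>Two tuples differ in every coordinate iff their quotient has no trivial coordinate, and
  \<open>f\<close> identifies them iff that quotient lies in its kernel.\<close>

lemma polymorphic_iff:
  "polymorphic k f \<longleftrightarrow> fo_hom group_neq_sig (power_struct (group_neq_struct G) k) (group_neq_struct G) f"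
  (is "?l \<longleftrightarrow> ?r")
proof -
  have hom_iff: "?r \<longleftrightarrow> f \<in> carrier (gpow k) \<rightarrow> carrier G \<and>
    (\<forall>x\<in>carrier (gpow k). \<forall>y\<in>carrier (gpow k). f (\<lambda>i\<in>{..<k}. x i \<otimes> y i) = f x \<otimes> f y) \<and>
    (\<forall>x\<in>carrier (gpow k). f (\<lambda>i\<in>{..<k}. inv (x i)) = inv (f x)) \<and>
    f (\<lambda>i\<in>{..<k}. \<one>) = \<one> \<and>
    (\<forall>x\<in>carrier (gpow k). \<forall>y\<in>carrier (gpow k). (\<forall>i<k. x i \<noteq> y i) \<longrightarrow> f x \<noteq> f y)" (is "_ \<longleftrightarrow> ?r'")
  proof -
    show ?thesis
      unfolding fo_hom_def
      by (auto simp: group_neq_sig_def group_sig_def all_group_fsym power_struct_def group_neq_struct_def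
        group_struct_def ball_tuples tuples_0 Pi_iff PiE_iff)
  qed
  show ?thesis
  proof
    assume ?l
    then have f: "f \<in> hom (gpow k) G" and
      ker: "\<And>x. x \<in> carrier (gpow k) \<Longrightarrow> f x = \<one> \<Longrightarrow> \<exists>i<k. x i = \<one>"
      by (auto simp: polymorphic_def)
    interpret group_hom "gpow k" G f
      by (rule group_hom_power[OF f])
    have "f (\<lambda>i\<in>{..<k}. x i \<otimes> y i) = f x \<otimes> f y" if "x \<in> carrier (gpow k)" "y \<in> carrier (gpow k)" for x y
      using hom_mult[OF that] by simp
    moreover have "f (\<lambda>i\<in>{..<k}. inv (x i)) = inv (f x)" if "x \<in> carrier (gpow k)" for x
      using hom_inv[OF that] by (simp only: inv_group_power[OF that])
    moreover have "f (\<lambda>i\<in>{..<k}. \<one>) = \<one>"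
      using hom_one by simp
    moreover have "f x \<noteq> f y" if xy: "x \<in> carrier (gpow k)" "y \<in> carrier (gpow k)" "\<forall>i<k. x i \<noteq> y i" for x y
    proof
      assume "f x = f y"
      then have "f (\<lambda>i\<in>{..<k}. x i \<otimes> inv (y i)) = \<one>"
        using hom_group_power_diff[OF f xy(1,2)] hom_closed[OF xy(2)] by simp
      moreover have "(\<lambda>i\<in>{..<k}. x i \<otimes> inv (y i)) \<in> carrier (gpow k)"
        using xy by (auto simp: PiE_iff)
      ultimately obtain i where i: "i < k" "(\<lambda>i\<in>{..<k}. x i \<otimes> inv (y i)) i = \<one>"
        using ker by blast
      then have "i < k" "x i \<otimes> inv (y i) = \<one>"
        by simp_all
      moreover have "x i \<in> carrier G" "y i \<in> carrier G"
        using xy \<open>i < k\<close> by (auto simp: PiE_iff)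
      ultimately have "x i = y i"
        using eq_of_diff_one by blast
      with xy(3) \<open>i < k\<close> show False by blast
    qed
    ultimately show ?r
      unfolding hom_iff using f by (auto simp: hom_def)
  next
    assume ?r
    then have r: ?r' unfolding hom_iff .
    then have "f \<in> hom (gpow k) G"
      by (auto simp: hom_def)
    moreover have "\<exists>i<k. x i = \<one>" if "x \<in> carrier (gpow k)" "f x = \<one>" for x
    proof -
      have "(\<lambda>i\<in>{..<k}. \<one>) \<in> carrier (gpow k)" by auto
      moreover have "f x = f (\<lambda>i\<in>{..<k}. \<one>)"
        using r that(2) by simp
      ultimately have "\<not> (\<forall>i<k. x i \<noteq> (\<lambda>i\<in>{..<k}. \<one>) i)"
        using r that(1) by blast
      then show ?thesis by auto
    qed
    ultimately show ?l
      by (auto simp: polymorphic_def)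
  qed
qed

lemma Pol_iff:
  "f \<in> Pol group_neq_sig (group_neq_struct G) k \<longleftrightarrow>
    1 \<le> k \<and> polymorphic k f \<and> f \<in> extensional ({..<k} \<rightarrow>\<^sub>E carrier G)"
proof -
  have "univ (group_neq_struct G) = carrier G"
    by (simp add: group_neq_struct_def group_struct_def)
  moreover have "f \<in> ({..<k} \<rightarrow>\<^sub>E carrier G) \<rightarrow> carrier G" if "polymorphic k f"
    using that by (auto simp: polymorphic_def hom_def)
  ultimately show ?thesis
    by (auto simp: Pol_def polymorphic_iff PiE_def)
qed

lemma restrict_in_Pol:
  assumes "1 \<le> k" "polymorphic k f"
  shows "restrict f ({..<k} \<rightarrow>\<^sub>E carrier G) \<in> Pol group_neq_sig (group_neq_struct G) k"
proof -
  interpret K: comm_group "gpow k" by (rule comm_group_power)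
  have "restrict f (carrier (gpow k)) x = f x" if "x \<in> carrier (gpow k)" for x
    using that by simp
  then have "polymorphic k (restrict f (carrier (gpow k)))"
    using assms(2) unfolding polymorphic_def hom_def
    by (auto simp del: carrier_product_group mult_product_group)
  then show ?thesis
    using assms(1) by (simp add: Pol_iff)
qed

text \<open>Because of the disequality relation, endomorphisms of the structure are embeddings; for
  a group homomorphism a trivial kernel is enough.\<close>

lemma embedding_fo_hom:
  assumes "h \<in> hom G G" "\<And>x. x \<in> carrier G \<Longrightarrow> h x = \<one> \<Longrightarrow> x = \<one>"
  shows "fo_hom group_neq_sig (group_neq_struct G) (group_neq_struct G) h"
proof -
  interpret group_hom G G h
    by (intro group_hom.intro group_hom_axioms.intro is_group assms(1))
  have inj: "x = y" if xy: "x \<in> carrier G" "y \<in> carrier G" "h x = h y" for x y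
  proof -
    have "h (x \<otimes> inv y) = \<one>" using xy by simp
    then have "x \<otimes> inv y = \<one>" using assms(2) xy by simp
    then show ?thesis using xy eq_of_diff_one by blast
  qed
  show ?thesis
    unfolding fo_hom_def
    by (auto simp: group_neq_sig_def group_sig_def group_neq_struct_def group_struct_def
        ball_tuples all_group_fsym dest: inj)
qed

lemma fo_hom_embedding:
  assumes "fo_hom group_neq_sig (group_neq_struct G) (group_neq_struct G) h"
  shows "h \<one> = \<one>" "x \<in> carrier G \<Longrightarrow> h x = \<one> \<Longrightarrow> x = \<one>"
proof -
  have h: "h \<one> = \<one> \<and> (\<forall>x\<in>carrier G. \<forall>y\<in>carrier G. x \<noteq> y \<longrightarrow> h x \<noteq> h y)"
    using assms unfolding fo_hom_def
    by (auto simp: group_neq_sig_def group_sig_def group_neq_struct_def group_struct_def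
        ball_tuples tuples_0 all_group_fsym)
  then show "h \<one> = \<one>" by blast
  show "x = \<one>" if "x \<in> carrier G" "h x = \<one>"
    using h that by (metis one_closed)
qed

end

lemma countable_tuple_functions:
  assumes "countable A"
  shows "countable ({..<k::nat} \<rightarrow>\<^sub>E A)"
proof (rule countable_subset)
  show "({..<k} \<rightarrow>\<^sub>E A) \<subseteq> vec ` lists A"
  proof
    fix x assume x: "x \<in> {..<k} \<rightarrow>\<^sub>E A"
    then have "x = vec (map x [0..<k])"
      by (rule vec_eqI) auto
    moreover have "map x [0..<k] \<in> lists A"
      using x by (auto simp: PiE_iff)
    ultimately show "x \<in> vec ` lists A" by (rule image_eqI)
  qed
  show "countable (vec ` lists A)"
    using assms by (intro countable_image countable_lists)
qed

section \<open>The base element of a core with at most two elements\<close>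

context comm_group
begin

lemma one_in_powers: "\<one> \<in> powers m"
  unfolding powers_def by (rule image_eqI[of _ _ \<one>]) simp_all

lemma powers_carrier: "x \<in> powers m \<Longrightarrow> x \<in> carrier G"
  by (auto simp: powers_def)

lemma powers_mult: "x \<in> powers m \<Longrightarrow> y \<in> powers m \<Longrightarrow> x \<otimes> y \<in> powers m"
  unfolding powers_def by (auto simp: nat_pow_distrib[symmetric])

lemma powers_inv: "x \<in> powers m \<Longrightarrow> inv x \<in> powers m"
  unfolding powers_def by (auto simp: nat_pow_inv[symmetric])

text \<open>If the core is \<open>{\<one>, d}\<close>, a root \<open>c\<close> of \<open>d\<close>
  is raised to the odd part of \<open>m\<close>: this keeps \<open>d\<close> as \<open>m\<close>-th
  power, as \<open>d\<close> has order 2, and makes the order of \<open>g\<close> a power of 2. Odd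
  primes then act invertibly on the powers of \<open>g\<close>. For the prime 2,
  \<open>z = g [^] j\<close> with trivial \<open>m\<close>-th power forces
  \<open>d [^] j = \<one>\<close>, so \<open>j\<close> is even and \<open>z\<close> is a
  square.\<close>

lemma exists_base_element:
  assumes "finite (powers m)" "card (powers m) \<le> 2" "0 < m"
  shows "\<exists>g\<in>carrier G. powers m = {\<one>, g [^] m} \<and> injective_for m (adjoin G {\<one>} g)"
proof (cases "powers m = {\<one>}")
  case True
  then have "powers m = {\<one>, \<one> [^] m}" by simp
  moreover have "injective_for m (adjoin G {\<one>} \<one>)"
    by (auto simp: injective_for_def adjoin_def)
  ultimately show ?thesis by blast
next
  case False
  then obtain d where d: "d \<in> powers m" "d \<noteq> \<one>"
    using one_in_powers by blast
  have card2: "card {\<one>, d} = 2" using d(2) by simp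
  have D: "powers m = {\<one>, d}"
  proof (rule sym, rule card_seteq[OF assms(1)])
    show "{\<one>, d} \<subseteq> powers m" using d one_in_powers by simp
    show "card (powers m) \<le> card {\<one>, d}" using assms(2) card2 by simp
  qed
  obtain c where c: "c \<in> carrier G" "c [^] m = d"
    using d(1) by (auto simp: powers_def)
  have dG: "d \<in> carrier G" using c by auto
  have dd: "d \<otimes> d = \<one>"
  proof -
    have "d \<otimes> d \<in> {\<one>, d}" using powers_mult[OF d(1) d(1)] D by simp
    moreover have "d \<otimes> d \<noteq> d" using d(2) dG by simp
    ultimately show ?thesis by blast
  qed
  have d_pow: "d [^] k = (if even k then \<one> else d)" for k :: nat
    using dd dG by (induction k) auto
  obtain r where r: "m = 2 ^ multiplicity 2 m * r" "\<not> 2 dvd r"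
    using multiplicity_decompose'[of m 2] assms(3) by auto
  define e where "e = multiplicity 2 m"
  define g where "g = c [^] r"
  have g: "g \<in> carrier G" using c by (simp add: g_def)
  have gm: "g [^] m = d"
  proof -
    have "g [^] m = d [^] r"
      using c by (simp add: g_def nat_pow_pow mult.commute flip: c(2))
    then show ?thesis using r(2) by (simp add: d_pow)
  qed
  have g2: "g [^] (2 ^ Suc e :: nat) = \<one>"
  proof -
    have "r * 2 ^ Suc e = m * 2" by (subst r(1)) (simp add: e_def)
    then have "g [^] (2 ^ Suc e :: nat) = d [^] (2::nat)"
      using c by (simp add: g_def nat_pow_pow flip: c(2) del: power_Suc)
    then show ?thesis by (simp add: d_pow del: power_Suc)
  qed
  have "injective_for m (adjoin G {\<one>} g)"
    unfolding injective_for_def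
  proof (intro allI impI ballI)
    fix p z assume p: "prime p \<and> p dvd m" and z: "z \<in> adjoin G {\<one>} g" "z [^] (m div p) = \<one>"
    obtain j :: nat where j: "z = g [^] j"
      using z(1) g by (auto simp: adjoin_def)
    have "\<exists>l::nat. (g [^] l) [^] p = g [^] j"
    proof (cases "p = 2")
      case True
      have "d [^] j = (g [^] j) [^] m"
        using g gm by (metis mult.commute nat_pow_pow)
      also have "\<dots> = (z [^] (m div p)) [^] p"
        using j g p by (simp add: nat_pow_pow mult.assoc)
      also have "\<dots> = \<one>" using z(2) by simp
      finally have "even j" using d(2) by (simp add: d_pow split: if_splits)
      then obtain l where "j = l * 2" by (metis dvdE mult.commute)
      then have "(g [^] l) [^] p = g [^] j" using True g by (simp add: nat_pow_pow)
      then show ?thesis ..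
    next
      case False
      then have "coprime p 2"
        using p primes_coprime two_is_prime_nat by blast
      then have "coprime p (2 ^ Suc e)" by simp
      then obtain x y where "p * x = 2 ^ Suc e * y + 1"
        using bezout_nat[of p "2 ^ Suc e"] p by (auto simp: prime_gt_0_nat)
      then have "j * x * p = 2 ^ Suc e * (y * j) + j"
        by (metis add_mult_distrib mult.assoc mult.commute mult_1_right)
      then have "(g [^] (j * x)) [^] p = (g [^] (2 ^ Suc e :: nat)) [^] (y * j) \<otimes> g [^] j"
        using g by (simp add: nat_pow_pow nat_pow_mult del: power_Suc)
      then have "(g [^] (j * x)) [^] p = g [^] j"
        using g g2 by (simp del: power_Suc)
      then show ?thesis ..
    qed
    then obtain l :: nat where l: "(g [^] l) [^] p = g [^] j" by blast
    have "g [^] l \<in> adjoin G {\<one>} g"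
      using g by (auto simp: adjoin_def intro!: exI[of _ l])
    with l j show "\<exists>b\<in>adjoin G {\<one>} g. b [^] p = z" by blast
  qed
  with g gm D show ?thesis by blast
qed

end

section \<open>Prescribed kernels over a core with at most two elements\<close>

locale small_core = comm_group G for G :: "('a, 'b) monoid_scheme" (structure) +
  fixes n m :: nat and g0 :: 'a
  assumes n_pos: "0 < n" and exponent: "x \<in> carrier G \<Longrightarrow> x [^] n = \<one>"
    and m_pos: "0 < m"
    and infinite_powers: "prime p \<Longrightarrow> p dvd m \<Longrightarrow> infinite (powers (m div p))"
    and countable_carrier: "countable (carrier G)"
    and g0: "g0 \<in> carrier G" and core: "powers m = {\<one>, g0 [^] m}"
    and g0_injective: "injective_for m (adjoin G {\<one>} g0)"
begin

text \<open>The nontrivial core element if there is one and \<open>\<one>\<close> otherwise, so that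
  both cases are treated together.\<close>

definition d :: 'a where "d = g0 [^] m"

lemma d_carrier: "d \<in> carrier G"
  using g0 by (simp add: d_def)

lemma pow_m: "x \<in> carrier G \<Longrightarrow> x [^] m = \<one> \<or> x [^] m = d"
  using core unfolding powers_def d_def by blast

lemma d_square: "d \<otimes> d = \<one>"
proof (cases "d = \<one>")
  case False
  have "d \<otimes> d \<in> {\<one>, d}"
    using powers_mult[of d m d] core by (simp add: d_def)
  moreover have "d \<otimes> d \<noteq> d" using False d_carrier by simp
  ultimately show ?thesis by blast
qed simp

lemma d_inv: "inv d = d"
  using d_square d_carrier by (simp add: inv_equality)

lemma hom_with_kernel:
  assumes N: "subgroup N (gpow k)" and k0: "k0 \<in> carrier (gpow k)"
    and base: "\<And>j::nat. k0 [^]\<^bsub>gpow k\<^esub> j \<in> N \<longleftrightarrow> g0 [^] j = \<one>"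
    and reduce: "\<And>a. a \<in> carrier (gpow k) \<Longrightarrow> \<exists>j::nat. (a \<otimes>\<^bsub>gpow k\<^esub> k0 [^]\<^bsub>gpow k\<^esub> j) [^]\<^bsub>gpow k\<^esub> m \<in> N"
  shows "\<exists>f\<in>hom (gpow k) G. \<forall>x\<in>carrier (gpow k). f x = \<one> \<longleftrightarrow> x \<in> N"
proof -
  have sub: "subgroup (adjoin G {\<one>} g0) G"
    by (rule adjoin_subgroup[OF triv_subgroup g0 exponent[OF g0] n_pos])
  have "finite (powers m)" using core by simp
  then obtain E where E: "subgroup E G" "adjoin G {\<one>} g0 \<subseteq> E" "injective_for m E"
    "\<And>p. prime p \<Longrightarrow> p dvd m \<Longrightarrow> infinite {z \<in> E. z [^] p = \<one>}"
    using exists_large_injective_subgroup[OF m_pos _ infinite_powers sub g0_injective] by auto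
  have g0E: "g0 \<in> E"
    using mem_adjoin[OF triv_subgroup g0] E(2) by blast
  have exp: "a [^]\<^bsub>gpow k\<^esub> n = \<one>\<^bsub>gpow k\<^esub>" if "a \<in> carrier (gpow k)" for a
  proof -
    have "(\<lambda>i\<in>{..<k}. a i [^] n) = (\<lambda>i\<in>{..<k}. \<one>)"
      using that by (intro restrict_ext) (auto intro!: exponent)
    then show ?thesis by (simp only: pow_group_power[OF that] one_product_group)
  qed
  have "kernel_problem G (gpow k) n m E N g0 k0"
    by (intro kernel_problem.intro kernel_problem_axioms.intro comm_group_axioms comm_group_power)
      (fact n_pos exponent exp E(1) E(3) E(4) N g0E k0 base reduce)+
  then interpret kernel_problem G "gpow k" n m E N g0 k0 .
  have "countable (carrier (gpow k))"
    using countable_tuple_functions[OF countable_carrier] by simp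
  then show ?thesis by (rule hom_with_kernel)
qed

text \<open>The kernels of the polymorphisms below are cut out inside a power of the core
  \<open>{\<one>, d}\<close> by one linear equation that involves the first coordinate.\<close>

lemma hom_with_core_kernel:
  assumes chi: "chi \<in> hom (gpow k) G" "\<And>y. y \<in> carrier G \<Longrightarrow> chi (single k 0 y) = y"
  shows "\<exists>f\<in>hom (gpow k) G. \<forall>x\<in>carrier (gpow k). f x = \<one> \<longleftrightarrow> (\<forall>i<k. x i \<in> {\<one>, d}) \<and> chi x = \<one>"
proof -
  interpret K: comm_group "gpow k" by (rule comm_group_power)
  interpret chi: group_hom "gpow k" G chi by (rule group_hom_power[OF chi(1)])
  define N where "N = {x \<in> carrier (gpow k). (\<forall>i<k. x i \<in> {\<one>, d}) \<and> chi x = \<one>}"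
  have mem: "x \<otimes> y \<in> {\<one>, d}" if "x \<in> {\<one>, d}" "y \<in> {\<one>, d}" for x y
    using that d_square d_carrier by auto
  have "subgroup N (gpow k)"
  proof (rule K.subgroupI)
    show "N \<subseteq> carrier (gpow k)" by (auto simp: N_def)
    have "\<one>\<^bsub>gpow k\<^esub> \<in> N"
      unfolding N_def using chi.hom_one by auto
    then show "N \<noteq> {}" by blast
    fix x assume x: "x \<in> N"
    then have xc: "x \<in> carrier (gpow k)" by (simp add: N_def)
    have "chi (inv\<^bsub>gpow k\<^esub> x) = \<one>"
      using x xc chi.hom_inv by (simp add: N_def del: inv_product_group carrier_product_group)
    moreover have "\<forall>i<k. (inv\<^bsub>gpow k\<^esub> x) i \<in> {\<one>, d}"
      unfolding inv_group_power[OF xc] using x d_inv by (auto simp: N_def)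
    ultimately show "inv\<^bsub>gpow k\<^esub> x \<in> N"
      using K.inv_closed[OF xc] unfolding N_def by blast
    fix y assume y: "y \<in> N"
    then have yc: "y \<in> carrier (gpow k)" by (simp add: N_def)
    have "chi (x \<otimes>\<^bsub>gpow k\<^esub> y) = \<one>"
      using x y chi.hom_mult[OF xc yc] by (simp add: N_def del: mult_product_group)
    moreover have "\<forall>i<k. (x \<otimes>\<^bsub>gpow k\<^esub> y) i \<in> {\<one>, d}"
      unfolding mult_group_power using x y mem by (auto simp: N_def)
    ultimately show "x \<otimes>\<^bsub>gpow k\<^esub> y \<in> N"
      using K.m_closed[OF xc yc] unfolding N_def by blast
  qed
  moreover have k0: "single k 0 g0 \<in> carrier (gpow k)"
    by (rule single_carrier[OF g0])
  moreover have "single k 0 g0 [^]\<^bsub>gpow k\<^esub> j \<in> N \<longleftrightarrow> g0 [^] j = \<one>" for j :: nat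
  proof -
    have "single k 0 (g0 [^] j) \<in> N \<longleftrightarrow> (\<forall>i<k. single k 0 (g0 [^] j) i \<in> {\<one>, d}) \<and> g0 [^] j = \<one>"
      unfolding N_def using single_carrier[of "g0 [^] j" k 0] chi(2)[of "g0 [^] j"] g0 by simp
    then show ?thesis
      unfolding single_pow[OF g0] by (auto simp: single_def)
  qed
  moreover have "\<exists>j::nat. (a \<otimes>\<^bsub>gpow k\<^esub> single k 0 g0 [^]\<^bsub>gpow k\<^esub> j) [^]\<^bsub>gpow k\<^esub> m \<in> N"
    if a: "a \<in> carrier (gpow k)" for a
  proof -
    have in_core: "\<forall>i<k. (b [^]\<^bsub>gpow k\<^esub> m) i \<in> {\<one>, d}" if b: "b \<in> carrier (gpow k)" for b
      unfolding pow_group_power[OF b] using pow_m b by (auto simp: PiE_iff)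
    have in_N: "b [^]\<^bsub>gpow k\<^esub> m \<in> N" if b: "b \<in> carrier (gpow k)" "chi b [^] m = \<one>" for b
      unfolding N_def using b in_core[OF b(1)] K.nat_pow_closed[OF b(1)] chi.hom_nat_pow[OF b(1)] by simp
    have closed: "a \<otimes>\<^bsub>gpow k\<^esub> single k 0 g0 [^]\<^bsub>gpow k\<^esub> j \<in> carrier (gpow k)" for j :: nat
      by (intro K.m_closed K.nat_pow_closed a k0)
    have chi_eq: "chi (a \<otimes>\<^bsub>gpow k\<^esub> single k 0 g0 [^]\<^bsub>gpow k\<^esub> j) = chi a \<otimes> g0 [^] j" for j :: nat
      using chi.hom_mult[OF a K.nat_pow_closed[OF k0, of j]] chi.hom_nat_pow[OF k0, of j] chi(2)[OF g0]
      by simp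
    have "(chi a \<otimes> g0 [^] j) [^] m = chi a [^] m \<otimes> d [^] j" for j :: nat
      using chi.hom_closed[OF a] g0 by (simp add: nat_pow_distrib d_def nat_pow_pow mult.commute)
    \<comment> \<open>The \<open>m\<close>-th power of any tuple has its entries in the core, so
      only the equation for \<open>chi\<close> can fail. Its defect is \<open>\<one>\<close> or
      \<open>d\<close>, and one factor \<open>single k 0 g0\<close> contributes exactly
      \<open>d\<close>.\<close>
    moreover have "chi a [^] m \<otimes> d [^] (0::nat) = \<one> \<or> chi a [^] m \<otimes> d [^] (1::nat) = \<one>"
      using pow_m[OF chi.hom_closed[OF a]] d_square d_carrier by auto
    ultimately show ?thesis
      using in_N[OF closed] unfolding chi_eq by metis
  qed
  ultimately have "\<exists>f\<in>hom (gpow k) G. \<forall>x\<in>carrier (gpow k). f x = \<one> \<longleftrightarrow> x \<in> N"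
    by (rule hom_with_kernel)
  then show ?thesis
    by (auto simp: N_def)
qed

end

subsection \<open>Groups with a small core\<close>

definition siggers_left :: "nat \<Rightarrow> nat" where
  "siggers_left i = [0, 1, 0, 2, 1, 2] ! i"

definition siggers_right :: "nat \<Rightarrow> nat" where
  "siggers_right i = [1, 0, 2, 0, 2, 1] ! i"

lemma siggers_maps: "siggers_left \<in> {..<6} \<rightarrow> {..<3}" "siggers_right \<in> {..<6} \<rightarrow> {..<3}"
  by (auto simp: siggers_left_def siggers_right_def less_6_nat)

lemma apply6_reindex:
  "apply6 s x y x z y z = s (reindex 6 siggers_left (vec [x, y, z]))"
  "apply6 s y x z x z y = s (reindex 6 siggers_right (vec [x, y, z]))"
proof -
  have "(\<lambda>i\<in>{..<6}. [x, y, x, z, y, z] ! i) = reindex 6 siggers_left (vec [x, y, z])"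
    unfolding reindex_def by (rule restrict_ext) (auto simp: less_6_nat siggers_left_def)
  moreover have "(\<lambda>i\<in>{..<6}. [y, x, z, x, z, y] ! i) = reindex 6 siggers_right (vec [x, y, z])"
    unfolding reindex_def by (rule restrict_ext) (auto simp: less_6_nat siggers_right_def)
  ultimately show "apply6 s x y x z y z = s (reindex 6 siggers_left (vec [x, y, z]))"
    "apply6 s y x z x z y = s (reindex 6 siggers_right (vec [x, y, z]))"
    by (simp_all only: apply6_def)
qed

lemma (in comm_group) group_power_coord: "x \<in> carrier (gpow k) \<Longrightarrow> i < k \<Longrightarrow> x i \<in> carrier G"
  by (simp add: PiE_iff)

lemma all_less_3: "(\<forall>i<3::nat. P i) \<longleftrightarrow> P 0 \<and> P 1 \<and> P 2"
  unfolding less_3_nat by blast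

lemma all_less_6: "(\<forall>i<6::nat. P i) \<longleftrightarrow> P 0 \<and> P 1 \<and> P 2 \<and> P 3 \<and> P 4 \<and> P 5"
  unfolding less_6_nat by blast

context small_core
begin

text \<open>The homomorphism \<open>e\<close> amalgamates two copies of \<open>G\<close> along the images of the two sides of
  the Siggers identity; its two coordinate restrictions are the required endomorphisms.\<close>

lemma siggers_amalgam:
  assumes A: "A \<in> hom (gpow 3) G" and B: "B \<in> hom (gpow 3) G"
    and kerA: "\<And>t. t \<in> carrier (gpow 3) \<Longrightarrow> A t = \<one> \<longleftrightarrow> (\<forall>i<3. t i \<in> {\<one>, d}) \<and> t 1 = \<one>"
    and kerB: "\<And>t. t \<in> carrier (gpow 3) \<Longrightarrow> B t = \<one> \<longleftrightarrow> (\<forall>i<3. t i \<in> {\<one>, d}) \<and> t 1 = \<one>"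
  shows "\<exists>e1 e2. e1 \<in> hom G G \<and> e2 \<in> hom G G \<and>
    (\<forall>u\<in>carrier G. e1 u = \<one> \<longrightarrow> u = \<one>) \<and> (\<forall>u\<in>carrier G. e2 u = \<one> \<longrightarrow> u = \<one>) \<and>
    (\<forall>t\<in>carrier (gpow 3). e1 (A t) = e2 (B t))"
proof -
  interpret K: comm_group "gpow 2" by (rule comm_group_power)
  interpret K3: comm_group "gpow 3" by (rule comm_group_power)
  interpret A: group_hom "gpow 3" G A by (rule group_hom_power[OF A])
  interpret B: group_hom "gpow 3" G B by (rule group_hom_power[OF B])
  \<comment> \<open>These pairs must become trivial when \<open>A t\<close> is identified with
    \<open>B t\<close>. As \<open>A\<close> and \<open>B\<close> have the same kernel,
    \<open>N\<close> meets both coordinate axes trivially, which makes \<open>e1\<close> and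
    \<open>e2\<close> injective.\<close>
  define N where "N = {p \<in> carrier (gpow 2). \<exists>t\<in>carrier (gpow 3). p 0 = A t \<and> p 1 = inv (B t)}"
  have N_I: "p \<in> N" if "p \<in> carrier (gpow 2)" "t \<in> carrier (gpow 3)" "p 0 = A t" "p 1 = inv (B t)" for p t
    using that unfolding N_def by blast
  have N_one: "p \<in> N" if "p \<in> carrier (gpow 2)" "p 0 = \<one>" "p 1 = \<one>" for p
    using N_I[OF that(1) K3.one_closed] that A.hom_one B.hom_one by (simp del: one_product_group)
  have "subgroup N (gpow 2)"
  proof (rule K.subgroupI)
    show "N \<subseteq> carrier (gpow 2)" unfolding N_def by blast
    have "\<one>\<^bsub>gpow 2\<^esub> \<in> N" by (rule N_one) auto
    then show "N \<noteq> {}" by blast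
    fix p assume "p \<in> N"
    then obtain t where p: "p \<in> carrier (gpow 2)" "t \<in> carrier (gpow 3)" "p 0 = A t" "p 1 = inv (B t)"
      unfolding N_def by blast
    show "inv\<^bsub>gpow 2\<^esub> p \<in> N"
    proof (rule N_I[OF K.inv_closed[OF p(1)] K3.inv_closed[OF p(2)]])
      show "(inv\<^bsub>gpow 2\<^esub> p) 0 = A (inv\<^bsub>gpow 3\<^esub> t)"
        unfolding A.hom_inv[OF p(2)] inv_group_power[OF p(1)] using p by simp
      show "(inv\<^bsub>gpow 2\<^esub> p) 1 = inv (B (inv\<^bsub>gpow 3\<^esub> t))"
        unfolding B.hom_inv[OF p(2)] inv_group_power[OF p(1)] using p by simp
    qed
    fix q assume "q \<in> N"
    then obtain u where q: "q \<in> carrier (gpow 2)" "u \<in> carrier (gpow 3)" "q 0 = A u" "q 1 = inv (B u)"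
      unfolding N_def by blast
    show "p \<otimes>\<^bsub>gpow 2\<^esub> q \<in> N"
    proof (rule N_I[OF K.m_closed[OF p(1) q(1)] K3.m_closed[OF p(2) q(2)]])
      show "(p \<otimes>\<^bsub>gpow 2\<^esub> q) 0 = A (t \<otimes>\<^bsub>gpow 3\<^esub> u)"
        unfolding A.hom_mult[OF p(2) q(2)] unfolding mult_group_power using p q by simp
      show "(p \<otimes>\<^bsub>gpow 2\<^esub> q) 1 = inv (B (t \<otimes>\<^bsub>gpow 3\<^esub> u))"
        unfolding B.hom_mult[OF p(2) q(2)] unfolding mult_group_power
        using p(4) q(4) inv_mult[OF B.hom_closed[OF p(2)] B.hom_closed[OF q(2)]] by simp
    qed
  qed
  moreover have k0: "single 2 0 g0 \<in> carrier (gpow 2)"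
    by (rule single_carrier[OF g0])
  moreover have base: "single 2 0 g0 [^]\<^bsub>gpow 2\<^esub> j \<in> N \<longleftrightarrow> g0 [^] j = \<one>" for j :: nat
    unfolding single_pow[OF g0]
  proof
    assume "single 2 0 (g0 [^] j) \<in> N"
    then obtain t where t: "t \<in> carrier (gpow 3)" "g0 [^] j = A t" "\<one> = inv (B t)"
      unfolding N_def by (auto simp: single_def)
    then have "B t = \<one>"
      using B.hom_closed[OF t(1)] by (metis inv_inv inv_one)
    then show "g0 [^] j = \<one>"
      using kerA[OF t(1)] kerB[OF t(1)] t(2) by simp
  next
    assume "g0 [^] j = \<one>"
    then show "single 2 0 (g0 [^] j) \<in> N"
      using single_carrier[of \<one> 2 0] by (intro N_one) (auto simp: single_def)
  qed
  moreover have "\<exists>j::nat. (a \<otimes>\<^bsub>gpow 2\<^esub> single 2 0 g0 [^]\<^bsub>gpow 2\<^esub> j) [^]\<^bsub>gpow 2\<^esub> m \<in> N"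
    if a: "a \<in> carrier (gpow 2)" for a
  proof -
    \<comment> \<open>An \<open>m\<close>-th power outside the kernel is sent to a nontrivial core
      element, and \<open>d\<close> is the only one.\<close>
    have at_d: "H (single 3 1 d) = d"
      if H: "H \<in> hom (gpow 3) G"
        and ker: "\<And>t. t \<in> carrier (gpow 3) \<Longrightarrow> H t = \<one> \<longleftrightarrow> (\<forall>i<3. t i \<in> {\<one>, d}) \<and> t 1 = \<one>" for H
    proof (cases "d = \<one>")
      case True
      then have "single 3 1 d = \<one>\<^bsub>gpow 3\<^esub>" by (simp only: single_one)
      then show ?thesis
        using True group_hom.hom_one[OF group_hom_power[OF H]] by (simp only:)
    next
      case False
      have "single 3 1 d = single 3 1 g0 [^]\<^bsub>gpow 3\<^esub> m"
        unfolding single_pow[OF g0] d_def ..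
      then have "H (single 3 1 d) = H (single 3 1 g0) [^] m"
        using group_hom.hom_nat_pow[OF group_hom_power[OF H] single_carrier[OF g0]] by (simp only:)
      moreover have "H (single 3 1 g0) \<in> carrier G"
        using group_hom.hom_closed[OF group_hom_power[OF H] single_carrier[OF g0]] .
      moreover have "H (single 3 1 d) \<noteq> \<one>"
        using ker[OF single_carrier[OF d_carrier]] False by (auto simp: single_def)
      ultimately show ?thesis using pow_m by metis
    qed
    have in_N: "p \<in> N" if p: "p \<in> carrier (gpow 2)" "p 0 = p 1" "p 0 \<in> {\<one>, d}" for p
    proof (cases "p 0 = \<one>")
      case True
      then show ?thesis using p(2) by (intro N_one[OF p(1)]) simp_all
    next
      case False
      then have "p 0 = d" "p 1 = d" using p(2,3) by auto
      then show ?thesis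
        using at_d[OF A kerA] at_d[OF B kerB] d_inv
        by (intro N_I[OF p(1) single_carrier[OF d_carrier, of 3 1]]) (simp_all only:)
    qed
    have aG: "a 0 \<in> carrier G" "a 1 \<in> carrier G"
      using group_power_coord[OF a] by simp_all
    have closed: "(a \<otimes>\<^bsub>gpow 2\<^esub> single 2 0 g0 [^]\<^bsub>gpow 2\<^esub> j) [^]\<^bsub>gpow 2\<^esub> m \<in> carrier (gpow 2)" for j :: nat
      by (intro K.m_closed K.nat_pow_closed a k0)
    have eq: "(a \<otimes>\<^bsub>gpow 2\<^esub> single 2 0 g0 [^]\<^bsub>gpow 2\<^esub> j) [^]\<^bsub>gpow 2\<^esub> m =
        (\<lambda>i\<in>{..<2}. (a i \<otimes> single 2 0 (g0 [^] j) i) [^] m)" for j :: nat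
      unfolding pow_group_power[OF K.m_closed[OF a K.nat_pow_closed[OF k0]]]
      unfolding mult_group_power single_pow[OF g0] by (rule restrict_ext) simp
    have coords: "((a \<otimes>\<^bsub>gpow 2\<^esub> single 2 0 g0 [^]\<^bsub>gpow 2\<^esub> j) [^]\<^bsub>gpow 2\<^esub> m) 0 = a 0 [^] m \<otimes> d [^] j"
      "((a \<otimes>\<^bsub>gpow 2\<^esub> single 2 0 g0 [^]\<^bsub>gpow 2\<^esub> j) [^]\<^bsub>gpow 2\<^esub> m) 1 = a 1 [^] m" for j :: nat
      unfolding eq using aG g0
      by (simp_all add: single_def nat_pow_distrib d_def nat_pow_pow mult.commute)
    \<comment> \<open>A power of \<open>g0\<close> in the first coordinate makes both entries of the
      \<open>m\<close>-th power equal, and \<open>in_N\<close> covers such diagonal pairs of core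
      elements.\<close>
    have "a 0 [^] m \<otimes> d [^] (0::nat) = a 1 [^] m \<or> a 0 [^] m \<otimes> d [^] (1::nat) = a 1 [^] m"
      using pow_m[OF aG(1)] pow_m[OF aG(2)] d_square d_carrier by auto
    then obtain j :: nat where j: "a 0 [^] m \<otimes> d [^] j = a 1 [^] m" by blast
    have "(a \<otimes>\<^bsub>gpow 2\<^esub> single 2 0 g0 [^]\<^bsub>gpow 2\<^esub> j) [^]\<^bsub>gpow 2\<^esub> m \<in> N"
      by (rule in_N[OF closed]; unfold coords j) (use pow_m[OF aG(2)] in blast)+
    then show ?thesis ..
  qed
  ultimately have "\<exists>e\<in>hom (gpow 2) G. \<forall>p\<in>carrier (gpow 2). e p = \<one> \<longleftrightarrow> p \<in> N"
    by (rule hom_with_kernel)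
  then obtain e where e: "e \<in> hom (gpow 2) G" "\<And>p. p \<in> carrier (gpow 2) \<Longrightarrow> e p = \<one> \<longleftrightarrow> p \<in> N"
    by blast
  interpret e: group_hom "gpow 2" G e by (rule group_hom_power[OF e(1)])
  define e1 where "e1 = e \<circ> single 2 0"
  define e2 where "e2 = e \<circ> single 2 1"
  have hom: "e1 \<in> hom G G" "e2 \<in> hom G G"
    unfolding e1_def e2_def by (rule Group.hom_compose[OF single_hom e(1)])+
  have ker1: "u = \<one>" if "u \<in> carrier G" "e1 u = \<one>" for u
  proof -
    have "single 2 0 u \<in> N" using e(2)[OF single_carrier[OF that(1)]] that(2) by (simp add: e1_def)
    then obtain t where t: "t \<in> carrier (gpow 3)" "u = A t" "\<one> = inv (B t)"
      unfolding N_def by (auto simp: single_def)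
    then have "B t = \<one>"
      using B.hom_closed[OF t(1)] by (metis inv_inv inv_one)
    then show ?thesis
      using kerA[OF t(1)] kerB[OF t(1)] t(2) by simp
  qed
  have ker2: "u = \<one>" if "u \<in> carrier G" "e2 u = \<one>" for u
  proof -
    have "single 2 1 u \<in> N" using e(2)[OF single_carrier[OF that(1)]] that(2) by (simp add: e2_def)
    then obtain t where t: "t \<in> carrier (gpow 3)" "\<one> = A t" "u = inv (B t)"
      unfolding N_def by (auto simp: single_def)
    then have "A t = \<one>" by simp
    then have "B t = \<one>" using kerA[OF t(1)] kerB[OF t(1)] by blast
    then show ?thesis using t(3) by simp
  qed
  have "e1 (A t) = e2 (B t)" if t: "t \<in> carrier (gpow 3)" for t
  proof -
    note c = A.hom_closed[OF t] B.hom_closed[OF t]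
    let ?p = "single 2 0 (A t) \<otimes>\<^bsub>gpow 2\<^esub> inv\<^bsub>gpow 2\<^esub> single 2 1 (B t)"
    have p: "?p \<in> carrier (gpow 2)"
      by (intro K.m_closed K.inv_closed single_carrier c)
    have "?p 0 = A t" "?p 1 = inv (B t)"
      unfolding mult_group_power inv_group_power[OF single_carrier[OF c(2)]]
      using c by (simp_all add: single_def)
    then have "e ?p = \<one>"
      using e(2)[OF p] N_I[OF p t] by blast
    then have "e1 (A t) \<otimes> inv (e2 (B t)) = \<one>"
      using e.hom_mult[OF single_carrier[OF c(1)] K.inv_closed[OF single_carrier[OF c(2)]]]
        e.hom_inv[OF single_carrier[OF c(2)]] by (simp add: e1_def e2_def)
    moreover have "e1 (A t) \<in> carrier G" "e2 (B t) \<in> carrier G"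
      using hom c by (auto simp: hom_def)
    ultimately show ?thesis by (rule eq_of_diff_one[rotated 2])
  qed
  with hom ker1 ker2 show ?thesis by blast
qed

theorem exists_pseudo_Siggers:
  "\<exists>s. pseudo_Siggers group_neq_sig (group_neq_struct G) s"
proof -
  \<comment> \<open>Three terms, an odd number, exclude the tuple with all entries \<open>d\<close>.
    Positions 0, 2, 4 read x, x, y on the left of the Siggers identity and y, z, z on the right.
    Squares of core elements vanish, so both sides have the same kernel, given by the condition that
    y is trivial.\<close>
  define chi where "chi x = x 0 \<otimes> x 2 \<otimes> x 4" for x :: "nat \<Rightarrow> 'a"
  have "chi \<in> hom (gpow 6) G"
  proof (rule homI)
    show "chi x \<in> carrier G" if "x \<in> carrier (gpow 6)" for x
      using group_power_coord[OF that] by (simp add: chi_def)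
    fix x y assume "x \<in> carrier (gpow 6)" "y \<in> carrier (gpow 6)"
    then have "x i \<in> carrier G" "y i \<in> carrier G" if "i < 6" for i
      using group_power_coord that by blast+
    then show "chi (x \<otimes>\<^bsub>gpow 6\<^esub> y) = chi x \<otimes> chi y"
      by (simp add: chi_def m_ac)
  qed
  moreover have "chi (single 6 0 y) = y" if "y \<in> carrier G" for y
    using that by (simp add: chi_def single_def)
  ultimately obtain f where f: "f \<in> hom (gpow 6) G" and
    ker: "\<And>x. x \<in> carrier (gpow 6) \<Longrightarrow> f x = \<one> \<longleftrightarrow> (\<forall>i<6. x i \<in> {\<one>, d}) \<and> x 0 \<otimes> x 2 \<otimes> x 4 = \<one>"
    using hom_with_core_kernel[of chi 6] unfolding chi_def by auto
  have "polymorphic 6 f"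
    unfolding polymorphic_def
  proof (intro conjI f ballI impI)
    fix x assume x: "x \<in> carrier (gpow 6)" "f x = \<one>"
    show "\<exists>i<6. x i = \<one>"
    proof (rule ccontr)
      assume no: "\<not> (\<exists>i<6. x i = \<one>)"
      then have "x i = d" if "i < 6" for i
        using ker[OF x(1)] x(2) that by blast
      then have "d \<otimes> d \<otimes> d = \<one>" "x 0 = d"
        using ker[OF x(1)] x(2) by auto
      then show False
        using no d_square d_carrier by auto
    qed
  qed
  then have Pol: "restrict f (carrier (gpow 6)) \<in> Pol group_neq_sig (group_neq_struct G) 6"
    using restrict_in_Pol[of 6 f] by simp
  define A where "A = f \<circ> reindex 6 siggers_left"
  define B where "B = f \<circ> reindex 6 siggers_right"
  have AB: "A \<in> hom (gpow 3) G" "B \<in> hom (gpow 3) G"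
    unfolding A_def B_def by (rule Group.hom_compose[OF reindex_hom f], rule siggers_maps)+
  have re: "reindex 6 siggers_left t \<in> carrier (gpow 6)" "reindex 6 siggers_right t \<in> carrier (gpow 6)"
    if "t \<in> carrier (gpow 3)" for t
    using hom_in_carrier[OF reindex_hom[OF siggers_maps(1)] that]
      hom_in_carrier[OF reindex_hom[OF siggers_maps(2)] that] .
  have cancel: "x \<otimes> x \<otimes> y = y" "y \<otimes> x \<otimes> x = y" if "x \<in> {\<one>, d}" "y \<in> carrier G" for x y
    using that d_square d_carrier by (auto simp: m_assoc)
  have kerA: "A t = \<one> \<longleftrightarrow> (\<forall>i<3. t i \<in> {\<one>, d}) \<and> t 1 = \<one>" if t: "t \<in> carrier (gpow 3)" for t
  proof -
    have "A t = \<one> \<longleftrightarrow> (\<forall>i<3. t i \<in> {\<one>, d}) \<and> t 0 \<otimes> t 0 \<otimes> t 1 = \<one>"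
      unfolding A_def comp_apply ker[OF re(1)[OF t]] all_less_6 all_less_3
      by (auto simp: reindex_def siggers_left_def)
    moreover have "t 0 \<otimes> t 0 \<otimes> t 1 = t 1" if "\<forall>i<3. t i \<in> {\<one>, d}"
      using that group_power_coord[OF t, of 1] by (intro cancel) simp_all
    ultimately show ?thesis by auto
  qed
  have kerB: "B t = \<one> \<longleftrightarrow> (\<forall>i<3. t i \<in> {\<one>, d}) \<and> t 1 = \<one>" if t: "t \<in> carrier (gpow 3)" for t
  proof -
    have "B t = \<one> \<longleftrightarrow> (\<forall>i<3. t i \<in> {\<one>, d}) \<and> t 1 \<otimes> t 2 \<otimes> t 2 = \<one>"
      unfolding B_def comp_apply ker[OF re(2)[OF t]] all_less_6 all_less_3
      by (auto simp: reindex_def siggers_right_def)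
    moreover have "t 1 \<otimes> t 2 \<otimes> t 2 = t 1" if "\<forall>i<3. t i \<in> {\<one>, d}"
      using that group_power_coord[OF t, of 1] by (intro cancel) simp_all
    ultimately show ?thesis by auto
  qed
  obtain e1 e2 where e: "e1 \<in> hom G G" "e2 \<in> hom G G"
    "\<And>u. u \<in> carrier G \<Longrightarrow> e1 u = \<one> \<Longrightarrow> u = \<one>" "\<And>u. u \<in> carrier G \<Longrightarrow> e2 u = \<one> \<Longrightarrow> u = \<one>"
    "\<And>t. t \<in> carrier (gpow 3) \<Longrightarrow> e1 (A t) = e2 (B t)"
    using siggers_amalgam[OF AB kerA kerB] by blast
  let ?s = "restrict f (carrier (gpow 6))"
  have "e1 (apply6 ?s x y x z y z) = e2 (apply6 ?s y x z x z y)"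
    if "x \<in> carrier G" "y \<in> carrier G" "z \<in> carrier G" for x y z
  proof -
    have t: "vec [x, y, z] \<in> carrier (gpow 3)"
      using vec_carrier[of "[x, y, z]" 3 "carrier G"] that by simp
    show ?thesis
      unfolding apply6_reindex restrict_apply'[OF re(1)[OF t]] restrict_apply'[OF re(2)[OF t]]
      using e(5)[OF t] by (simp add: A_def B_def)
  qed
  moreover have "univ (group_neq_struct G) = carrier G"
    by (simp add: group_neq_struct_def group_struct_def)
  ultimately have "\<forall>x\<in>univ (group_neq_struct G). \<forall>y\<in>univ (group_neq_struct G). \<forall>z\<in>univ (group_neq_struct G).
      e1 (apply6 ?s x y x z y z) = e2 (apply6 ?s y x z x z y)"
    by (simp only:) blast
  then have "pseudo_Siggers group_neq_sig (group_neq_struct G) ?s"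
    unfolding pseudo_Siggers_def
    using Pol embedding_fo_hom[OF e(1,3)] embedding_fo_hom[OF e(2,4)] by blast
  then show ?thesis by blast
qed

end

text \<open>Since \<open>\<xi>\<close> sends \<open>f\<close> to one projection, the same argument
  \<open>i\<close> governs both minors; this ties their images together.\<close>

lemma minor_preserving_two_minors:
  assumes \<xi>: "minor_preserving B C (UNIV :: bool set) (projection_clone UNIV) \<xi>"
    and "f \<in> C n" "\<sigma> \<in> {..<n} \<rightarrow> {..<k}" "\<tau> \<in> {..<n} \<rightarrow> {..<k}"
    and "op_comp B n k f (\<lambda>i. projection B k (\<sigma> i)) = g" "op_comp B n k f (\<lambda>i. projection B k (\<tau> i)) = g'"
  shows "\<exists>i<n. \<xi> k g = projection UNIV k (\<sigma> i) \<and> \<xi> k g' = projection UNIV k (\<tau> i)"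
proof -
  have "\<xi> n f \<in> projection_clone UNIV n"
    using \<xi> assms(2) unfolding minor_preserving_def by blast
  then obtain i where i: "i < n" "\<xi> n f = projection UNIV n i"
    unfolding projection_clone_def by blast
  have "\<xi> k (op_comp B n k f (\<lambda>i. projection B k (\<rho> i))) = projection UNIV k (\<rho> i)"
    if "\<rho> \<in> {..<n} \<rightarrow> {..<k}" for \<rho>
  proof -
    have "\<xi> k (op_comp B n k f (\<lambda>i. projection B k (\<rho> i))) =
        op_comp UNIV n k (\<xi> n f) (\<lambda>i. projection UNIV k (\<rho> i))"
      using \<xi> assms(2) that unfolding minor_preserving_def by blast
    then show ?thesis
      unfolding i(2) op_comp_projection_projection[OF that i(1)] .
  qed
  then show ?thesis
    using i(1) assms(3-6) by blast
qed

context comm_group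
begin

lemma coord_hom: "i < k \<Longrightarrow> (\<lambda>x. x i) \<in> hom (gpow k) G"
  by (rule homI) (use group_power_coord in \<open>auto simp del: carrier_product_group\<close>)

lemma hom_mult_pointwise:
  assumes f: "f \<in> hom (gpow k) G" and g: "g \<in> hom (gpow k) G"
  shows "(\<lambda>x. f x \<otimes> g x) \<in> hom (gpow k) G"
proof (rule homI)
  note closed = hom_in_carrier[OF f] hom_in_carrier[OF g]
  show "f x \<otimes> g x \<in> carrier G" if "x \<in> carrier (gpow k)" for x
    using closed[OF that] by simp
  fix x y assume xy: "x \<in> carrier (gpow k)" "y \<in> carrier (gpow k)"
  show "f (x \<otimes>\<^bsub>gpow k\<^esub> y) \<otimes> g (x \<otimes>\<^bsub>gpow k\<^esub> y) = f x \<otimes> g x \<otimes> (f y \<otimes> g y)"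
    unfolding hom_mult[OF f xy] hom_mult[OF g xy] using closed[OF xy(1)] closed[OF xy(2)]
    by (simp add: m_ac)
qed

lemma hom_inv_pointwise:
  assumes f: "f \<in> hom (gpow k) G"
  shows "(\<lambda>x. inv (f x)) \<in> hom (gpow k) G"
proof (rule homI)
  note closed = hom_in_carrier[OF f]
  show "inv (f x) \<in> carrier G" if "x \<in> carrier (gpow k)" for x
    using closed[OF that] by simp
  fix x y assume xy: "x \<in> carrier (gpow k)" "y \<in> carrier (gpow k)"
  show "inv (f (x \<otimes>\<^bsub>gpow k\<^esub> y)) = inv (f x) \<otimes> inv (f y)"
    unfolding hom_mult[OF f xy] using closed[OF xy(1)] closed[OF xy(2)] by (rule inv_mult)
qed

lemma hom_vec3:
  assumes "f \<in> hom (gpow k) G" "g \<in> hom (gpow k) G" "h \<in> hom (gpow k) G"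
  shows "(\<lambda>x. vec [f x, g x, h x]) \<in> hom (gpow k) (gpow 3)"
proof (rule homI)
  show "vec [f x, g x, h x] \<in> carrier (gpow 3)" if "x \<in> carrier (gpow k)" for x
    using vec_carrier[of "[f x, g x, h x]" 3 "carrier G"] assms[THEN hom_in_carrier, OF that] by simp
  fix x y assume xy: "x \<in> carrier (gpow k)" "y \<in> carrier (gpow k)"
  show "vec [f (x \<otimes>\<^bsub>gpow k\<^esub> y), g (x \<otimes>\<^bsub>gpow k\<^esub> y), h (x \<otimes>\<^bsub>gpow k\<^esub> y)] =
      vec [f x, g x, h x] \<otimes>\<^bsub>gpow 3\<^esub> vec [f y, g y, h y]"
    unfolding assms[THEN hom_mult, OF xy] unfolding mult_group_power
    unfolding vec_def by (rule ext) (auto simp: less_3_nat)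
qed

end

context small_core
begin

theorem no_minor_preserving_map:
  "\<not> minor_preserving (carrier G) (Pol group_neq_sig (group_neq_struct G))
      (UNIV :: bool set) (projection_clone UNIV) \<xi>"
proof
  let ?Pol = "Pol group_neq_sig (group_neq_struct G)"
  assume \<xi>: "minor_preserving (carrier G) ?Pol (UNIV :: bool set) (projection_clone UNIV) \<xi>"
  have "\<exists>h\<in>hom (gpow 3) G. \<forall>x\<in>carrier (gpow 3). h x = \<one> \<longleftrightarrow> (\<forall>i<3. x i \<in> {\<one>, d}) \<and> x 0 = \<one>"
    by (rule hom_with_core_kernel) (auto simp: single_def intro: coord_hom)
  then obtain h where h: "h \<in> hom (gpow 3) G" and
    ker: "\<And>x. x \<in> carrier (gpow 3) \<Longrightarrow> h x = \<one> \<longleftrightarrow> (\<forall>i<3. x i \<in> {\<one>, d}) \<and> x 0 = \<one>"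
    by blast
  define P where "P V a b = (\<lambda>x::nat \<Rightarrow> 'a. h (vec [V x, a x, b x]))" for V a b :: "(nat \<Rightarrow> 'a) \<Rightarrow> 'a"
  have P_Pol: "restrict (P V a b) ({..<3} \<rightarrow>\<^sub>E carrier G) \<in> ?Pol 3"
    if homs: "V \<in> hom (gpow 3) G" "a \<in> hom (gpow 3) G" "b \<in> hom (gpow 3) G"
      and nonzero: "\<And>x. x \<in> carrier (gpow 3) \<Longrightarrow> V x = \<one> \<Longrightarrow> a x \<in> {\<one>, d} \<Longrightarrow> b x \<in> {\<one>, d} \<Longrightarrow> \<exists>i<3. x i = \<one>"
    for V a b
  proof (rule restrict_in_Pol)
    have "P V a b \<in> hom (gpow 3) G"
      using Group.hom_compose[OF hom_vec3[OF homs] h] by (simp add: P_def comp_def)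
    moreover have "\<exists>i<3. x i = \<one>" if x: "x \<in> carrier (gpow 3)" "P V a b x = \<one>" for x
    proof (rule nonzero[OF x(1)])
      have "(\<forall>i<3. vec [V x, a x, b x] i \<in> {\<one>, d}) \<and> vec [V x, a x, b x] 0 = \<one>"
        using ker[OF hom_in_carrier[OF hom_vec3[OF homs] x(1)]] x(2) unfolding P_def by blast
      then show "V x = \<one>" "a x \<in> {\<one>, d}" "b x \<in> {\<one>, d}"
        by (simp_all add: all_less_3)
    qed
    ultimately show "polymorphic 3 (P V a b)"
      by (simp add: polymorphic_def)
  qed simp
  have minor: "op_comp (carrier G) 3 2 (restrict (P V a b) ({..<3} \<rightarrow>\<^sub>E carrier G)) (\<lambda>i. projection (carrier G) 2 (\<sigma> i)) =
      (\<lambda>x\<in>{..<2::nat} \<rightarrow>\<^sub>E carrier G. h (vec [V' x, a' x, b' x]))"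
    if \<sigma>: "\<sigma> \<in> {..<3} \<rightarrow> {..<2}"
      and eq: "\<And>x. x 0 \<in> carrier G \<Longrightarrow> x 1 \<in> carrier G \<Longrightarrow> V (reindex 3 \<sigma> x) = V' x \<and> a (reindex 3 \<sigma> x) = a' x \<and> b (reindex 3 \<sigma> x) = b' x"
    for V a b \<sigma> V' a' b'
    unfolding op_comp_projection[OF \<sigma>]
  proof (rule restrict_ext)
    fix x :: "nat \<Rightarrow> 'a" assume x: "x \<in> {..<2} \<rightarrow>\<^sub>E carrier G"
    then have "x 0 \<in> carrier G" "x 1 \<in> carrier G" by (simp_all add: PiE_iff)
    then show "restrict (P V a b) ({..<3} \<rightarrow>\<^sub>E carrier G) (reindex 3 \<sigma> x) = h (vec [V' x, a' x, b' x])"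
      unfolding restrict_apply'[OF reindex_carrier[OF \<sigma> x]] P_def using eq[of x] by simp
  qed
  have c: "(\<lambda>x. x i) \<in> hom (gpow 3) G" if "i < 3" for i
    using coord_hom that .
  note homs = hom_mult_pointwise hom_inv_pointwise c
  let ?A = "\<lambda>x\<in>{..<2::nat} \<rightarrow>\<^sub>E carrier G. h (vec [x 1, x 0 \<otimes> inv (x 1), \<one>])"
  let ?A' = "\<lambda>x\<in>{..<2::nat} \<rightarrow>\<^sub>E carrier G. h (vec [x 1, \<one>, x 0 \<otimes> inv (x 1)])"
  let ?p = "\<lambda>i. projection (UNIV :: bool set) 2 i"
  have maps: "(!) [0, 1, 1] \<in> {..<3} \<rightarrow> {..<2::nat}" "(!) [1, 0, 1] \<in> {..<3} \<rightarrow> {..<2::nat}"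
    "(!) [1, 0, 0] \<in> {..<3} \<rightarrow> {..<2::nat}" "(!) [0, 1, 0] \<in> {..<3} \<rightarrow> {..<2::nat}"
    by (auto simp: less_3_nat)
  have cancel: "x \<otimes> y \<otimes> inv x = y" "y \<otimes> x \<otimes> inv x = y"
    if "x \<in> carrier G" "y \<in> carrier G" for x y
    using that by (simp_all add: m_comm[of x y] m_assoc)
  \<comment> \<open>Write \<open>h\<close> as the triple \<open>(v, a, b)\<close> of its components. The four operations have the
    components \<open>(a, b, v-a-b)\<close>, \<open>(a, v-b, b-a)\<close>, \<open>(v-a, b, a-b)\<close> and \<open>(v-a, v-b, a+b-v)\<close>,
    and all of them have both \<open>(a, v-a)\<close> and \<open>(b, v-b)\<close> among their binary minors.\<close>
  have 1: "\<exists>i<3. \<xi> 2 ?A = ?p ([0, 1, 1] ! i) \<and> \<xi> 2 ?A' = ?p ([1, 0, 1] ! i)"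
  proof (rule minor_preserving_two_minors[OF \<xi> _ maps(1,2)])
    show "restrict (P (\<lambda>x. x 2) (\<lambda>x. x 0 \<otimes> inv (x 2)) (\<lambda>x. x 1 \<otimes> inv (x 2))) ({..<3} \<rightarrow>\<^sub>E carrier G) \<in> ?Pol 3"
      by (rule P_Pol) ((intro homs; simp)+, rule exI[of _ 2], simp)
  qed (rule minor, rule maps, simp add: reindex_def)+
  have 2: "\<exists>i<3. \<xi> 2 ?A = ?p ([0, 1, 1] ! i) \<and> \<xi> 2 ?A' = ?p ([0, 1, 0] ! i)"
  proof (rule minor_preserving_two_minors[OF \<xi> _ maps(1,4)])
    show "restrict (P (\<lambda>x. x 1) (\<lambda>x. x 0 \<otimes> inv (x 2)) (\<lambda>x. x 2 \<otimes> inv (x 1))) ({..<3} \<rightarrow>\<^sub>E carrier G) \<in> ?Pol 3"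
      by (rule P_Pol) ((intro homs; simp)+, rule exI[of _ 1], simp)
  qed (rule minor, rule maps, simp add: reindex_def)+
  have 3: "\<exists>i<3. \<xi> 2 ?A = ?p ([1, 0, 0] ! i) \<and> \<xi> 2 ?A' = ?p ([1, 0, 1] ! i)"
  proof (rule minor_preserving_two_minors[OF \<xi> _ maps(3,2)])
    show "restrict (P (\<lambda>x. x 0) (\<lambda>x. x 2 \<otimes> inv (x 0)) (\<lambda>x. x 1 \<otimes> inv (x 2))) ({..<3} \<rightarrow>\<^sub>E carrier G) \<in> ?Pol 3"
      by (rule P_Pol) ((intro homs; simp)+, rule exI[of _ 0], simp)
  qed (rule minor, rule maps, simp add: reindex_def)+
  have 4: "\<exists>i<3. \<xi> 2 ?A = ?p ([1, 0, 0] ! i) \<and> \<xi> 2 ?A' = ?p ([0, 1, 0] ! i)"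
  proof (rule minor_preserving_two_minors[OF \<xi> _ maps(3,4)])
    show "restrict (P (\<lambda>x. x 0 \<otimes> x 1 \<otimes> inv (x 2)) (\<lambda>x. x 2 \<otimes> inv (x 0)) (\<lambda>x. x 2 \<otimes> inv (x 1)))
        ({..<3} \<rightarrow>\<^sub>E carrier G) \<in> ?Pol 3"
    proof (rule P_Pol)
      fix x assume x: "x \<in> carrier (gpow 3)" "x 0 \<otimes> x 1 \<otimes> inv (x 2) = \<one>"
        "x 2 \<otimes> inv (x 0) \<in> {\<one>, d}" "x 2 \<otimes> inv (x 1) \<in> {\<one>, d}"
      note xc = group_power_coord[OF x(1), of 0] group_power_coord[OF x(1), of 1] group_power_coord[OF x(1), of 2]
      have x2: "x 0 \<otimes> x 1 = x 2"
        using eq_of_diff_one[OF _ _ x(2)] xc by simp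
      have "x 2 \<otimes> inv (x 0) = x 1" "x 2 \<otimes> inv (x 1) = x 0"
        unfolding x2[symmetric] using cancel xc by simp_all
      then have "x 1 \<in> {\<one>, d}" "x 0 \<in> {\<one>, d}"
        using x(3,4) by simp_all
      \<comment> \<open>If \<open>x 0\<close> and \<open>x 1\<close> both equal \<open>d\<close>,
        then \<open>x 2\<close> is \<open>d \<otimes> d = \<one>\<close>.\<close>
      then have "x 0 = \<one> \<or> x 1 = \<one> \<or> x 2 = \<one>"
        using x2 d_square by auto
      then show "\<exists>i<3. x i = \<one>"
        unfolding less_3_nat by blast
    qed (intro homs; simp)+
  qed (rule minor, rule maps, simp add: reindex_def cancel)+
  have neq: "?p 0 \<noteq> ?p 1"
    by (subst projection_bool_eq_iff) simp_all
  \<comment> \<open>The two common minors are sent to one of four pairs of binary projections; the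
    facts 1 to 4 exclude the index pairs (0,0), (0,1), (1,0) and (1,1) in turn.\<close>
  show False
    using 1 2 3 4 neq unfolding less_3_nat by auto
qed

end

subsection \<open>Groups with a large core\<close>

lemma (in comm_group) finprod_hom_single:
  assumes f: "f \<in> hom (gpow k) G" and x: "x \<in> carrier (gpow k)"
  shows "f x = finprod G (\<lambda>i. f (single k i (x i))) {..<k}"
proof -
  interpret K: comm_group "gpow k" by (rule comm_group_power)
  interpret f: group_hom "gpow k" G f by (rule group_hom_power[OF f])
  have closed: "f (single k i (x i)) \<in> carrier G" if "i < k" for i
    using f.hom_closed[OF single_carrier[OF group_power_coord[OF x that]]] .
  have "f (\<lambda>i\<in>{..<k}. if i < l then x i else \<one>) = finprod G (\<lambda>i. f (single k i (x i))) {..<l}" if "l \<le> k" for l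
    using that
  proof (induction l)
    case 0
    have "(\<lambda>i\<in>{..<k}. if i < 0 then x i else \<one>) = \<one>\<^bsub>gpow k\<^esub>" by simp
    then show ?case using f.hom_one by (simp only: lessThan_0 finprod_empty)
  next
    case (Suc l)
    then have l: "l < k" by simp
    let ?y = "\<lambda>i\<in>{..<k}. if i < l then x i else \<one>"
    have y: "?y \<in> carrier (gpow k)"
      using group_power_coord[OF x] by (simp add: PiE_iff)
    have "(\<lambda>i\<in>{..<k}. if i < Suc l then x i else \<one>) = single k l (x l) \<otimes>\<^bsub>gpow k\<^esub> ?y"
      unfolding mult_group_power
      by (rule restrict_ext) (use group_power_coord[OF x] l in \<open>auto simp: single_def less_Suc_eq simp del: carrier_product_group\<close>)
    then have "f (\<lambda>i\<in>{..<k}. if i < Suc l then x i else \<one>) = f (single k l (x l)) \<otimes> f ?y"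
      using f.hom_mult[OF single_carrier[OF group_power_coord[OF x l]] y] by (simp only:)
    also have "f ?y = finprod G (\<lambda>i. f (single k i (x i))) {..<l}"
      by (rule Suc.IH) (use l in simp)
    also have "f (single k l (x l)) \<otimes> finprod G (\<lambda>i. f (single k i (x i))) {..<l} =
        finprod G (\<lambda>i. f (single k i (x i))) (insert l {..<l})"
      by (rule finprod_insert[symmetric]) (use closed l in auto)
    finally show ?case by (simp add: lessThan_Suc)
  qed
  from this[of k] have "f (\<lambda>i\<in>{..<k}. if i < k then x i else \<one>) = finprod G (\<lambda>i. f (single k i (x i))) {..<k}"
    by simp
  moreover have "(\<lambda>i\<in>{..<k}. if i < k then x i else \<one>) = x"
    using x by (auto simp: PiE_iff extensional_def fun_eq_iff)
  ultimately show ?thesis by simp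
qed

locale large_core = comm_group G for G :: "('a, 'b) monoid_scheme" (structure) +
  fixes m :: nat
  assumes finite_core: "finite (powers m)" and large: "3 \<le> card (powers m)"
begin

lemma hom_core: "h \<in> hom G G \<Longrightarrow> x \<in> powers m \<Longrightarrow> h x \<in> powers m"
proof -
  assume h: "h \<in> hom G G" and x: "x \<in> powers m"
  interpret group_hom G G h
    by (intro group_hom.intro group_hom_axioms.intro is_group h)
  from x show ?thesis
    unfolding powers_def by (auto simp: hom_nat_pow)
qed

lemma finprod_core: "finite I \<Longrightarrow> (\<And>i. i \<in> I \<Longrightarrow> f i \<in> powers m) \<Longrightarrow> finprod G f I \<in> powers m"
proof (induction I rule: finite_induct)
  case (insert i I)
  then show ?case
    using powers_carrier powers_mult by (subst finprod_insert) auto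
qed (simp add: one_in_powers)

text \<open>If \<open>h\<close> were constant on nontrivial core elements, the quotient of two
  distinct ones would be nontrivial and yet sent to \<open>\<one>\<close>. A core of size at least
  three contains two such elements.\<close>

lemma two_values:
  assumes h: "h \<in> hom G G" and y: "y \<in> powers m" "h y \<noteq> \<one>"
  shows "\<exists>a\<in>powers m - {\<one>}. h a \<noteq> h y"
proof (rule ccontr)
  interpret h: group_hom G G h
    by (intro group_hom.intro group_hom_axioms.intro is_group h)
  assume "\<not> ?thesis"
  then have same: "h a = h y" if "a \<in> powers m" "a \<noteq> \<one>" for a
    using that by blast
  have "\<not> powers m \<subseteq> {\<one>, y}"
  proof
    assume "powers m \<subseteq> {\<one>, y}"
    then have "card (powers m) \<le> card {\<one>, y}" by (simp add: card_mono)
    also have "\<dots> \<le> 2" using card_insert_le_m1[of 2 "{y}" \<one>] by simp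
    finally show False using large by simp
  qed
  then obtain a where a: "a \<in> powers m" "a \<noteq> \<one>" "a \<noteq> y" by blast
  note c = powers_carrier[OF a(1)] powers_carrier[OF y(1)]
  have "a \<otimes> inv y \<noteq> \<one>"
    using a(3) eq_of_diff_one c by blast
  then have "h (a \<otimes> inv y) = h y"
    using same powers_mult[OF a(1) powers_inv[OF y(1)]] by blast
  moreover have "h (a \<otimes> inv y) = \<one>"
    using same[OF a(1,2)] c by simp
  ultimately show False using y(2) by simp
qed

lemma component_hom: "polymorphic k f \<Longrightarrow> (\<lambda>y. f (single k i y)) \<in> hom G G"
  using Group.hom_compose[OF single_hom[of k i]] unfolding polymorphic_def comp_def by blast

lemma no_kernel_on_core:
  assumes f: "polymorphic k f" and u: "\<And>i. i < k \<Longrightarrow> u i \<in> powers m \<and> u i \<noteq> \<one>"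
  shows "finprod G (\<lambda>i. f (single k i (u i))) {..<k} \<noteq> \<one>"
proof
  let ?x = "\<lambda>i\<in>{..<k}. u i"
  assume "finprod G (\<lambda>i. f (single k i (u i))) {..<k} = \<one>"
  moreover have x: "?x \<in> carrier (gpow k)"
    using u by (auto simp: PiE_iff dest: powers_carrier)
  moreover have "f ?x = finprod G (\<lambda>i. f (single k i (?x i))) {..<k}"
    by (rule finprod_hom_single[OF _ x]) (use f in \<open>simp add: polymorphic_def\<close>)
  moreover have "finprod G (\<lambda>i. f (single k i (?x i))) {..<k} = finprod G (\<lambda>i. f (single k i (u i))) {..<k}"
    using hom_in_carrier[OF component_hom[OF f]] powers_carrier[of "u _" m] u
    by (intro finprod_cong') auto
  ultimately have "f ?x = \<one>" by simp
  then obtain i where "i < k" "?x i = \<one>"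
    using f x unfolding polymorphic_def by blast
  then show False using u by simp
qed

text \<open>Some component is injective on the core, since otherwise nontrivial kernel elements of
  all components would form a forbidden tuple. By finiteness it permutes the core, so a nontrivial
  argument of it cancels any nontrivial product of other values. If a second component were
  nontrivial, \<open>two_values\<close> would make that product nontrivial and again give a
  forbidden tuple.\<close>

lemma essentially_unary:
  assumes f: "polymorphic k f"
  shows "\<exists>i<k. (\<exists>y\<in>powers m. f (single k i y) \<noteq> \<one>) \<and>
    (\<forall>j<k. j \<noteq> i \<longrightarrow> (\<forall>y\<in>powers m. f (single k j y) = \<one>))"
proof -
  define F where "F i y = f (single k i y)" for i y
  have F: "F i \<in> hom G G" for i
    unfolding F_def using component_hom[OF f] .
  have F_hom: "group_hom G G (F i)" for i
    by (intro group_hom.intro group_hom_axioms.intro is_group F)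
  have F_core: "F i y \<in> powers m" if "y \<in> powers m" for i y
    by (rule hom_core[OF F that])
  note no_ker = no_kernel_on_core[OF f, folded F_def]
  have "\<exists>i<k. \<forall>y\<in>powers m. F i y = \<one> \<longrightarrow> y = \<one>"
  proof (rule ccontr)
    assume "\<not> ?thesis"
    then have "\<forall>i. \<exists>u. i < k \<longrightarrow> u \<in> powers m \<and> F i u = \<one> \<and> u \<noteq> \<one>"
      by blast
    then obtain u where u: "\<And>i. i < k \<Longrightarrow> u i \<in> powers m \<and> F i (u i) = \<one> \<and> u i \<noteq> \<one>"
      by metis
    have "finprod G (\<lambda>i. F i (u i)) {..<k} = \<one>"
      using u by (intro finprod_one_eqI) auto
    then show False using no_ker[of u] u by blast
  qed
  then obtain i where i: "i < k" "\<And>y. y \<in> powers m \<Longrightarrow> F i y = \<one> \<Longrightarrow> y = \<one>"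
    by blast
  interpret Fi: group_hom G G "F i" by (rule F_hom)
  have "inj_on (F i) (powers m)"
  proof (rule inj_onI)
    fix x y assume xy: "x \<in> powers m" "y \<in> powers m" "F i x = F i y"
    note c = powers_carrier[OF xy(1)] powers_carrier[OF xy(2)]
    have "F i (x \<otimes> inv y) = \<one>" using xy(3) c by simp
    then have "x \<otimes> inv y = \<one>"
      using i(2) powers_mult[OF xy(1) powers_inv[OF xy(2)]] by blast
    then show "x = y" using eq_of_diff_one c by blast
  qed
  then have surj: "F i ` powers m = powers m"
    using F_core by (intro endo_inj_surj[OF finite_core]) auto
  have "\<not> powers m \<subseteq> {\<one>}"
  proof
    assume "powers m \<subseteq> {\<one>}"
    then have "card (powers m) \<le> card {\<one>}" by (intro card_mono) simp_all
    then show False using large by simp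
  qed
  then obtain w where w: "w \<in> powers m" "w \<noteq> \<one>" by blast
  have "F j y = \<one>" if j: "j < k" "j \<noteq> i" and y: "y \<in> powers m" for j y
  proof (rule ccontr)
    assume Fy: "F j y \<noteq> \<one>"
    interpret Fj: group_hom G G "F j" by (rule F_hom)
    have y1: "y \<noteq> \<one>" using Fy by auto
    obtain a where a: "a \<in> powers m" "a \<noteq> \<one>" "F j a \<noteq> F j y"
      using two_values[OF F y Fy] by blast
    define r where "r = finprod G (\<lambda>l. F l w) ({..<k} - {i, j})"
    have r: "r \<in> powers m"
      unfolding r_def using F_core[OF w(1)] by (intro finprod_core) auto
    \<comment> \<open>since \<open>F j\<close> takes two values on nontrivial elements, one of them does not cancel \<open>r\<close>\<close>
    have "\<exists>c\<in>powers m. c \<noteq> \<one> \<and> F j c \<otimes> r \<noteq> \<one>"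
    proof (rule ccontr)
      assume "\<not> ?thesis"
      then have "F j a \<otimes> r = F j y \<otimes> r"
        using a y y1 by metis
      then show False
        using a(3) powers_carrier[OF r] powers_carrier[OF F_core[OF a(1)]] powers_carrier[OF F_core[OF y]] by simp
    qed
    then obtain c where c: "c \<in> powers m" "c \<noteq> \<one>" "F j c \<otimes> r \<noteq> \<one>" by blast
    have cr: "F j c \<otimes> r \<in> powers m"
      by (rule powers_mult[OF F_core[OF c(1)] r])
    then have "inv (F j c \<otimes> r) \<in> F i ` powers m"
      unfolding surj by (rule powers_inv)
    then obtain v where v: "v \<in> powers m" "F i v = inv (F j c \<otimes> r)"
      by (metis imageE)
    have "v \<noteq> \<one>"
    proof
      assume "v = \<one>"
      then have "inv (F j c \<otimes> r) = \<one>" using v(2) Fi.hom_one by simp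
      then have "F j c \<otimes> r = inv \<one>" using powers_carrier[OF cr] by (metis inv_inv)
      then show False using c(3) by simp
    qed
    define u where "u l = (if l = i then v else if l = j then c else w)" for l
    have u: "u l \<in> powers m \<and> u l \<noteq> \<one>" for l
      using v(1) \<open>v \<noteq> \<one>\<close> c w by (simp add: u_def)
    have Fc: "F l (u l) \<in> carrier G" for l
      using powers_carrier[OF F_core] u by blast
    have "F j c \<in> carrier G" "F i v \<in> carrier G"
      using Fc[of j] Fc[of i] j(2) by (simp_all add: u_def)
    note Fc = Fc this
    have "finprod G (\<lambda>l. F l (u l)) ({..<k} - {i, j}) = r"
      unfolding r_def using Fc powers_carrier[OF F_core[OF w(1)]]
      by (intro finprod_cong') (auto simp: u_def)
    then have "finprod G (\<lambda>l. F l (u l)) (insert j ({..<k} - {i, j})) = F j c \<otimes> r"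
      using Fc j by (subst finprod_insert) (auto simp: u_def)
    then have "finprod G (\<lambda>l. F l (u l)) (insert i (insert j ({..<k} - {i, j}))) = F i v \<otimes> (F j c \<otimes> r)"
      using Fc j by (subst finprod_insert) (auto simp: u_def)
    also have "\<dots> = \<one>"
      unfolding v(2) using powers_carrier[OF cr] by (rule l_inv)
    also have "insert i (insert j ({..<k} - {i, j})) = {..<k}"
      using i(1) j(1) by auto
    finally show False using no_ker[of u] u by blast
  qed
  moreover have "F i w \<noteq> \<one>" using i(2) w by blast
  ultimately show ?thesis
    using i(1) w(1) unfolding F_def by blast
qed

section \<open>The essential argument as a map to projections\<close>

definition essential :: "nat \<Rightarrow> ((nat \<Rightarrow> 'a) \<Rightarrow> 'a) \<Rightarrow> nat" where
  "essential k f = (SOME i. i < k \<and> (\<exists>y\<in>powers m. f (single k i y) \<noteq> \<one>))"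

lemma essential:
  assumes "polymorphic k f"
  shows "essential k f < k" "\<exists>y\<in>powers m. f (single k (essential k f) y) \<noteq> \<one>"
    and "\<And>j y. j < k \<Longrightarrow> j \<noteq> essential k f \<Longrightarrow> y \<in> powers m \<Longrightarrow> f (single k j y) = \<one>"
proof -
  obtain i where i: "i < k" "\<exists>y\<in>powers m. f (single k i y) \<noteq> \<one>"
    "\<And>j y. j < k \<Longrightarrow> j \<noteq> i \<Longrightarrow> y \<in> powers m \<Longrightarrow> f (single k j y) = \<one>"
    using essentially_unary[OF assms] by blast
  have "essential k f = i"
    unfolding essential_def by (rule some_equality) (use i in blast)+
  then show "essential k f < k" "\<exists>y\<in>powers m. f (single k (essential k f) y) \<noteq> \<one>"
    "\<And>j y. j < k \<Longrightarrow> j \<noteq> essential k f \<Longrightarrow> y \<in> powers m \<Longrightarrow> f (single k j y) = \<one>"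
    using i by blast+
qed

lemma essential_unique:
  assumes "polymorphic k f" "i < k" "y \<in> powers m" "f (single k i y) \<noteq> \<one>"
  shows "essential k f = i"
  using essential(3)[OF assms(1,2)] assms(3,4) by blast

lemma eval_on_core:
  assumes f: "polymorphic k f" and x: "\<And>i. i < k \<Longrightarrow> x i \<in> powers m" "x \<in> extensional {..<k}"
  shows "f x = f (single k (essential k f) (x (essential k f)))"
proof -
  let ?i = "essential k f"
  have xc: "x \<in> carrier (gpow k)"
    using x by (auto simp: PiE_iff dest: powers_carrier)
  have c: "f (single k i (x i)) \<in> carrier G" if "i < k" for i
    using hom_in_carrier[OF component_hom[OF f]] powers_carrier[OF x(1)[OF that]] .
  have "f x = finprod G (\<lambda>i. f (single k i (x i))) {..<k}"
    by (rule finprod_hom_single[OF _ xc]) (use f in \<open>simp add: polymorphic_def\<close>)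
  also have "{..<k} = insert ?i ({..<k} - {?i})"
    using essential(1)[OF f] by auto
  also have "finprod G (\<lambda>i. f (single k i (x i))) (insert ?i ({..<k} - {?i})) =
      f (single k ?i (x ?i)) \<otimes> finprod G (\<lambda>i. f (single k i (x i))) ({..<k} - {?i})"
    using c essential(1)[OF f] by (intro finprod_insert) auto
  also have "finprod G (\<lambda>i. f (single k i (x i))) ({..<k} - {?i}) = \<one>"
    using essential(3)[OF f] x(1) by (intro finprod_one_eqI) auto
  finally show ?thesis
    using c[OF essential(1)[OF f]] by simp
qed

text \<open>A core element placed at the image under \<open>\<sigma>\<close> of the essential
  argument of \<open>f\<close> reappears at that argument; all other entries passed to
  \<open>f\<close> are core elements, which \<open>f\<close> ignores there.\<close>

lemma essential_minor:
  assumes f: "polymorphic k f" and g: "polymorphic l g" and \<sigma>: "\<sigma> \<in> {..<k} \<rightarrow> {..<l}"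
    and eq: "\<And>x. x \<in> carrier (gpow l) \<Longrightarrow> g x = f (reindex k \<sigma> x)"
  shows "essential l g = \<sigma> (essential k f)"
proof -
  let ?i = "essential k f"
  obtain y where y: "y \<in> powers m" "f (single k ?i y) \<noteq> \<one>"
    using essential(2)[OF f] by blast
  have i: "?i < k" "\<sigma> ?i < l"
    using essential(1)[OF f] \<sigma> by auto
  let ?x = "reindex k \<sigma> (single l (\<sigma> ?i) y)"
  have "g (single l (\<sigma> ?i) y) = f ?x"
    by (rule eq[OF single_carrier[OF powers_carrier[OF y(1)]]])
  also have "\<dots> = f (single k ?i (?x ?i))"
  proof (rule eval_on_core[OF f])
    show "?x j \<in> powers m" if "j < k" for j
      using that funcset_mem[OF \<sigma>, of j] y(1) one_in_powers by (simp add: reindex_def single_def)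
  qed (simp add: reindex_def)
  also have "?x ?i = y"
    using i by (simp add: reindex_def single_def)
  finally show ?thesis
    using essential_unique[OF g i(2) y(1)] y(2) by simp
qed

text \<open>The essential argument is detected by a tuple over the finite core, so the core serves
  as the finite set for uniform continuity.\<close>

theorem exists_minor_preserving_map:
  "\<exists>\<xi>. minor_preserving (carrier G) (Pol group_neq_sig (group_neq_struct G))
      (UNIV :: bool set) (projection_clone UNIV) \<xi> \<and>
    uniformly_continuous_clone_map (carrier G) (Pol group_neq_sig (group_neq_struct G)) \<xi>"
proof -
  define \<xi> where "\<xi> k f = projection (UNIV :: bool set) k (essential k f)" for k f
  have "minor_preserving (carrier G) (Pol group_neq_sig (group_neq_struct G))
      (UNIV :: bool set) (projection_clone UNIV) \<xi>"
    unfolding minor_preserving_def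
  proof (intro conjI allI ballI)
    show "\<xi> k \<in> Pol group_neq_sig (group_neq_struct G) k \<rightarrow> projection_clone UNIV k" for k
      using essential(1) by (auto simp: \<xi>_def projection_clone_def Pol_iff)
    fix k l :: nat and f :: "(nat \<Rightarrow> 'a) \<Rightarrow> 'a" and \<sigma> :: "nat \<Rightarrow> nat"
    assume f: "f \<in> Pol group_neq_sig (group_neq_struct G) k" and \<sigma>: "\<sigma> \<in> {..<k} \<rightarrow> {..<l}"
    then have pf: "polymorphic k f" and k: "1 \<le> k" by (auto simp: Pol_iff)
    let ?g = "\<lambda>x. f (reindex k \<sigma> x)"
    have pg: "polymorphic l ?g"
      unfolding polymorphic_def
    proof (intro conjI ballI impI)
      show "?g \<in> hom (gpow l) G"
        using Group.hom_compose[OF reindex_hom[OF \<sigma>], of f G] pf by (simp add: polymorphic_def comp_def)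
      fix x assume x: "x \<in> carrier (gpow l)" "?g x = \<one>"
      have "reindex k \<sigma> x \<in> carrier (gpow k)"
        by (rule hom_in_carrier[OF reindex_hom[OF \<sigma>] x(1)])
      then obtain i where "i < k" "reindex k \<sigma> x i = \<one>"
        using pf x(2) unfolding polymorphic_def by blast
      then show "\<exists>i<l. x i = \<one>"
        using \<sigma> by (auto simp: reindex_def)
    qed
    have "0 < l" using funcset_mem[OF \<sigma>, of 0] k by simp
    let ?h = "restrict ?g ({..<l} \<rightarrow>\<^sub>E carrier G)"
    have h: "?h \<in> Pol group_neq_sig (group_neq_struct G) l"
      using restrict_in_Pol[OF _ pg] \<open>0 < l\<close> by simp
    have "essential l ?h = \<sigma> (essential k f)"
      by (rule essential_minor[OF pf _ \<sigma>]) (use h in \<open>simp_all add: Pol_iff\<close>)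
    then show "\<xi> l (op_comp (carrier G) k l f (\<lambda>i. projection (carrier G) l (\<sigma> i))) =
        op_comp UNIV k l (\<xi> k f) (\<lambda>i. projection UNIV l (\<sigma> i))"
      unfolding \<xi>_def op_comp_projection_projection[OF \<sigma> essential(1)[OF pf]]
      unfolding op_comp_projection[OF \<sigma>] by simp
  qed
  moreover have "uniformly_continuous_clone_map (carrier G) (Pol group_neq_sig (group_neq_struct G)) \<xi>"
    unfolding uniformly_continuous_clone_map_def
  proof (intro exI conjI allI ballI impI)
    show "finite (powers m)" by (rule finite_core)
    show "powers m \<subseteq> carrier G" using powers_carrier by blast
    fix k :: nat and f g :: "(nat \<Rightarrow> 'a) \<Rightarrow> 'a"
    assume f: "f \<in> Pol group_neq_sig (group_neq_struct G) k" and g: "g \<in> Pol group_neq_sig (group_neq_struct G) k"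
      and eq: "\<forall>x\<in>{..<k} \<rightarrow>\<^sub>E powers m. f x = g x"
    have pf: "polymorphic k f" and pg: "polymorphic k g"
      using f g by (auto simp: Pol_iff)
    obtain y where y: "y \<in> powers m" "f (single k (essential k f) y) \<noteq> \<one>"
      using essential(2)[OF pf] by blast
    have "single k (essential k f) y \<in> {..<k} \<rightarrow>\<^sub>E powers m"
      using y(1) one_in_powers by (simp add: single_def)
    then have "g (single k (essential k f) y) \<noteq> \<one>"
      using eq y(2) by metis
    then have "essential k g = essential k f"
      by (rule essential_unique[OF pg essential(1)[OF pf] y(1)])
    then show "\<xi> k f = \<xi> k g" by (simp add: \<xi>_def)
  qed
  ultimately show ?thesis by blast
qed

text \<open>At every position the two sides of the identity carry different variables. A suitable
  core element for the variable on the left at the essential position, and \<open>\<one>\<close> for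
  the other two, makes the left value nontrivial and the right one trivial. The outer endomorphisms
  are embeddings fixing \<open>\<one>\<close>, so they cannot equate these values.\<close>

theorem no_pseudo_Siggers: "\<not> pseudo_Siggers group_neq_sig (group_neq_struct G) s"
proof
  assume s: "pseudo_Siggers group_neq_sig (group_neq_struct G) s"
  have univ: "univ (group_neq_struct G) = carrier G"
    by (simp add: group_neq_struct_def group_struct_def)
  obtain e1 e2 where e: "fo_hom group_neq_sig (group_neq_struct G) (group_neq_struct G) e1"
    "fo_hom group_neq_sig (group_neq_struct G) (group_neq_struct G) e2"
    "\<And>x y z. x \<in> carrier G \<Longrightarrow> y \<in> carrier G \<Longrightarrow> z \<in> carrier G \<Longrightarrow>
      e1 (s (reindex 6 siggers_left (vec [x, y, z]))) = e2 (s (reindex 6 siggers_right (vec [x, y, z])))"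
    using s unfolding pseudo_Siggers_def univ apply6_reindex by blast
  have ps: "polymorphic 6 s"
    using s unfolding pseudo_Siggers_def by (simp add: Pol_iff)
  let ?i = "essential 6 s"
  obtain y where y: "y \<in> powers m" "s (single 6 ?i y) \<noteq> \<one>"
    using essential(2)[OF ps] by blast
  have i: "?i < 6" by (rule essential(1)[OF ps])
  have yc: "y \<in> carrier G" by (rule powers_carrier[OF y(1)])
  let ?t = "single 3 (siggers_left ?i) y"
  have L: "siggers_left ?i < 3" "siggers_right ?i < 3" "siggers_left ?i \<noteq> siggers_right ?i"
    using i unfolding less_6_nat by (auto simp: siggers_left_def siggers_right_def)
  have t: "?t = vec [?t 0, ?t 1, ?t 2]"
    by (rule vec_eqI[of _ 3 "carrier G"]) (use single_carrier[OF yc, of 3] in \<open>auto simp: less_3_nat\<close>)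
  have core: "?t j \<in> powers m" if "j < 3" for j
    using that y(1) one_in_powers by (simp add: single_def)
  have eval_side: "s (reindex 6 \<rho> ?t) = s (single 6 ?i (?t (\<rho> ?i)))" if \<rho>: "\<rho> \<in> {..<6} \<rightarrow> {..<3}" for \<rho>
  proof -
    have "s (reindex 6 \<rho> ?t) = s (single 6 ?i (reindex 6 \<rho> ?t ?i))"
    proof (rule eval_on_core[OF ps])
      show "reindex 6 \<rho> ?t j \<in> powers m" if "j < 6" for j
        using core[of "\<rho> j"] that \<rho> by (auto simp: reindex_def)
    qed (simp add: reindex_def)
    then show ?thesis using i by (simp add: reindex_def)
  qed
  have "e1 (s (reindex 6 siggers_left ?t)) = e2 (s (reindex 6 siggers_right ?t))"
    using e(3)[of "?t 0" "?t 1" "?t 2"] core[THEN powers_carrier] t by simp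
  moreover have "?t (siggers_left ?i) = y" "?t (siggers_right ?i) = \<one>"
    using L by (simp_all add: single_def)
  ultimately have "e1 (s (single 6 ?i y)) = e2 (s (single 6 ?i \<one>))"
    by (simp only: eval_side siggers_maps)
  moreover have "s (single 6 ?i \<one>) = \<one>"
    using group_hom.hom_one[OF group_hom_power[of s 6]] ps by (simp only: single_one polymorphic_def)
  ultimately have "e1 (s (single 6 ?i y)) = \<one>"
    using fo_hom_embedding(1)[OF e(2)] by simp
  then show False
    using fo_hom_embedding(2)[OF e(1)] y(2) hom_in_carrier[OF component_hom[OF ps] yc] by blast
qed

end

subsection \<open>The dichotomy\<close>

theorem proposition5p18:
  fixes G :: "('a, 'b) monoid_scheme"
  assumes "comm_group G"
    and "omega_categorical group_sig (group_struct G)"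
  shows "(\<exists>s. pseudo_Siggers group_neq_sig (group_neq_struct G) s) \<longleftrightarrow>
    \<not> (\<exists>\<xi>. minor_preserving (carrier G) (Pol group_neq_sig (group_neq_struct G))
              (UNIV :: bool set) (projection_clone UNIV) \<xi> \<and>
            uniformly_continuous_clone_map (carrier G) (Pol group_neq_sig (group_neq_struct G)) \<xi>)"
proof -
  interpret comm_group G by fact
  obtain n :: nat where n: "0 < n" "\<And>x. x \<in> carrier G \<Longrightarrow> x [^]\<^bsub>G\<^esub> n = \<one>\<^bsub>G\<^esub>"
    using omega_categorical_bounded_exponent[OF assms(2)] by blast
  obtain m where m: "0 < m" "finite (powers m)"
    "\<And>p. prime p \<Longrightarrow> p dvd m \<Longrightarrow> infinite (powers (m div p))"
    using least_finite_powers[OF n] by blast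
  have count: "countable (carrier G)"
    using assms(2) by (simp add: omega_categorical_def group_struct_def)
  show ?thesis
  proof (cases "card (powers m) \<le> 2")
    case True
    obtain g where g: "g \<in> carrier G" "powers m = {\<one>\<^bsub>G\<^esub>, g [^]\<^bsub>G\<^esub> m}"
      "injective_for m (adjoin G {\<one>\<^bsub>G\<^esub>} g)"
      using exists_base_element[OF m(2) True m(1)] by blast
    interpret small_core G n m g
      by unfold_locales (fact n m count g)+
    show ?thesis
      using exists_pseudo_Siggers no_minor_preserving_map by blast
  next
    case False
    interpret large_core G m
      by unfold_locales (use m False in simp_all)
    show ?thesis
      using no_pseudo_Siggers exists_minor_preserving_map by blast
  qed
qed

end
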